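(* Let $\beta\in(0,1)$ and $\alpha\in[-\beta,\beta]$. Let $\{m_n:n\in\mathbb{N}\}$ be a sequence of positive integers with $1\le m_n\le n$ for each $n\in\mathbb{N}$, $\lim_{n\to\infty}m_n=+\infty$, and, with $\gamma_n:=m_n/n$, $\lim_{n\to\infty}\gamma_n=\gamma\in[0,1]$. Let $\{T_n\}$ be the elephant random walk with stops in the triangular array setting with parameters $\alpha,\beta$, and let $\Sigma_n$ be the number of moves up to time $n$ of the underlying elephant random walk with stops (both defined in the context). (i) If $\alpha\in[-\beta,\beta/2)$ then $$\frac{\gamma_nT_n}{\sqrt{\Sigma_{m_n}}}\stackrel{\text{d}}{\to}N\left(0,\frac{\beta\{\gamma+\alpha(1-\gamma)\}^2}{\beta-2\alpha}+\beta\gamma(1-\gamma)\right)\quad\text{as }n\to\infty.$$ (ii) If $\alpha=\beta/2$ then $$\frac{\gamma_nT_n}{\sqrt{\Sigma_{m_n}\log\Sigma_{m_n}}}\stackrel{\text{d}}{\to}N\left(0,\{\gamma+\beta(1-\gamma)/2\}^2\right)\quad\text{as }n\to\infty.$$ (iii) If $\alpha\in(\beta/2,\beta]$ then $$\lim_{n\to\infty}\frac{\gamma_nT_n}{(m_n)^{\alpha}}=\{\gamma+\alpha(1-\gamma)\}M\quad\text{in }L^2,$$ where $M$ is the random variable such that $W_n/n^{\alpha}\to M$ a.s. and in $L^2$. Moreover, $$\frac{\gamma_nT_n-M\cdot\{\gamma_n+\alpha(1-\gamma_n)\}\cdot(m_n)^{\alpha}}{\sqrt{\Sigma_{m_n}}}\stackrel{\text{d}}{\to}N\left(0,\frac{\beta\{\gamma+\alpha(1-\gamma)\}^2}{2\alpha-\beta}+\beta\gamma(1-\gamma)\right)\quad\text{as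 }n\to\infty.$$
   Context: Elephant random walk with stops. Let $s\in[0,1]$, $p,q\in[0,1)$, $r\in(0,1)$ with $p+q+r=1$, and put $\alpha:=p-q$, $\beta:=1-r$, so $\beta\in(0,1)$, $\alpha\in[-\beta,\beta]$. Let $X_1=+1$ with probability $s$ and $X_1=-1$ with probability $1-s$. Let $\{U_n:n\ge1\}$ be independent random variables, independent of $X_1$, with $U_n$ uniform on $\{1,\dots,n\}$, and for $n\in\mathbb{N}=\{1,2,\dots\}$ let $X_{n+1}=X_{U_n}$ with probability $p$, $X_{n+1}=-X_{U_n}$ with probability $q$, and $X_{n+1}=0$ with probability $r$ (these choices being independent of each other and of everything else). Put $W_n=\sum_{k=1}^nX_k$ and $\Sigma_n=\sum_{k=1}^n1_{\{X_k\ne0\}}=\sum_{k=1}^nX_k^2$. It is known that for $\alpha\in(\beta/2,\beta]$ there is a random variable $M$ with $W_n/n^\alpha\to M$ a.s. and in $L^2$. Triangular array setting. Given $\{m_n\}$ with $1\le m_n\le n$, for each $n$ and $1\le k\le n$ let $Y^{(n)}_k=X_k$ for $1\le k\le m_n$ and $Y^{(n)}_k=X^{(n)}_k$ for $m_n<k\le n$, where for $m_n<k\le n$, $X^{(n)}_k=X_{U_{k,n}}$ with probability $p$, $X^{(n)}_k=-X_{U_{k,n}}$ with probability $q$, and $X^{(n)}_k=0$ with probability $r$. Here $\mathcal{U}_n=\{U_{k,n}:m_n<k\le n\}$ is an i.i.d. collection of uniform random variables on $\{1,\dots,m_n\}$, and the collections $\mathcal{U}_n$, $n\in\mathbb{N}$,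 are independent (of each other and of $\{X_i\}$); the choices with probabilities $p,q,r$ are again independent of each other and of everything else. Define $T_n:=\sum_{k=1}^nY^{(n)}_k$. $N(0,\sigma^2)$ is the centered normal law with variance $\sigma^2$; $N(0,0)$ is interpreted as the point mass at $0$. In (ii) the quotient is read as $0$ when $\Sigma_{m_n}=1$. *)

theory Defs
  imports "HOL-Probability.Probability"
begin

datatype source =
    Initial
  | Memory nat
  | Move nat
  | Array_Memory nat nat
  | Array_Move nat nat

text \<open>
  The walk's next step copies, flips or drops the remembered step, which is encoded by a
  random multiplier: \<open>\<xi> n\<close> is 1, -1, 0 with probabilities \<open>p\<close>, \<open>q\<close>, \<open>r\<close>, and
  \<open>X (n + 1) = \<xi> n * X (U n)\<close>. Likewise \<open>V n k\<close> is the remembered time \<open>U_{k,n}\<close> of the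
  triangular array and \<open>\<eta> n k\<close> the corresponding multiplier. Time starts at 1, so
  \<open>X 0\<close>, \<open>U 0\<close>, \<open>m 0\<close> etc. are unconstrained and never matter.
  The locale parameter \<open>P\<close> is the underlying probability space.
\<close>

locale erw_stops_array = prob_space P for P :: "'a measure" +
  fixes s p q r :: real
    and m :: "nat \<Rightarrow> nat"
    and X :: "nat \<Rightarrow> 'a \<Rightarrow> real"
    and U :: "nat \<Rightarrow> 'a \<Rightarrow> nat"
    and \<xi> :: "nat \<Rightarrow> 'a \<Rightarrow> real"
    and V :: "nat \<Rightarrow> nat \<Rightarrow> 'a \<Rightarrow> nat"
    and \<eta> :: "nat \<Rightarrow> nat \<Rightarrow> 'a \<Rightarrow> real"
  assumes s: "0 \<le> s" "s \<le> 1"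
    and p: "0 \<le> p" "p < 1"
    and q: "0 \<le> q" "q < 1"
    and r: "0 < r" "r < 1"
    and pqr: "p + q + r = 1"
    and m: "\<And>n. 1 \<le> n \<Longrightarrow> 1 \<le> m n \<and> m n \<le> n"
    and X_1: "\<P>(\<omega> in P. X 1 \<omega> = 1) = s" "\<P>(\<omega> in P. X 1 \<omega> = - 1) = 1 - s"
    and U_measurable: "\<And>n. 1 \<le> n \<Longrightarrow> U n \<in> measurable P (count_space {1..n})"
    and U_uniform: "\<And>n. 1 \<le> n \<Longrightarrow>
      distr P (count_space {1..n}) (U n) = uniform_count_measure {1..n}"
    and \<xi>: "\<And>n. 1 \<le> n \<Longrightarrow> \<P>(\<omega> in P. \<xi> n \<omega> = 1) = p"
      "\<And>n. 1 \<le> n \<Longrightarrow> \<P>(\<omega> in P. \<xi> n \<omega> = - 1) = q"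
      "\<And>n. 1 \<le> n \<Longrightarrow> \<P>(\<omega> in P. \<xi> n \<omega> = 0) = r"
    and X_step: "\<And>n \<omega>. 1 \<le> n \<Longrightarrow> \<omega> \<in> space P \<Longrightarrow>
      X (n + 1) \<omega> = \<xi> n \<omega> * X (U n \<omega>) \<omega>"
    and V_measurable: "\<And>n k. m n < k \<Longrightarrow> k \<le> n \<Longrightarrow>
      V n k \<in> measurable P (count_space {1..m n})"
    and V_uniform: "\<And>n k. m n < k \<Longrightarrow> k \<le> n \<Longrightarrow>
      distr P (count_space {1..m n}) (V n k) = uniform_count_measure {1..m n}"
    and \<eta>: "\<And>n k. m n < k \<Longrightarrow> k \<le> n \<Longrightarrow> \<P>(\<omega> in P. \<eta> n k \<omega> = 1) = p"
      "\<And>n k. m n < k \<Longrightarrow> k \<le> n \<Longrightarrow> \<P>(\<omega> in P. \<eta> n k \<omega> = - 1) = q"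
      "\<And>n k. m n < k \<Longrightarrow> k \<le> n \<Longrightarrow> \<P>(\<omega> in P. \<eta> n k \<omega> = 0) = r"
    and indep: "indep_vars (\<lambda>_. borel)
      (\<lambda>i. case i of
          Initial \<Rightarrow> X 1
        | Memory n \<Rightarrow> (\<lambda>\<omega>. real (U n \<omega>))
        | Move n \<Rightarrow> \<xi> n
        | Array_Memory n k \<Rightarrow> (\<lambda>\<omega>. real (V n k \<omega>))
        | Array_Move n k \<Rightarrow> \<eta> n k)
      ({Initial} \<union> {Memory n |n. 1 \<le> n} \<union> {Move n |n. 1 \<le> n}
        \<union> {Array_Memory n k |n k. m n < k \<and> k \<le> n}
        \<union> {Array_Move n k |n k. m n < k \<and> k \<le> n})"

definition walk :: "(nat \<Rightarrow> 'a \<Rightarrow> real) \<Rightarrow> nat \<Rightarrow> 'a \<Rightarrow> real" where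
  "walk X n \<omega> = (\<Sum>k=1..n. X k \<omega>)"

definition num_moves :: "(nat \<Rightarrow> 'a \<Rightarrow> real) \<Rightarrow> nat \<Rightarrow> 'a \<Rightarrow> real" where
  "num_moves X n \<omega> = (\<Sum>k=1..n. of_bool (X k \<omega> \<noteq> 0))"

definition array_step ::
  "(nat \<Rightarrow> nat) \<Rightarrow> (nat \<Rightarrow> 'a \<Rightarrow> real) \<Rightarrow> (nat \<Rightarrow> nat \<Rightarrow> 'a \<Rightarrow> nat)
    \<Rightarrow> (nat \<Rightarrow> nat \<Rightarrow> 'a \<Rightarrow> real) \<Rightarrow> nat \<Rightarrow> nat \<Rightarrow> 'a \<Rightarrow> real" where
  "array_step m X V \<eta> n k \<omega> =
    (if k \<le> m n then X k \<omega> else \<eta> n k \<omega> * X (V n k \<omega>) \<omega>)"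

definition array_walk ::
  "(nat \<Rightarrow> nat) \<Rightarrow> (nat \<Rightarrow> 'a \<Rightarrow> real) \<Rightarrow> (nat \<Rightarrow> nat \<Rightarrow> 'a \<Rightarrow> nat)
    \<Rightarrow> (nat \<Rightarrow> nat \<Rightarrow> 'a \<Rightarrow> real) \<Rightarrow> nat \<Rightarrow> 'a \<Rightarrow> real" where
  "array_walk m X V \<eta> n \<omega> = (\<Sum>k=1..n. array_step m X V \<eta> n k \<omega>)"

text \<open>Parametrised by the variance, whereas \<^const>\<open>normal_density\<close> takes the standard deviation.\<close>

definition centered_normal :: "real \<Rightarrow> real measure" where
  "centered_normal v =
    (if v = 0 then return borel 0 else density lborel (normal_density 0 (sqrt v)))"

definition converges_in_distribution ::
  "'a measure \<Rightarrow> (nat \<Rightarrow> 'a \<Rightarrow> real) \<Rightarrow> real measure \<Rightarrow> bool" where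
  "converges_in_distribution P Z \<mu> \<longleftrightarrow> weak_conv_m (\<lambda>n. distr P borel (Z n)) \<mu>"

definition square_integrable :: "'a measure \<Rightarrow> ('a \<Rightarrow> real) \<Rightarrow> bool" where
  "square_integrable P f \<longleftrightarrow>
    f \<in> borel_measurable P \<and> integrable P (\<lambda>\<omega>. (f \<omega>)\<^sup>2)"

definition converges_in_L2 ::
  "'a measure \<Rightarrow> (nat \<Rightarrow> 'a \<Rightarrow> real) \<Rightarrow> ('a \<Rightarrow> real) \<Rightarrow> bool" where
  "converges_in_L2 P Z L \<longleftrightarrow>
    (\<forall>n. square_integrable P (Z n)) \<and> square_integrable P L \<and>
    (\<lambda>n. \<integral>\<omega>. (Z n \<omega> - L \<omega>)\<^sup>2 \<partial>P) \<longlonglongrightarrow> 0"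

end

theory Submission
  imports Defs "HOL-Real_Asymp.Real_Asymp"
begin

text \<open>
  Everything rests on one fact about a single draw. A step that copies, flips or drops a uniformly
  chosen one of \<open>X 1, \<dots>, X j\<close> is, given the past, a move with probability \<open>\<beta> \<Sigma>\<^sub>j / j\<close>, and its
  conditional mean is \<open>\<alpha> W\<^sub>j / j\<close>. This holds for the next step of the walk and, with \<open>j = m\<^sub>n\<close>, for
  every later entry of row \<open>n\<close>, even given the entire walk (\<open>fresh_step_expectation\<close>). Subtracting the
  conditional means writes \<open>\<gamma>\<^sub>n T\<^sub>n\<close> as \<open>(\<gamma>\<^sub>n + \<alpha> (1 - \<gamma>\<^sub>n)) W\<^sub>m\<close>, where \<open>m = m\<^sub>n\<close>, plus \<open>\<gamma>\<^sub>n\<close> times a sum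
  of \<open>n - m\<close> centred row entries. With \<open>a\<^sub>j = \<Gamma>(j + \<alpha>) / \<Gamma>(j)\<close>, the quotient \<open>W\<^sub>j / a\<^sub>j\<close> is a martingale, so
  the first part is a weighted sum of martingale differences, too.

  The conditional variance of such a difference is \<open>\<beta> \<Sigma>\<^sub>j / j\<close>, up to the square of the drift
  \<open>\<alpha> W\<^sub>j / j\<close>, which is of smaller order. The number of moves \<open>\<Sigma>\<^sub>j\<close> is random even to first order: it
  grows like a random multiple of \<open>b\<^sub>j = \<Gamma>(j + \<beta>) / \<Gamma>(j)\<close>. But once it has been observed at a time \<open>k\<close>, its later values
  are \<open>\<Sigma>\<^sub>k b\<^sub>j / b\<^sub>k\<close> with a relative error of order \<open>1 / sqrt \<Sigma>\<^sub>k\<close> (\<open>moves_variance\<close>), and \<open>\<Sigma>\<^sub>k\<close> tends to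
  infinity in probability (\<open>expectation_inverse_moves_le\<close>). Dividing the sum by \<open>sqrt \<Sigma>\<^sub>k\<close> therefore makes
  all conditional variances deterministic up to vanishing errors. Replacing the differences one by one by
  Gaussian factors then shows that weighted sums of differences after time \<open>k\<close> are asymptotically normal,
  with an error that is uniform in the weights (\<open>char_bound\<close>).

  The three regimes differ in the choice of \<open>k\<close>. The variances that add up are multiples of
  \<open>b\<^sub>j / (j a\<^sub>j\<^sub>+\<^sub>1\<^sup>2)\<close>, and by the identity \<open>clock_diff\<close> their sums are read off from
  \<open>c\<^sub>j = b\<^sub>j / a\<^sub>j\<^sup>2\<close>, which behaves like the power \<open>\<beta> - 2 \<alpha>\<close> of \<open>j\<close>. If \<open>\<alpha> < \<beta> / 2\<close> the sum up to \<open>m\<close>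
  is dominated by late times, and if \<open>\<alpha> = \<beta> / 2\<close> it grows like \<open>ln m\<close>. In both cases \<open>k\<close> tends to infinity
  so slowly that \<open>W\<^sub>k\<close> contributes nothing, and Slutsky's lemma exchanges the norming known at time \<open>k\<close> for
  the one in the theorem (\<open>clt_up_to_critical\<close>). If \<open>\<alpha> > \<beta> / 2\<close> the sum converges, and \<open>a\<^sub>m M - W\<^sub>m\<close> is
  \<open>a\<^sub>m\<close> times the tail of the martingale after \<open>k = m\<close>; the normal law comes from this tail together with the
  row, which is independent of it given the past (\<open>supercritical_clt\<close>). For the convergence in mean
  square it is enough that the centred row entries are orthogonal (\<open>supercritical_L2\<close>).
\<close>


section \<open>Gamma quotients and the variance clock\<close>

lemma eventually_powr_cancel:
  "\<forall>\<^sub>F n in sequentially. real n powr e * (f n / real n powr e) = f n"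
  by (rule eventually_mono[OF eventually_gt_at_top[of 0]]) simp

text \<open>
  Up to a constant factor this is the product of \<open>1 + c / i\<close> over \<open>1 \<le> i < n\<close>, the growth of a quantity
  whose expected relative increase at time \<open>i\<close> is \<open>c / i\<close>. The Gamma quotient fixes the constant so that
  \<open>growth c n\<close> is asymptotic to \<open>n powr c\<close>.
\<close>

definition growth :: "real \<Rightarrow> nat \<Rightarrow> real" where
  "growth c n = Gamma (real n + c) / Gamma (real n)"

lemma growth_pos: "-1 < c \<Longrightarrow> 1 \<le> n \<Longrightarrow> 0 < growth c n"
  unfolding growth_def by (intro divide_pos_pos Gamma_real_pos) auto

lemma growth_Suc:
  assumes "-1 < c" "1 \<le> n"
  shows "growth c (Suc n) = growth c n * (1 + c / real n)"
proof -
  have "Gamma ((real n + c) + 1) = (real n + c) * Gamma (real n + c)"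
    by (rule Gamma_plus1) (use assms in \<open>auto elim!: nonpos_Ints_cases\<close>)
  moreover have "Gamma (real n + 1) = real n * Gamma (real n)"
    by (rule Gamma_plus1) (use assms in \<open>auto elim!: nonpos_Ints_cases\<close>)
  moreover have "Gamma (real n) > 0" using assms by (intro Gamma_real_pos) auto
  ultimately show ?thesis using assms
    unfolding growth_def by (simp add: field_simps add.commute)
qed

lemma growth_mono:
  assumes "0 \<le> c" "1 \<le> i" "i \<le> j"
  shows "growth c i \<le> growth c j"
  using assms(3)
proof (induction rule: dec_induct)
  case (step n)
  have "growth c n * 1 \<le> growth c n * (1 + c / real n)"
    using growth_pos[of c n] step assms by (intro mult_left_mono) auto
  then show ?case using step assms growth_Suc[of c n] by simp
qed simp

lemma growth_over_id_antimono:
  assumes "-1 < c" "c \<le> 1" "1 \<le> i" "i \<le> j"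
  shows "growth c j / real j \<le> growth c i / real i"
  using assms(4)
proof (induction rule: dec_induct)
  case (step n)
  have n: "1 \<le> n" using step assms by simp
  have e: "1 + c / real n = (real n + c) / real n" using n by (simp add: field_simps)
  have "growth c (Suc n) / real (Suc n) = growth c n / real n * ((real n + c) / (real n + 1))"
    unfolding growth_Suc[OF assms(1) n] e by (simp add: ac_simps)
  also have "\<dots> \<le> growth c n / real n * 1"
    using growth_pos[of c n] n assms by (intro mult_left_mono) auto
  finally show ?case using step by simp
qed simp

text \<open>
  Gauss's product formula for the Gamma function at \<open>1 + c\<close>, which is positive although \<open>c\<close> need not be.
\<close>

lemma growth_asymptotics:
  assumes "-1 < c"
  shows "(\<lambda>n. growth c n / real n powr c) \<longlonglongrightarrow> 1"
proof -
  define z where "z = 1 + c"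
  have z: "z > 0" "z \<notin> \<int>\<^sub>\<le>\<^sub>0" using assms by (auto simp: z_def elim!: nonpos_Ints_cases)
  have Gz: "Gamma z > 0" using z by (intro Gamma_real_pos)
  have "(\<lambda>n. Gamma z / Gamma_series z n) \<longlonglongrightarrow> Gamma z / Gamma z"
    using Gz by (intro tendsto_divide tendsto_const Gamma_series_LIMSEQ) auto
  then have 1: "(\<lambda>n. Gamma z / Gamma_series z n) \<longlonglongrightarrow> 1" using Gz by simp
  have 2: "(\<lambda>n. real n powr (1 + c) / ((real n + 1) * (real n + 2) powr c)) \<longlonglongrightarrow> 1"
    by real_asymp
  \<comment> \<open>the index shift turns the Pochhammer symbol in the product formula at \<open>1 + c\<close> into \<open>growth c\<close>\<close>
  have "(\<lambda>n. growth c (n + 2) / real (n + 2) powr c) \<longlonglongrightarrow> 1"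
  proof (rule Lim_transform_eventually)
    show "(\<lambda>n. (Gamma z / Gamma_series z n) * (real n powr (1 + c) / ((real n + 1) * (real n + 2) powr c))) \<longlonglongrightarrow> 1"
      using tendsto_mult[OF 1 2] by simp
    show "\<forall>\<^sub>F n in sequentially. (Gamma z / Gamma_series z n) * (real n powr (1 + c) / ((real n + 1) * (real n + 2) powr c))
        = growth c (n + 2) / real (n + 2) powr c"
      using eventually_gt_at_top[of 0]
    proof eventually_elim
      case (elim n)
      have p: "pochhammer z (n + 1) = Gamma (real (n + 2) + c) / Gamma z"
        using pochhammer_Gamma[OF z(2), of "n + 1"] by (simp add: z_def algebra_simps)
      have f: "Gamma (real (n + 2)) = fact n * (real n + 1)"
        using Gamma_fact[of "n + 1", where 'a=real] by (simp add: algebra_simps)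
      have e: "exp (z * ln (real n)) = real n powr (1 + c)"
        using elim by (simp add: powr_def z_def)
      have "Gamma z / Gamma_series z n = Gamma (real (n + 2) + c) / (fact n * real n powr (1 + c))"
        unfolding Gamma_series_def p using Gz e by (simp only: of_real_eq_id id_apply) simp
      moreover have "real n powr (1 + c) > 0" using elim by simp
      ultimately show ?case
        unfolding growth_def f by (simp add: add.commute)
    qed
  qed
  then show ?thesis by (rule LIMSEQ_offset)
qed

lemma growth_filterlim:
  assumes "0 < c"
  shows "filterlim (growth c) at_top sequentially"
proof -
  have "filterlim (\<lambda>n. real n powr c * (growth c n / real n powr c)) at_top sequentially"
    by (rule filterlim_at_top_mult_tendsto_pos[OF growth_asymptotics])
       (use assms in auto, real_asymp)
  then show ?thesis
    by (rule filterlim_cong[THEN iffD1, rotated 3, OF _ refl refl])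
       (rule eventually_powr_cancel)
qed

lemma growth_over_id_tendsto_0:
  assumes "-1 < c" "c < 1"
  shows "(\<lambda>n. growth c n / real n) \<longlonglongrightarrow> 0" (is "?f \<longlonglongrightarrow> _")
proof -
  have "(\<lambda>n. real n powr c / real n * (growth c n / real n powr c)) \<longlonglongrightarrow> 0 * 1"
    using assms by (intro tendsto_mult growth_asymptotics) (auto, real_asymp)
  then have "?f \<longlonglongrightarrow> 0 * 1"
    by (rule Lim_transform_eventually) (rule eventually_mono[OF eventually_gt_at_top[of 0]], simp)
  then show ?thesis by simp
qed

text \<open>
  By the weighted arithmetic-geometric mean inequality, \<open>growth c n / n powr c\<close> increases to 1 and
  \<open>growth c n * (n + c) powr (1 - c) / n\<close> decreases to 1. This traps \<open>growth c n\<close> between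
  \<open>n * (n + c) powr (c - 1)\<close> and \<open>n powr c\<close>, which are \<open>O(n powr (c - 1))\<close> apart.
\<close>

lemma growth_minus_powr:
  assumes "0 < c" "c < 1"
  shows "(\<lambda>n. growth c n - real n powr c) \<longlonglongrightarrow> 0"
proof -
  let ?h = "\<lambda>n. growth c n / real n powr c"
  let ?l = "\<lambda>n. growth c n * (real n + c) powr (1 - c) / real n"
  have upper: "growth c n \<le> real n powr c" if "1 \<le> n" for n
  proof -
    have "incseq (\<lambda>k. ?h (n + k))"
    proof (rule incseq_SucI)
      fix k
      define j where "j = n + k"
      have j: "1 \<le> j" using that by (simp add: j_def)
      have "(1 + 1 / real j) powr c * 1 powr (1 - c) \<le> c * (1 + 1 / real j) + (1 - c) * 1"
        using assms j by (intro Youngs_inequality_0) (auto simp: add_pos_nonneg)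
      then have *: "(1 + 1 / real j) powr c \<le> 1 + c / real j"
        by (simp add: algebra_simps)
      have "real (Suc j) = real j * (1 + 1 / real j)" using j by (simp add: field_simps)
      then have "real (Suc j) powr c = real j powr c * (1 + 1 / real j) powr c"
        using j by (metis powr_mult)
      then have "growth c j * real (Suc j) powr c \<le> growth c (Suc j) * real j powr c"
        using * growth_Suc[of c j] growth_pos[of c j] j assms
          mult_left_mono[OF *, of "growth c j * real j powr c"] by (simp add: algebra_simps)
      then show "?h (n + k) \<le> ?h (n + Suc k)"
        using j by (simp add: j_def[symmetric] divide_simps mult.commute)
    qed
    moreover have "(\<lambda>k. ?h (n + k)) \<longlonglongrightarrow> 1"
      using LIMSEQ_ignore_initial_segment[OF growth_asymptotics, of c n] assms by (simp add: add.commute)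
    ultimately have "?h (n + 0) \<le> 1" by (rule incseq_le)
    then show ?thesis using that by (simp add: divide_simps)
  qed
  have lower: "real n * (real n + c) powr (c - 1) \<le> growth c n" if "1 \<le> n" for n
  proof -
    have "decseq (\<lambda>k. ?l (n + k))"
    proof (rule decseq_SucI)
      fix k
      define j where "j = n + k"
      have j: "1 \<le> j" using that by (simp add: j_def)
      have "(1 + 1 / (real j + c)) powr (1 - c) * 1 powr c \<le> (1 - c) * (1 + 1 / (real j + c)) + c * 1"
        using assms j by (intro Youngs_inequality_0) (auto simp: add_pos_nonneg)
      then have "(1 + 1 / (real j + c)) powr (1 - c) \<le> 1 + (1 - c) / (real j + c)"
        by (simp add: algebra_simps add_divide_distrib)
      also have "\<dots> = (real j + 1) / (real j + c)" using j assms by (simp add: field_simps)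
      finally have *: "(1 + 1 / (real j + c)) powr (1 - c) \<le> (real j + 1) / (real j + c)" .
      have "real (Suc j) + c = (real j + c) * (1 + 1 / (real j + c))"
        using j assms by (simp add: field_simps)
      then have e: "(real (Suc j) + c) powr (1 - c) = (real j + c) powr (1 - c) * (1 + 1 / (real j + c)) powr (1 - c)"
        using j assms by (metis powr_mult)
      have "?l (Suc j) = growth c j * (real j + c) powr (1 - c) / real j *
         ((real j + c) / (real j + 1) * (1 + 1 / (real j + c)) powr (1 - c))"
      proof -
        have gS: "growth c (Suc j) = growth c j * (1 + c / real j)"
          using growth_Suc[of c j] j assms by simp
        have g: "1 + c / real j = (real j + c) / real j" using j by (simp add: field_simps)
        show ?thesis using j assms unfolding e gS g by (simp add: ac_simps)
      qed
      also have "\<dots> \<le> growth c j * (real j + c) powr (1 - c) / real j *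
         ((real j + c) / (real j + 1) * ((real j + 1) / (real j + c)))"
        using growth_pos[of c j] j assms by (intro mult_left_mono *) auto
      also have "\<dots> = ?l j" using j assms by simp
      finally show "?l (n + Suc k) \<le> ?l (n + k)" by (simp add: j_def)
    qed
    moreover have "(\<lambda>k. ?l (n + k)) \<longlonglongrightarrow> 1"
    proof -
      have "(\<lambda>n. ?h n * (real n powr c * (real n + c) powr (1 - c) / real n)) \<longlonglongrightarrow> 1 * 1"
        using assms by (intro tendsto_mult growth_asymptotics) (auto, real_asymp)
      then have "?l \<longlonglongrightarrow> 1 * 1"
        by (rule Lim_transform_eventually) (rule eventually_mono[OF eventually_gt_at_top[of 0]], simp)
      from LIMSEQ_ignore_initial_segment[OF this, of n] show ?thesis by (simp add: add.commute)
    qed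
    ultimately have "?l (n + 0) \<ge> 1" by (rule decseq_ge)
    then have "real n \<le> growth c n * (real n + c) powr (1 - c)" using that by (simp add: divide_simps)
    then have "real n * (real n + c) powr (c - 1) \<le> growth c n * (real n + c) powr (1 - c) * (real n + c) powr (c - 1)"
      by (intro mult_right_mono) auto
    also have "\<dots> = growth c n" using that assms by (simp add: mult.assoc flip: powr_add)
    finally show ?thesis .
  qed
  show ?thesis
  proof (rule tendsto_sandwich)
    show "\<forall>\<^sub>F n in sequentially. real n * (real n + c) powr (c - 1) - real n powr c \<le> growth c n - real n powr c"
      using eventually_ge_at_top[of 1] by eventually_elim (use lower in auto)
    show "\<forall>\<^sub>F n in sequentially. growth c n - real n powr c \<le> 0"
      using eventually_ge_at_top[of 1] by eventually_elim (use upper in auto)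
    show "(\<lambda>n. real n * (real n + c) powr (c - 1) - real n powr c) \<longlonglongrightarrow> 0"
      using assms by real_asymp
  qed simp
qed

text \<open>
  The increment of the martingale \<open>W / growth \<alpha>\<close> at time \<open>j\<close> has, to first order, the conditional variance
  \<open>clock_tick \<alpha> \<beta> j\<close>, up to a factor that is the same for all \<open>j\<close>. Unless \<open>2 * \<alpha> = \<beta>\<close>, the clock changes by
  a constant multiple of the tick, again to first order.
\<close>

definition clock :: "real \<Rightarrow> real \<Rightarrow> nat \<Rightarrow> real" where
  "clock \<alpha> \<beta> n = growth \<beta> n / (growth \<alpha> n)\<^sup>2"

definition clock_tick :: "real \<Rightarrow> real \<Rightarrow> nat \<Rightarrow> real" where
  "clock_tick \<alpha> \<beta> n = growth \<beta> n / (real n * (growth \<alpha> (Suc n))\<^sup>2)"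

lemma clock_pos: "-1 < \<alpha> \<Longrightarrow> -1 < \<beta> \<Longrightarrow> 1 \<le> n \<Longrightarrow> 0 < clock \<alpha> \<beta> n"
  unfolding clock_def using growth_pos[of \<alpha> n] growth_pos[of \<beta> n] by simp

lemma clock_tick_pos: "-1 < \<alpha> \<Longrightarrow> -1 < \<beta> \<Longrightarrow> 1 \<le> n \<Longrightarrow> 0 < clock_tick \<alpha> \<beta> n"
  unfolding clock_tick_def using growth_pos[of \<alpha> "Suc n"] growth_pos[of \<beta> n] by simp

text \<open>
  Because this is an exact identity, sums of ticks can be evaluated by telescoping for all values of \<open>\<alpha>\<close>
  and \<open>\<beta>\<close>. The term \<open>\<alpha>\<^sup>2 / n\<close> is of lower order unless \<open>2 * \<alpha> = \<beta>\<close>, where it shows that the clock decreases.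
\<close>

lemma clock_diff:
  assumes "-1 < \<alpha>" "-1 < \<beta>" "1 \<le> n"
  shows "clock \<alpha> \<beta> n - clock \<alpha> \<beta> (Suc n) = clock_tick \<alpha> \<beta> n * (2 * \<alpha> - \<beta> + \<alpha>\<^sup>2 / real n)"
proof -
  have a: "growth \<alpha> n > 0" "growth \<alpha> (Suc n) = growth \<alpha> n * (1 + \<alpha> / real n)"
    using assms growth_pos growth_Suc by auto
  have b: "growth \<beta> (Suc n) = growth \<beta> n * (1 + \<beta> / real n)"
    using assms growth_Suc by auto
  have q: "1 + \<alpha> / real n > 0" using assms by (simp add: field_simps)
  have "clock \<alpha> \<beta> n - clock \<alpha> \<beta> (Suc n)
      = growth \<beta> n / (growth \<alpha> (Suc n))\<^sup>2 * ((1 + \<alpha> / real n)\<^sup>2 - (1 + \<beta> / real n))"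
  proof -
    have g: "growth \<alpha> n = growth \<alpha> (Suc n) / (1 + \<alpha> / real n)" using a(2) q by simp
    show ?thesis unfolding clock_def b g by (simp add: power_divide right_diff_distrib diff_divide_distrib)
  qed
  also have "(1 + \<alpha> / real n)\<^sup>2 - (1 + \<beta> / real n) = (2 * \<alpha> - \<beta> + \<alpha>\<^sup>2 / real n) / real n"
    using assms by (simp add: field_simps power2_eq_square)
  finally show ?thesis by (simp add: clock_tick_def)
qed

lemma clock_telescope:
  assumes "-1 < \<alpha>" "-1 < \<beta>" "1 \<le> k" "k \<le> n"
  shows "(\<Sum>j=k..<n. clock_tick \<alpha> \<beta> j * (2 * \<alpha> - \<beta> + \<alpha>\<^sup>2 / real j)) = clock \<alpha> \<beta> k - clock \<alpha> \<beta> n"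
  using assms(4)
proof (induction rule: dec_induct)
  case (step n)
  then show ?case using assms clock_diff[of \<alpha> \<beta> n] by simp
qed simp

lemma clock_asymptotics:
  assumes "-1 < \<alpha>" "-1 < \<beta>"
  shows "(\<lambda>n. clock \<alpha> \<beta> n / real n powr (\<beta> - 2 * \<alpha>)) \<longlonglongrightarrow> 1"
proof -
  have "(\<lambda>n. (growth \<beta> n / real n powr \<beta>) / (growth \<alpha> n / real n powr \<alpha>)\<^sup>2) \<longlonglongrightarrow> 1 / 1\<^sup>2"
    using assms by (intro tendsto_intros growth_asymptotics) auto
  moreover have "(growth \<beta> n / real n powr \<beta>) / (growth \<alpha> n / real n powr \<alpha>)\<^sup>2
      = clock \<alpha> \<beta> n / real n powr (\<beta> - 2 * \<alpha>)" for n
  proof -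
    have "(real n powr \<alpha>)\<^sup>2 = real n powr (2 * \<alpha>)"
      by (simp add: power2_eq_square flip: powr_add)
    then show ?thesis by (simp add: clock_def power_divide powr_diff)
  qed
  ultimately show ?thesis by simp
qed

lemma clock_at_top:
  assumes "-1 < \<alpha>" "-1 < \<beta>" "\<alpha> < \<beta> / 2"
  shows "filterlim (clock \<alpha> \<beta>) at_top sequentially"
proof -
  have "filterlim (\<lambda>n. real n powr (\<beta> - 2 * \<alpha>) * (clock \<alpha> \<beta> n / real n powr (\<beta> - 2 * \<alpha>))) at_top sequentially"
    by (rule filterlim_at_top_mult_tendsto_pos[OF clock_asymptotics])
       (use assms in \<open>auto, real_asymp\<close>)
  then show ?thesis
    by (rule filterlim_cong[THEN iffD1, rotated 3, OF _ refl refl])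
       (rule eventually_powr_cancel)
qed

lemma clock_tendsto_1:
  assumes "-1 < \<alpha>" "-1 < \<beta>" "\<alpha> = \<beta> / 2"
  shows "clock \<alpha> \<beta> \<longlonglongrightarrow> 1"
  by (rule Lim_transform_eventually[OF clock_asymptotics[OF assms(1,2)]])
     (rule eventually_mono[OF eventually_gt_at_top[of 0]], simp add: assms(3))

lemma clock_tendsto_0:
  assumes "-1 < \<alpha>" "-1 < \<beta>" "\<alpha> > \<beta> / 2"
  shows "clock \<alpha> \<beta> \<longlonglongrightarrow> 0" (is "?f \<longlonglongrightarrow> _")
proof -
  have "(\<lambda>n. real n powr (\<beta> - 2 * \<alpha>) * (clock \<alpha> \<beta> n / real n powr (\<beta> - 2 * \<alpha>))) \<longlonglongrightarrow> 0 * 1"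
    using assms by (intro tendsto_mult clock_asymptotics) (auto, real_asymp)
  then have "?f \<longlonglongrightarrow> 0 * 1"
    by (rule Lim_transform_eventually) (rule eventually_powr_cancel)
  then show ?thesis by simp
qed

lemma sum_inverse_bounds:
  assumes "1 \<le> k" "k \<le> n"
  shows "ln (real n) - ln (real k) \<le> (\<Sum>j=k..<n. 1 / real j)"
    and "(\<Sum>j=k..<n. 1 / real j) \<le> 1 + ln (real n) - ln (real k)"
proof -
  have ln_le: "ln (real (Suc j)) - ln (real j) \<le> 1 / real j" if "1 \<le> j" for j
  proof -
    have "ln (1 + 1 / real j) \<le> 1 / real j" by (rule ln_add_one_self_le_self) simp
    moreover have "ln (real (Suc j)) - ln (real j) = ln (1 + 1 / real j)"
    proof -
      have "1 + 1 / real j = real (Suc j) / real j" using that by (simp add: field_simps)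
      then show ?thesis using that by (simp add: ln_div)
    qed
    ultimately show ?thesis by simp
  qed
  have ln_ge: "1 / real (Suc j) \<le> ln (real (Suc j)) - ln (real j)" if "1 \<le> j" for j
  proof -
    have "ln (real j / real (Suc j)) \<le> real j / real (Suc j) - 1"
      using that by (intro ln_le_minus_one) auto
    moreover have "real j / real (Suc j) - 1 = - (1 / real (Suc j))" by (simp add: field_simps)
    moreover have "ln (real j / real (Suc j)) = ln (real j) - ln (real (Suc j))"
      using that by (simp add: ln_div)
    ultimately show ?thesis by linarith
  qed
  show "ln (real n) - ln (real k) \<le> (\<Sum>j=k..<n. 1 / real j)"
    using assms(2)
  proof (induction rule: dec_induct)
    case (step n)
    then show ?case using ln_le[of n] assms by simp
  qed simp
  have *: "(\<Sum>j=k..<n. 1 / real (Suc j)) \<le> ln (real n) - ln (real k)"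
    using assms(2)
  proof (induction rule: dec_induct)
    case (step n)
    then show ?case using ln_ge[of n] assms by simp
  qed simp
  show "(\<Sum>j=k..<n. 1 / real j) \<le> 1 + ln (real n) - ln (real k)"
  proof -
    have "(\<Sum>j=k..<n. 1 / real j) + 1 / real n = 1 / real k + (\<Sum>j=k..<n. 1 / real (Suc j))"
      using assms(2)
    proof (induction rule: dec_induct)
      case (step n)
      then show ?case by simp
    qed simp
    moreover have "1 / real k \<le> 1" "0 \<le> 1 / real n" using assms by auto
    ultimately show ?thesis using * by linarith
  qed
qed

section \<open>Convergence in distribution and in probability\<close>

lemma real_distribution_centered_normal:
  assumes "0 \<le> v"
  shows "real_distribution (centered_normal v)"
proof (cases "v = 0")
  case True
  then show ?thesis
    by (auto simp: centered_normal_def real_distribution_def real_distribution_axioms_def prob_space_return)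
next
  case False
  then show ?thesis using assms
    by (auto simp: centered_normal_def real_distribution_def real_distribution_axioms_def
        intro!: prob_space_normal_density)
qed

lemma char_centered_normal:
  assumes "0 \<le> v"
  shows "char (centered_normal v) t = of_real (exp (- (t\<^sup>2 * v / 2)))"
proof (cases "v = 0")
  case True
  then show ?thesis by (simp add: centered_normal_def char_def integral_return)
next
  case False
  then have v: "v > 0" using assms by simp
  interpret prob_space std_normal_distribution
    by (rule prob_space_normal_density) simp
  have "distributed std_normal_distribution lborel (\<lambda>x. x) (\<lambda>x. ennreal (normal_density 0 1 x))"
    by (auto simp: distributed_def distr_id2)
  from normal_density_affine[OF this, of "sqrt v" 0] v
  have "distributed std_normal_distribution lborel (\<lambda>x. sqrt v * x) (\<lambda>x. ennreal (normal_density 0 (sqrt v) x))"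
    by simp
  then have "centered_normal v = distr std_normal_distribution borel (\<lambda>x. sqrt v * x)"
    using False by (auto simp: centered_normal_def distributed_def cong: distr_cong)
  then have "char (centered_normal v) t = char std_normal_distribution (t * sqrt v)"
    by (simp add: char_def integral_distr mult.assoc)
  also have "\<dots> = of_real (exp (- (t\<^sup>2 * v / 2)))"
    using v by (simp add: char_std_normal_distribution power_mult_distrib)
  finally show ?thesis .
qed

text \<open>
  The starting time of a martingale sum can be sent to infinity so slowly that everything which vanishes
  for each fixed starting time still vanishes.
\<close>

lemma diagonal_sequence:
  fixes F :: "nat \<Rightarrow> nat \<Rightarrow> real"
  assumes "\<And>k. F k \<longlonglongrightarrow> 0"
  obtains g :: "nat \<Rightarrow> nat" where "filterlim g at_top sequentially" "\<And>n. g n \<le> n"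
    "(\<lambda>n. F (g n) n) \<longlonglongrightarrow> 0"
proof -
  define S where "S n = {0} \<union> {k. k \<le> n \<and> (\<forall>i\<ge>n. \<bar>F k i\<bar> \<le> 1 / real (k + 1))}" for n
  define g where "g n = Max (S n)" for n
  have fin: "finite (S n)" for n
    by (rule finite_subset[of _ "{..n}"]) (auto simp: S_def)
  have gS: "g n \<in> S n" for n
    unfolding g_def using fin by (intro Max_in) (auto simp: S_def)
  have large: "eventually (\<lambda>n. K \<le> g n) sequentially" for K
  proof -
    have "eventually (\<lambda>i. \<bar>F K i\<bar> < 1 / real (K + 1)) sequentially"
      using order_tendstoD(2)[OF tendsto_rabs_zero[OF assms[of K]], of "1 / real (K + 1)"] by simp
    then obtain N where N: "\<And>i. i \<ge> N \<Longrightarrow> \<bar>F K i\<bar> < 1 / real (K + 1)"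
      by (auto simp: eventually_sequentially)
    have "\<forall>n\<ge>max N K. K \<le> g n"
    proof (intro allI impI)
      fix n assume that: "n \<ge> max N K"
      have "K \<in> S n" using that N by (auto simp: S_def intro!: less_imp_le)
      then show "K \<le> g n" unfolding g_def using fin by (intro Max_ge)
    qed
    then show ?thesis unfolding eventually_sequentially by blast
  qed
  have lim: "filterlim g at_top sequentially"
    using large by (simp add: filterlim_at_top)
  moreover have "g n \<le> n" for n using gS[of n] by (auto simp: S_def)
  moreover have "(\<lambda>n. F (g n) n) \<longlonglongrightarrow> 0"
  proof (rule Lim_null_comparison)
    show "\<forall>\<^sub>F n in sequentially. norm (F (g n) n) \<le> 1 / real (g n + 1)"
      using large[of 1]
    proof eventually_elim
      case (elim n)
      then show ?case using gS[of n] by (auto simp: S_def)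
    qed
    have "(\<lambda>n. 1 / real (n + 1)) \<longlonglongrightarrow> 0"
      using LIMSEQ_inverse_real_of_nat by (simp add: inverse_eq_divide add.commute)
    from filterlim_compose[OF this lim] show "(\<lambda>n. 1 / real (g n + 1)) \<longlonglongrightarrow> 0" .
  qed
  ultimately show ?thesis by (rule that)
qed

lemma cmod_iexp_diff_le: "cmod (iexp x - iexp y) \<le> 2 * min 1 \<bar>x - y\<bar>"
proof -
  have "iexp x - iexp y = iexp y * (iexp (x - y) - 1)"
    by (simp add: right_diff_distrib flip: exp_add)
  then have e: "cmod (iexp x - iexp y) = cmod (iexp (x - y) - 1)"
    by (simp add: norm_mult)
  have "cmod (iexp (x - y) - 1) \<le> \<bar>x - y\<bar>"
    using iexp_approx1[of "x - y" 0] by simp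
  moreover have "cmod (iexp (x - y) - 1) \<le> 2"
    using norm_triangle_ineq4[of "iexp (x - y)" 1] by simp
  ultimately show ?thesis unfolding e     by (smt (verit, best) abs_ge_zero min_def)
qed

text \<open>
  Near 0 the left-hand side is of order \<open>\<bar>x\<bar>\<close>; away from 0 the right-hand side is at least 1.
\<close>

lemma min_1_inverse_sqrt_le:
  fixes x :: real
  assumes "0 \<le> 1 + x"
  shows "min 1 \<bar>1 / sqrt (1 + x) - 1\<bar> \<le> 2 * min 1 \<bar>x\<bar>"
proof (cases "\<bar>x\<bar> \<ge> 1 / 2")
  case False
  define y where "y = sqrt (1 + x)"
  have y2: "y\<^sup>2 = 1 + x" using assms by (simp add: y_def)
  have "(1/2)\<^sup>2 \<le> 1 + x" using False by (simp add: power2_eq_square abs_le_iff)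
  then have y: "1 / 2 \<le> y" unfolding y_def by (rule real_le_rsqrt)
  have "x = (y - 1) * (y + 1)" using y2 by (simp add: power2_eq_square algebra_simps)
  then have "\<bar>x\<bar> = \<bar>y - 1\<bar> * (y + 1)" using y by (simp add: abs_mult)
  then have "\<bar>y - 1\<bar> * 1 \<le> \<bar>x\<bar>" using y mult_left_mono[of 1 "y + 1" "\<bar>y - 1\<bar>"] by simp
  moreover have "\<bar>1 / y - 1\<bar> = \<bar>y - 1\<bar> / y"
  proof -
    have "1 / y - 1 = (1 - y) / y" using y by (simp add: diff_divide_distrib)
    then show ?thesis using y by (simp add: abs_minus_commute)
  qed
  moreover have "\<bar>y - 1\<bar> / y \<le> \<bar>y - 1\<bar> / (1 / 2)" using y by (intro divide_left_mono) auto
  ultimately show ?thesis using False unfolding y_def by (auto simp: min_def)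
qed (auto simp: min_def)

lemma min_1_abs_ln_le:
  fixes x :: real
  assumes "0 < 1 + x"
  shows "min 1 \<bar>ln (1 + x)\<bar> \<le> 2 * min 1 \<bar>x\<bar>"
proof (cases "\<bar>x\<bar> \<ge> 1 / 2")
  case False
  then have "\<bar>ln (1 + x) - x\<bar> \<le> 2 * x\<^sup>2" by (intro abs_ln_one_plus_x_minus_x_bound) auto
  moreover have "2 * x\<^sup>2 \<le> \<bar>x\<bar>"
  proof -
    have "\<bar>x\<bar> * \<bar>x\<bar> \<le> \<bar>x\<bar> * (1 / 2)" using False by (intro mult_left_mono) auto
    then show ?thesis by (simp add: power2_eq_square flip: abs_mult)
  qed
  ultimately have "\<bar>ln (1 + x)\<bar> \<le> 2 * \<bar>x\<bar>" by linarith
  then show ?thesis using False by (auto simp: min_def)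
qed (auto simp: min_def)

lemma min_1_abs_mult_le:
  fixes d \<rho> :: real
  shows "min 1 \<bar>(1 + d) * \<rho> - 1\<bar> \<le> 2 * min 1 \<bar>d\<bar> + 2 * min 1 \<bar>\<rho> - 1\<bar>"
proof (cases "1 \<le> \<bar>d\<bar> \<or> 1 \<le> \<bar>\<rho> - 1\<bar>")
  case True
  then have "min 1 \<bar>d\<bar> = 1 \<or> min 1 \<bar>\<rho> - 1\<bar> = 1" by auto
  moreover have "0 \<le> min 1 \<bar>d\<bar>" "0 \<le> min 1 \<bar>\<rho> - 1\<bar>" "min 1 \<bar>(1 + d) * \<rho> - 1\<bar> \<le> 1" by auto
  moreover have "x \<le> 2 * a + 2 * b" if "a = 1 \<or> b = 1" "0 \<le> a" "0 \<le> b" "x \<le> 1" for x a b :: real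
    using that by auto
  ultimately show ?thesis by blast
next
  case False
  have "(1 + d) * \<rho> - 1 = d + (1 + d) * (\<rho> - 1)" by (simp add: algebra_simps)
  then have "\<bar>(1 + d) * \<rho> - 1\<bar> \<le> \<bar>d\<bar> + \<bar>1 + d\<bar> * \<bar>\<rho> - 1\<bar>" by (metis abs_mult abs_triangle_ineq)
  also have "\<dots> \<le> \<bar>d\<bar> + 2 * \<bar>\<rho> - 1\<bar>" using False by (intro add_left_mono mult_right_mono) auto
  finally show ?thesis using False by (auto simp: min_def)
qed

context prob_space
begin

text \<open>
  Convergence to 0 in probability, expressed through a bounded metric so that it can be verified by
  estimating expectations.
\<close>

definition vanishes_in_prob :: "(nat \<Rightarrow> 'a \<Rightarrow> real) \<Rightarrow> bool" where
  "vanishes_in_prob Z \<longleftrightarrow> (\<lambda>n. expectation (\<lambda>\<omega>. min 1 \<bar>Z n \<omega>\<bar>)) \<longlonglongrightarrow> 0"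

lemma integrable_min_1_abs [intro]:
  fixes f :: "'a \<Rightarrow> real"
  assumes "random_variable borel f"
  shows "integrable M (\<lambda>\<omega>. min 1 \<bar>f \<omega>\<bar>)"
  using assms by (intro integrable_const_bound[where B=1]) auto

lemma vanishes_in_probI:
  assumes "\<And>n. random_variable borel (Z n)"
    and "\<forall>\<^sub>F n in sequentially. integrable M (Y n)"
    and "\<forall>\<^sub>F n in sequentially. AE \<omega> in M. min 1 \<bar>Z n \<omega>\<bar> \<le> Y n \<omega>"
    and "(\<lambda>n. expectation (Y n)) \<longlonglongrightarrow> 0"
  shows "vanishes_in_prob Z"
  unfolding vanishes_in_prob_def
proof (rule tendsto_sandwich[OF _ _ tendsto_const assms(4)])
  show "\<forall>\<^sub>F n in sequentially. 0 \<le> expectation (\<lambda>\<omega>. min 1 \<bar>Z n \<omega>\<bar>)"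
    by (simp add: integral_nonneg)
  show "\<forall>\<^sub>F n in sequentially. expectation (\<lambda>\<omega>. min 1 \<bar>Z n \<omega>\<bar>) \<le> expectation (Y n)"
    using assms(2,3) by eventually_elim (intro integral_mono_AE integrable_min_1_abs assms(1))
qed

lemma vanishes_in_prob_AE:
  assumes "\<And>n. random_variable borel (Z n)" "AE \<omega> in M. (\<lambda>n. Z n \<omega>) \<longlonglongrightarrow> 0"
  shows "vanishes_in_prob Z"
proof -
  have "(\<lambda>n. expectation (\<lambda>\<omega>. min 1 \<bar>Z n \<omega>\<bar>)) \<longlonglongrightarrow> expectation (\<lambda>\<omega>. 0)"
  proof (rule integral_dominated_convergence[where w="\<lambda>_. 1"])
    show "AE \<omega> in M. (\<lambda>n. min 1 \<bar>Z n \<omega>\<bar>) \<longlonglongrightarrow> 0"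
      using assms(2)
    proof eventually_elim
      case (elim \<omega>)
      from tendsto_min[OF tendsto_const[of 1] tendsto_rabs_zero[OF elim]] show ?case by simp
    qed
  qed (use assms(1) in auto)
  then show ?thesis by (simp add: vanishes_in_prob_def)
qed

text \<open>
  Weak convergence makes the \<open>A n\<close> tight: up to a small probability they are bounded by some \<open>K + 1\<close>, and
  then \<open>(A n + B n) * R n\<close> differs from \<open>A n\<close> by at most \<open>(K + 1) * \<bar>R n - 1\<bar> + 2 * \<bar>B n\<bar>\<close>, provided that
  \<open>\<bar>R n - 1\<bar>\<close> and \<open>\<bar>B n\<bar>\<close> are at most 1. Hence both sequences have the same limiting characteristic function.
\<close>

lemma slutsky:
  fixes A B R C :: "nat \<Rightarrow> 'a \<Rightarrow> real"
  assumes [measurable]: "\<And>n. random_variable borel (A n)" "\<And>n. random_variable borel (B n)"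
      "\<And>n. random_variable borel (R n)" "\<And>n. random_variable borel (C n)"
    and \<mu>: "real_distribution \<mu>"
    and char: "\<And>t. (\<lambda>n. expectation (\<lambda>\<omega>. iexp (t * A n \<omega>))) \<longlonglongrightarrow> char \<mu> t"
    and R: "vanishes_in_prob (\<lambda>n \<omega>. R n \<omega> - 1)"
    and B: "vanishes_in_prob B"
    and C: "\<forall>\<^sub>F n in sequentially. AE \<omega> in M. C n \<omega> = (A n \<omega> + B n \<omega>) * R n \<omega>"
  shows "converges_in_distribution M C \<mu>"
proof -
  interpret \<mu>: real_distribution \<mu> by fact
  have rd: "real_distribution (distr M borel (A n))" "real_distribution (distr M borel (C n))" for n
    by (auto intro: real_distribution_distr)
  have char': "char (distr M borel Z) t = expectation (\<lambda>\<omega>. iexp (t * Z \<omega>))"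
    if [measurable]: "random_variable borel Z" for Z t
    by (simp add: char_def integral_distr)
  have weak: "weak_conv_m (\<lambda>n. distr M borel (A n)) \<mu>"
    using rd(1) \<mu> by (rule levy_continuity) (unfold char'[OF assms(1)], rule char)
  \<comment> \<open>a continuous function that is 1 where \<open>\<bar>x\<bar> \<ge> K + 1\<close> and 0 where \<open>\<bar>x\<bar> \<le> K\<close>\<close>
  define f :: "nat \<Rightarrow> real \<Rightarrow> real" where "f K x = min 1 (max 0 (\<bar>x\<bar> - real K))" for K x
  have f_meas [measurable]: "f K \<in> borel_measurable borel" for K unfolding f_def by measurable
  have f_bdd: "0 \<le> f K x" "f K x \<le> 1" for K x by (auto simp: f_def)
  have f_lim: "(\<lambda>n. expectation (\<lambda>\<omega>. f K (A n \<omega>))) \<longlonglongrightarrow> (\<integral>x. f K x \<partial>\<mu>)" for K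
  proof -
    have "(\<lambda>n. \<integral>x. f K x \<partial>distr M borel (A n)) \<longlonglongrightarrow> (\<integral>x. f K x \<partial>\<mu>)"
      using rd(1) \<mu> weak
    proof (rule weak_conv_imp_integral_bdd_continuous_conv)
      show "isCont (f K) x" for x unfolding f_def by (intro continuous_intros)
      show "norm (f K x) \<le> 1" for x using f_bdd[of K x] by simp
    qed
    then show ?thesis by (simp add: integral_distr)
  qed
  have f_0: "(\<lambda>K. \<integral>x. f K x \<partial>\<mu>) \<longlonglongrightarrow> (\<integral>x. 0 \<partial>\<mu>)"
  proof (rule integral_dominated_convergence[where w="\<lambda>_. 1"])
    show "AE x in \<mu>. (\<lambda>K. f K x) \<longlonglongrightarrow> 0"
    proof (rule AE_I2)
      fix x :: real
      obtain N where N: "\<bar>x\<bar> \<le> real N" using real_arch_simple by blast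
      have "f K x = 0" if "K \<ge> N" for K
        using that N of_nat_mono[OF that, where 'a=real] by (simp add: f_def)
      then have "\<forall>\<^sub>F K in sequentially. f K x = 0" by (auto simp: eventually_sequentially)
      then show "(\<lambda>K. f K x) \<longlonglongrightarrow> 0" by (rule tendsto_eventually)
    qed
  qed (use f_bdd in auto)
  have diff: "vanishes_in_prob (\<lambda>n \<omega>. C n \<omega> - A n \<omega>)"
    unfolding vanishes_in_prob_def
  proof (rule tendstoI)
    fix e :: real assume e: "e > 0"
    have "\<forall>\<^sub>F K in sequentially. (\<integral>x. f K x \<partial>\<mu>) < e / 2"
      using order_tendstoD(2)[OF f_0, of "e / 2"] e by simp
    then obtain K where K: "(\<integral>x. f K x \<partial>\<mu>) < e / 2"
      by (auto simp: eventually_sequentially)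
    let ?h = "\<lambda>n \<omega>. f K (A n \<omega>) + ((real K + 2) * min 1 \<bar>R n \<omega> - 1\<bar> + 2 * min 1 \<bar>B n \<omega>\<bar>)"
    have int: "integrable M (\<lambda>\<omega>. f K (A n \<omega>))" for n
      using f_bdd by (intro integrable_const_bound[where B=1]) auto
    have "expectation (?h n) = expectation (\<lambda>\<omega>. f K (A n \<omega>)) +
        ((real K + 2) * expectation (\<lambda>\<omega>. min 1 \<bar>R n \<omega> - 1\<bar>) + 2 * expectation (\<lambda>\<omega>. min 1 \<bar>B n \<omega>\<bar>))" for n
      using int by (subst Bochner_Integration.integral_add) (auto simp: integrable_min_1_abs)
    moreover have "(\<lambda>n. expectation (\<lambda>\<omega>. f K (A n \<omega>)) +
        ((real K + 2) * expectation (\<lambda>\<omega>. min 1 \<bar>R n \<omega> - 1\<bar>) + 2 * expectation (\<lambda>\<omega>. min 1 \<bar>B n \<omega>\<bar>)))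
        \<longlonglongrightarrow> (\<integral>x. f K x \<partial>\<mu>) + ((real K + 2) * 0 + 2 * 0)"
      using R B unfolding vanishes_in_prob_def
      by (intro tendsto_add tendsto_mult tendsto_const f_lim)
    ultimately have "(\<lambda>n. expectation (?h n)) \<longlonglongrightarrow> (\<integral>x. f K x \<partial>\<mu>) + ((real K + 2) * 0 + 2 * 0)"
      by simp
    then have "\<forall>\<^sub>F n in sequentially. expectation (?h n) < e"
      by (rule order_tendstoD) (use K e in simp)
    then show "\<forall>\<^sub>F n in sequentially. dist (expectation (\<lambda>\<omega>. min 1 \<bar>C n \<omega> - A n \<omega>\<bar>)) 0 < e"
      using C
    proof eventually_elim
      case (elim n)
      have "expectation (\<lambda>\<omega>. min 1 \<bar>C n \<omega> - A n \<omega>\<bar>) \<le> expectation (?h n)"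
      proof (rule integral_mono_AE)
        show "integrable M (?h n)" using int by (auto simp: integrable_min_1_abs)
        show "AE \<omega> in M. min 1 \<bar>C n \<omega> - A n \<omega>\<bar> \<le> ?h n \<omega>"
          using elim(2)
        proof eventually_elim
          case (elim \<omega>)
          let ?a = "A n \<omega>" and ?b = "B n \<omega>" and ?r = "R n \<omega> - 1"
          have "C n \<omega> - ?a = ?a * ?r + ?b * (1 + ?r)" by (simp add: elim algebra_simps)
          then have le: "\<bar>C n \<omega> - ?a\<bar> \<le> \<bar>?a\<bar> * \<bar>?r\<bar> + \<bar>?b\<bar> * \<bar>1 + ?r\<bar>"
            by (metis abs_triangle_ineq abs_mult)
          show ?case
          proof (cases "\<bar>?a\<bar> \<ge> real K + 1 \<or> \<bar>?r\<bar> \<ge> 1 \<or> \<bar>?b\<bar> \<ge> 1")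
            case True
            then have "f K ?a = 1 \<or> min 1 \<bar>?r\<bar> = 1 \<or> min 1 \<bar>?b\<bar> = 1"
              by (auto simp: f_def)
            moreover have "0 \<le> (real K + 2) * min 1 \<bar>?r\<bar>" "0 \<le> min 1 \<bar>?b\<bar>" "min 1 \<bar>C n \<omega> - ?a\<bar> \<le> 1" by auto
            moreover have "min 1 \<bar>?r\<bar> = 1 \<Longrightarrow> 1 \<le> (real K + 2) * min 1 \<bar>?r\<bar>" by simp
            ultimately show ?thesis using f_bdd(1)[of K ?a] by linarith
          next
            case False
            then have "\<bar>?a\<bar> * \<bar>?r\<bar> \<le> (real K + 2) * \<bar>?r\<bar>" "\<bar>?b\<bar> * \<bar>1 + ?r\<bar> \<le> \<bar>?b\<bar> * 2"
              by (auto intro!: mult_right_mono mult_left_mono)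
            then show ?thesis using False le f_bdd(1)[of K ?a] by (auto simp: min_def)
          qed
        qed
      qed (auto simp: integrable_min_1_abs)
      then show ?case using elim(1) by (simp add: integral_nonneg)
    qed
  qed
  have char_C: "(\<lambda>n. expectation (\<lambda>\<omega>. iexp (t * C n \<omega>))) \<longlonglongrightarrow> char \<mu> t" for t
  proof -
    have "(\<lambda>n. expectation (\<lambda>\<omega>. iexp (t * C n \<omega>)) - expectation (\<lambda>\<omega>. iexp (t * A n \<omega>))) \<longlonglongrightarrow> 0"
    proof (rule Lim_null_comparison[OF always_eventually], intro allI)
      fix n
      have "norm (expectation (\<lambda>\<omega>. iexp (t * C n \<omega>)) - expectation (\<lambda>\<omega>. iexp (t * A n \<omega>)))
          = norm (expectation (\<lambda>\<omega>. iexp (t * C n \<omega>) - iexp (t * A n \<omega>)))"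
        by (subst Bochner_Integration.integral_diff) (auto intro!: integrable_iexp)
      also have "\<dots> \<le> expectation (\<lambda>\<omega>. norm (iexp (t * C n \<omega>) - iexp (t * A n \<omega>)))"
        by (rule integral_norm_bound)
      also have "\<dots> \<le> expectation (\<lambda>\<omega>. 2 * ((1 + \<bar>t\<bar>) * min 1 \<bar>C n \<omega> - A n \<omega>\<bar>))"
      proof (rule integral_mono)
        fix \<omega>
        have "norm (iexp (t * C n \<omega>) - iexp (t * A n \<omega>)) \<le> 2 * min 1 \<bar>t * C n \<omega> - t * A n \<omega>\<bar>"
          using cmod_iexp_diff_le[of "t * C n \<omega>" "t * A n \<omega>"] by simp
        also have "\<bar>t * C n \<omega> - t * A n \<omega>\<bar> = \<bar>t\<bar> * \<bar>C n \<omega> - A n \<omega>\<bar>"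
          by (simp flip: right_diff_distrib abs_mult)
        also have "min 1 (\<bar>t\<bar> * \<bar>C n \<omega> - A n \<omega>\<bar>) \<le> (1 + \<bar>t\<bar>) * min 1 \<bar>C n \<omega> - A n \<omega>\<bar>"
          by (auto simp: min_def algebra_simps)
        finally show "norm (iexp (t * C n \<omega>) - iexp (t * A n \<omega>)) \<le> 2 * ((1 + \<bar>t\<bar>) * min 1 \<bar>C n \<omega> - A n \<omega>\<bar>)"
          by simp
      next
        show "integrable M (\<lambda>\<omega>. norm (iexp (t * C n \<omega>) - iexp (t * A n \<omega>)))"
          by (intro integrable_norm Bochner_Integration.integrable_diff integrable_iexp) auto
      qed (auto intro!: integrable_min_1_abs)
      also have "\<dots> = 2 * (1 + \<bar>t\<bar>) * expectation (\<lambda>\<omega>. min 1 \<bar>C n \<omega> - A n \<omega>\<bar>)"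
        by simp
      finally show "norm (expectation (\<lambda>\<omega>. iexp (t * C n \<omega>)) - expectation (\<lambda>\<omega>. iexp (t * A n \<omega>)))
          \<le> 2 * (1 + \<bar>t\<bar>) * expectation (\<lambda>\<omega>. min 1 \<bar>C n \<omega> - A n \<omega>\<bar>)" .
    next
      show "(\<lambda>n. 2 * (1 + \<bar>t\<bar>) * expectation (\<lambda>\<omega>. min 1 \<bar>C n \<omega> - A n \<omega>\<bar>)) \<longlonglongrightarrow> 0"
        using tendsto_mult_right_zero[OF diff[unfolded vanishes_in_prob_def]] .
    qed
    from tendsto_add[OF this char[of t]] show ?thesis by simp
  qed
  show ?thesis
    unfolding converges_in_distribution_def
    using rd(2) \<mu> by (rule levy_continuity) (unfold char'[OF assms(4)], rule char_C)
qed

lemma expectation_le_sqrt_second_moment: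
  assumes "integrable M f" "integrable M (\<lambda>\<omega>. (f \<omega>)\<^sup>2)"
  shows "expectation f \<le> sqrt (expectation (\<lambda>\<omega>. (f \<omega>)\<^sup>2))"
proof -
  have "0 \<le> expectation (\<lambda>\<omega>. (f \<omega>)\<^sup>2) - (expectation f)\<^sup>2"
    using variance_positive[of f] variance_eq[OF assms] by simp
  then have "\<bar>expectation f\<bar> \<le> sqrt (expectation (\<lambda>\<omega>. (f \<omega>)\<^sup>2))"
    by (intro real_le_rsqrt) simp
  then show ?thesis by simp
qed

end

section \<open>Information and fresh independent draws\<close>

lemma measurable_random_index:
  fixes N :: "'a \<Rightarrow> nat" and f :: "nat \<Rightarrow> 'a \<Rightarrow> real"
  assumes [measurable]: "(\<lambda>\<omega>. real (N \<omega>)) \<in> borel_measurable M"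
    and N: "\<And>\<omega>. \<omega> \<in> space M \<Longrightarrow> N \<omega> \<in> {1..n}"
    and f: "\<And>u. u \<in> {1..n} \<Longrightarrow> f u \<in> borel_measurable M"
  shows "(\<lambda>\<omega>. f (N \<omega>) \<omega>) \<in> borel_measurable M"
proof -
  have "(\<lambda>\<omega>. \<Sum>u=1..n. indicator {\<omega> \<in> space M. real (N \<omega>) = real u} \<omega> * f u \<omega>) \<in> borel_measurable M"
    by (rule borel_measurable_sum) (use f in measurable)
  moreover have "(\<Sum>u=1..n. indicator {\<omega> \<in> space M. real (N \<omega>) = real u} \<omega> * f u \<omega>) = f (N \<omega>) \<omega>"
    if \<omega>: "\<omega> \<in> space M" for \<omega>
  proof -
    have "(\<Sum>u=1..n. indicator {\<omega> \<in> space M. real (N \<omega>) = real u} \<omega> * f u \<omega>)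
        = (\<Sum>u=1..n. if u = N \<omega> then f u \<omega> else 0)"
      using \<omega> by (intro sum.cong refl) (auto simp: indicator_def)
    then show ?thesis using N[OF \<omega>] by (simp add: sum.delta')
  qed
  ultimately show ?thesis by (rule measurable_cong[THEN iffD1, rotated])
qed

context prob_space
begin

text \<open>
  The \<open>\<sigma>\<close>-algebra generated by the \<open>Y i\<close> with \<open>i \<in> J\<close>, on the sample space of \<open>M\<close> but without its measure,
  so that measurability with respect to it says that a quantity is determined by these variables.
\<close>

definition known :: "('i \<Rightarrow> 'a \<Rightarrow> real) \<Rightarrow> 'i set \<Rightarrow> 'a measure" where
  "known Y J = sigma (space M) (\<Union>i\<in>J. {Y i -` A \<inter> space M |A. A \<in> sets borel})"

lemma space_known [simp]: "space (known Y J) = space M"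
  unfolding known_def by (rule space_measure_of) auto

lemma sets_known:
  "sets (known Y J) = sigma_sets (space M) (\<Union>i\<in>J. {Y i -` A \<inter> space M |A. A \<in> sets borel})"
  unfolding known_def by (intro sets_measure_of) auto

lemma measurable_known [intro]: "i \<in> J \<Longrightarrow> Y i \<in> borel_measurable (known Y J)"
  by (rule measurableI) (auto simp: sets_known intro!: sigma_sets.Basic)

lemma known_mono: "J \<subseteq> K \<Longrightarrow> sets (known Y J) \<subseteq> sets (known Y K)"
  unfolding sets_known by (rule sigma_sets_mono') blast

lemma measurable_known_mono:
  "f \<in> measurable (known Y J) N \<Longrightarrow> J \<subseteq> K \<Longrightarrow> f \<in> measurable (known Y K) N"
  by (rule set_mp[OF measurable_mono[OF order_refl refl known_mono]]) auto

lemma sets_known_subset: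
  assumes "\<And>i. i \<in> J \<Longrightarrow> random_variable borel (Y i)"
  shows "sets (known Y J) \<subseteq> events"
  unfolding sets_known by (rule sets.sigma_sets_subset) (auto intro!: measurable_sets[OF assms])

lemma measurable_of_known:
  assumes "f \<in> measurable (known Y J) N" "\<And>i. i \<in> J \<Longrightarrow> random_variable borel (Y i)"
  shows "random_variable N f"
  by (rule set_mp[OF measurable_mono[OF order_refl refl sets_known_subset] assms(1)]) (use assms(2) in auto)

lemma indep_var_known:
  assumes Y: "indep_vars (\<lambda>_. borel) Y I" and JK: "J \<subseteq> I" "K \<subseteq> I" "J \<inter> K = {}"
    and f: "f \<in> measurable (known Y J) N" and g: "g \<in> measurable (known Y K) L"
  shows "indep_var N f L g"
  unfolding indep_var_eq
proof (intro conjI)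
  have Ym: "random_variable borel (Y i)" if "i \<in> I" for i
    using Y that by (auto simp: indep_vars_def)
  show "random_variable N f" "random_variable L g"
    using measurable_of_known[OF f] measurable_of_known[OF g] Ym JK by auto
  let ?E = "\<lambda>i. {Y i -` A \<inter> space M |A. A \<in> sets borel}"
  have "indep_sets (\<lambda>b. sigma_sets (space M) (\<Union>i\<in>(case b of True \<Rightarrow> J | False \<Rightarrow> K). ?E i)) UNIV"
  proof (rule indep_sets_collect_sigma)
    show "indep_sets ?E (\<Union>b\<in>UNIV. case b of True \<Rightarrow> J | False \<Rightarrow> K)"
      using Y JK unfolding indep_vars_def2
      by (auto intro: indep_sets_mono_index simp: UNIV_bool)
    show "Int_stable (?E i)" for i
    proof (rule Int_stableI)
      fix a b assume "a \<in> ?E i" "b \<in> ?E i"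
      then obtain A B where "A \<in> sets borel" "B \<in> sets borel"
        "a = Y i -` A \<inter> space M" "b = Y i -` B \<inter> space M" by auto
      then show "a \<inter> b \<in> ?E i" by (intro CollectI exI[of _ "A \<inter> B"]) auto
    qed
    show "disjoint_family_on (\<lambda>b. case b of True \<Rightarrow> J | False \<Rightarrow> K) UNIV"
      using JK(3) by (auto simp: disjoint_family_on_def split: bool.splits)
  qed
  then have ind: "indep_set (sets (known Y J)) (sets (known Y K))"
    unfolding indep_set_def sets_known
    by (rule indep_sets_mono_sets) (auto split: bool.splits)
  have f_sub: "sigma_sets (space M) {f -` A \<inter> space M |A. A \<in> sets N} \<subseteq> sets (known Y J)"
    using sets.sigma_sets_subset[of "{f -` A \<inter> space M |A. A \<in> sets N}" "known Y J"] measurable_sets[OF f]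
    by auto
  have g_sub: "sigma_sets (space M) {g -` A \<inter> space M |A. A \<in> sets L} \<subseteq> sets (known Y K)"
    using sets.sigma_sets_subset[of "{g -` A \<inter> space M |A. A \<in> sets L}" "known Y K"] measurable_sets[OF g]
    by auto
  show "indep_set (sigma_sets (space M) {f -` A \<inter> space M |A. A \<in> sets N})
      (sigma_sets (space M) {g -` A \<inter> space M |A. A \<in> sets L})"
    using ind unfolding indep_set_def
    by (rule indep_sets_mono_sets) (simp add: f_sub g_sub split: bool.splits)
qed

text \<open>
  On each of the finitely many events that fix the values of \<open>V\<close> and \<open>Y iE\<close>, the integrand is determined by
  the variables in \<open>J\<close>, of which the event is independent; so the expectation factorises there.
\<close>

lemma fresh_draw:
  fixes F :: "real \<Rightarrow> 'a \<Rightarrow> 'b::{real_normed_field, banach, second_countable_topology}"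
    and V :: "'a \<Rightarrow> nat"
  assumes Y: "indep_vars (\<lambda>_. borel) Y I" "J \<subseteq> I" "iV \<in> I - J" "iE \<in> I - J" "iV \<noteq> iE"
    and V: "V \<in> measurable M (count_space {1..n})" "distr M (count_space {1..n}) V = uniform_count_measure {1..n}"
    and YV: "Y iV = (\<lambda>\<omega>. real (V \<omega>))"
    and E: "prob {\<omega> \<in> space M. Y iE \<omega> = 1} = p" "prob {\<omega> \<in> space M. Y iE \<omega> = -1} = q"
      "prob {\<omega> \<in> space M. Y iE \<omega> = 0} = r" "p + q + r = 1"
    and X: "\<And>u. u \<in> {1..n} \<Longrightarrow> X u \<in> borel_measurable (known Y J)"
    and F: "(\<lambda>(x, \<omega>). F x \<omega>) \<in> borel_measurable (borel \<Otimes>\<^sub>M known Y J)"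
    and bdd: "\<And>u v. u \<in> {1..n} \<Longrightarrow> v \<in> {1, -1, 0} \<Longrightarrow> AE \<omega> in M. norm (F (v * X u \<omega>) \<omega>) \<le> B"
    and n: "1 \<le> n"
  shows "(\<integral>\<omega>. F (Y iE \<omega> * X (V \<omega>) \<omega>) \<omega> \<partial>M)
    = (\<integral>\<omega>. (\<Sum>u=1..n. of_real p * F (X u \<omega>) \<omega> + of_real q * F (- X u \<omega>) \<omega> + of_real r * F 0 \<omega>) / of_nat n \<partial>M)"
proof -
  have Ym: "random_variable borel (Y i)" if "i \<in> I" for i
    using Y(1) that by (auto simp: indep_vars_def)
  have mY [measurable]: "random_variable borel (Y iE)" "random_variable borel (Y iV)" using Ym Y by auto
  define \<pi> where "\<pi> v = prob {\<omega> \<in> space M. Y iE \<omega> = v}" for v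
  have \<pi>: "\<pi> 1 = p" "\<pi> (-1) = q" "\<pi> 0 = r" using E by (auto simp: \<pi>_def)
  define S where "S = ({1, -1, 0} :: real set)"
  have finS: "finite S" by (simp add: S_def)
  define G where "G u v \<omega> = F (v * X u \<omega>) \<omega>" for u v \<omega>
  have G_known: "G u v \<in> borel_measurable (known Y J)" if "u \<in> {1..n}" for u v
  proof -
    have [measurable]: "X u \<in> borel_measurable (known Y J)" using X that by auto
    have "(\<lambda>\<omega>. (v * X u \<omega>, \<omega>)) \<in> measurable (known Y J) (borel \<Otimes>\<^sub>M known Y J)" by measurable
    from measurable_compose[OF this F] show ?thesis by (simp add: G_def[abs_def])
  qed
  have G_int: "integrable M (G u v)" if "u \<in> {1..n}" "v \<in> S" for u v
  proof (rule integrable_const_bound)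
    show "AE \<omega> in M. norm (G u v \<omega>) \<le> B" using bdd[OF that[unfolded S_def]] by (simp add: G_def)
    show "random_variable borel (G u v)"
      using measurable_of_known[OF G_known[OF that(1)]] Ym Y by auto
  qed
  define D where "D u v \<omega> = (indicator {\<omega> \<in> space M. Y iV \<omega> = real u \<and> Y iE \<omega> = v} \<omega> :: real)" for u v \<omega>
  have D_int: "integrable M (\<lambda>\<omega>. of_real (D u v \<omega>) :: 'b)" for u v
    unfolding D_def by (rule integrable_const_bound[where B=1]) (auto simp: indicator_def)
  have D_known: "(\<lambda>\<omega>. of_real (D u v \<omega>) :: 'b) \<in> borel_measurable (known Y {iV, iE})" for u v
  proof -
    have [measurable]: "Y iV \<in> borel_measurable (known Y {iV, iE})" "Y iE \<in> borel_measurable (known Y {iV, iE})"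
      by auto
    have "{\<omega> \<in> space (known Y {iV, iE}). Y iV \<omega> = real u \<and> Y iE \<omega> = v} \<in> sets (known Y {iV, iE})" by measurable
    then have [measurable]: "{\<omega> \<in> space M. Y iV \<omega> = real u \<and> Y iE \<omega> = v} \<in> sets (known Y {iV, iE})" by simp
    show ?thesis unfolding D_def by measurable
  qed
  have D_exp: "(\<integral>\<omega>. of_real (D u v \<omega>) \<partial>M) = (of_real (\<pi> v) / of_nat n :: 'b)" if "u \<in> {1..n}" for u v
  proof -
    have "indep_var borel (Y iV) borel (Y iE)"
      by (rule indep_var_known[OF Y(1), of "{iV}" "{iE}"]) (use Y in auto)
    from indep_varD[OF this, of "{real u}" "{v}"]
    have "prob ((\<lambda>\<omega>. (Y iV \<omega>, Y iE \<omega>)) -` ({real u} \<times> {v}) \<inter> space M)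
        = prob (Y iV -` {real u} \<inter> space M) * prob (Y iE -` {v} \<inter> space M)" by simp
    also have "(\<lambda>\<omega>. (Y iV \<omega>, Y iE \<omega>)) -` ({real u} \<times> {v}) \<inter> space M
        = {\<omega> \<in> space M. Y iV \<omega> = real u \<and> Y iE \<omega> = v}" by auto
    also have "Y iE -` {v} \<inter> space M = {\<omega> \<in> space M. Y iE \<omega> = v}" by auto
    also have "prob (Y iV -` {real u} \<inter> space M) = 1 / real n"
    proof -
      have "Y iV -` {real u} \<inter> space M = V -` {u} \<inter> space M" by (auto simp: YV)
      also have "prob \<dots> = measure (distr M (count_space {1..n}) V) {u}"
        using V(1) that by (subst measure_distr) auto
      also have "\<dots> = 1 / real n"
        unfolding V(2) using that by (subst measure_uniform_count_measure) auto
      finally show ?thesis .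
    qed
    finally have "prob {\<omega> \<in> space M. Y iV \<omega> = real u \<and> Y iE \<omega> = v} = \<pi> v / real n"
      by (simp add: \<pi>_def)
    then have "(\<integral>\<omega>. D u v \<omega> \<partial>M) = \<pi> v / real n" by (simp add: D_def)
    moreover have "integrable M (D u v)"
      unfolding D_def by (rule integrable_const_bound[where B=1]) (auto simp: indicator_def)
    ultimately show ?thesis
      using integral_bounded_linear[OF bounded_linear_of_real, of M "D u v"] by simp
  qed
  have DG: "(\<integral>\<omega>. of_real (D u v \<omega>) * G u v \<omega> \<partial>M) = (of_real (\<pi> v) / of_nat n) * (\<integral>\<omega>. G u v \<omega> \<partial>M)"
    and DG_int: "integrable M (\<lambda>\<omega>. of_real (D u v \<omega>) * G u v \<omega>)" if "u \<in> {1..n}" "v \<in> S" for u v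
  proof -
    have "indep_var borel (\<lambda>\<omega>. of_real (D u v \<omega>) :: 'b) borel (G u v)"
      by (rule indep_var_known[OF Y(1) _ _ _ D_known G_known[OF that(1)]]) (use Y in auto)
    from indep_var_lebesgue_integral[OF this D_int G_int[OF that]] indep_var_integrable[OF this D_int G_int[OF that]]
    show "(\<integral>\<omega>. of_real (D u v \<omega>) * G u v \<omega> \<partial>M) = (of_real (\<pi> v) / of_nat n) * (\<integral>\<omega>. G u v \<omega> \<partial>M)"
      "integrable M (\<lambda>\<omega>. of_real (D u v \<omega>) * G u v \<omega>)"
      by (simp_all add: D_exp[OF that(1)])
  qed
  have AE_S: "AE \<omega> in M. Y iE \<omega> \<in> S"
  proof -
    have "prob {\<omega> \<in> space M. Y iE \<omega> \<in> S} = (\<Sum>v\<in>S. prob {\<omega> \<in> space M. Y iE \<omega> = v})"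
    proof -
      have "{\<omega> \<in> space M. Y iE \<omega> \<in> S} = (\<Union>v\<in>S. {\<omega> \<in> space M. Y iE \<omega> = v})" by auto
      then show ?thesis
        using finS by (simp, subst finite_measure_finite_Union) (auto simp: disjoint_family_on_def)
    qed
    also have "\<dots> = 1" using E by (simp add: S_def)
    finally show ?thesis using finS by (subst (asm) prob_Collect_eq_1) (auto simp: S_def)
  qed
  have V_in: "V \<omega> \<in> {1..n}" if "\<omega> \<in> space M" for \<omega> using measurable_space[OF V(1) that] by simp
  have "(\<integral>\<omega>. F (Y iE \<omega> * X (V \<omega>) \<omega>) \<omega> \<partial>M) = (\<integral>\<omega>. (\<Sum>u\<in>{1..n}. \<Sum>v\<in>S. of_real (D u v \<omega>) * G u v \<omega>) \<partial>M)"
  proof (rule integral_cong_AE)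
    show "AE \<omega> in M. F (Y iE \<omega> * X (V \<omega>) \<omega>) \<omega> = (\<Sum>u\<in>{1..n}. \<Sum>v\<in>S. of_real (D u v \<omega>) * G u v \<omega>)"
      using AE_S AE_space
    proof eventually_elim
      case (elim \<omega>)
      have "(\<Sum>u\<in>{1..n}. \<Sum>v\<in>S. of_real (D u v \<omega>) * G u v \<omega>)
          = (\<Sum>u\<in>{1..n}. \<Sum>v\<in>S. if u = V \<omega> then if v = Y iE \<omega> then G u v \<omega> else 0 else 0)"
        using elim by (intro sum.cong refl) (auto simp: D_def YV indicator_def)
      also have "\<dots> = (\<Sum>u\<in>{1..n}. if u = V \<omega> then \<Sum>v\<in>S. if v = Y iE \<omega> then G u v \<omega> else 0 else 0)"
        by (intro sum.cong refl) auto
      also have "\<dots> = G (V \<omega>) (Y iE \<omega>) \<omega>"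
        using elim finS V_in[of \<omega>] by (simp add: sum.delta')
      finally show ?case by (simp add: G_def)
    qed
    have sum_meas: "random_variable borel (\<lambda>\<omega>. \<Sum>u\<in>{1..n}. \<Sum>v\<in>S. of_real (D u v \<omega>) * G u v \<omega>)"
      using DG_int by (intro borel_measurable_sum) (auto intro: borel_measurable_integrable)
    show "random_variable borel (\<lambda>\<omega>. \<Sum>u\<in>{1..n}. \<Sum>v\<in>S. of_real (D u v \<omega>) * G u v \<omega>)" by fact
    have F': "(\<lambda>(x, \<omega>). F x \<omega>) \<in> borel_measurable (borel \<Otimes>\<^sub>M M)"
    proof -
      have "(\<lambda>\<omega>. \<omega>) \<in> measurable M (known Y J)"
        using sets_known_subset[of J Y] Ym Y by (intro measurableI) auto
      then have "(\<lambda>(x, \<omega>). (x, \<omega>)) \<in> measurable (borel \<Otimes>\<^sub>M M) (borel \<Otimes>\<^sub>M known Y J)"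
        by measurable
      from measurable_compose[OF this F] show ?thesis by (simp add: case_prod_beta')
    qed
    have "random_variable borel (\<lambda>\<omega>. X (V \<omega>) \<omega>)"
    proof (rule measurable_random_index[OF mY(2)[unfolded YV] V_in])
      show "random_variable borel (X u)" if "u \<in> {1..n}" for u
        by (rule measurable_of_known[OF X[OF that]]) (use Ym Y(2) in blast)
    qed
    then have "(\<lambda>\<omega>. (Y iE \<omega> * X (V \<omega>) \<omega>, \<omega>)) \<in> measurable M (borel \<Otimes>\<^sub>M M)"
      by measurable
    from measurable_compose[OF this F']
    show "random_variable borel (\<lambda>\<omega>. F (Y iE \<omega> * X (V \<omega>) \<omega>) \<omega>)" by simp
  qed
  also have "\<dots> = (\<Sum>u\<in>{1..n}. \<Sum>v\<in>S. (of_real (\<pi> v) / of_nat n) * (\<integral>\<omega>. G u v \<omega> \<partial>M))"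
    using DG DG_int by (simp add: Bochner_Integration.integral_sum Bochner_Integration.integrable_sum)
  also have "\<dots> = (\<integral>\<omega>. (\<Sum>u\<in>{1..n}. \<Sum>v\<in>S. (of_real (\<pi> v) / of_nat n) * G u v \<omega>) \<partial>M)"
    using G_int by (simp add: Bochner_Integration.integral_sum Bochner_Integration.integrable_sum)
  also have "\<dots> = (\<integral>\<omega>. (\<Sum>u=1..n. of_real p * F (X u \<omega>) \<omega> + of_real q * F (- X u \<omega>) \<omega> + of_real r * F 0 \<omega>) / of_nat n \<partial>M)"
    by (simp add: sum_divide_distrib S_def G_def \<pi> add_divide_distrib ac_simps)
  finally show ?thesis .
qed

end

section \<open>Taylor estimates and telescoping for characteristic functions\<close>

text \<open>
  For \<open>y \<ge> 0\<close>, \<open>exp (- y)\<close> lies between \<open>1 - y\<close> and \<open>1 / (1 + y)\<close>.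
\<close>

lemma abs_exp_minus_linear_le:
  fixes y :: real
  assumes "0 \<le> y"
  shows "\<bar>exp (- y) - (1 - y)\<bar> \<le> y\<^sup>2"
proof -
  have "exp (- y) \<le> 1 / (1 + y)"
    using exp_ge_add_one_self[of y] assms by (simp add: exp_minus inverse_eq_divide frac_le)
  also have "1 / (1 + y) \<le> 1 - y + y\<^sup>2"
  proof -
    have "1 \<le> (1 - y + y\<^sup>2) * (1 + y)"
      using assms by (simp add: algebra_simps power2_eq_square)
    then show ?thesis using assms by (simp add: divide_le_eq)
  qed
  finally show ?thesis using exp_ge_add_one_self[of "- y"] by linarith
qed

text \<open>
  The first three terms form the characteristic function at \<open>\<theta>\<close> of a variable with values \<open>1 - \<delta>\<close>, \<open>- \<delta>\<close>,
  \<open>-1 - \<delta>\<close> and probabilities \<open>(a + \<delta>) / 2\<close>, \<open>1 - a\<close>, \<open>(a - \<delta>) / 2\<close>. It has mean 0 and variance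
  \<open>a - \<delta>\<^sup>2\<close>, and since its values are at most 2 in size, its third absolute moment is at most
  \<open>2 * (a - \<delta>\<^sup>2)\<close>. So Taylor expansion to second order gives the first error term. The next two are the
  difference between \<open>\<theta>\<^sup>2 * (a - \<delta>\<^sup>2)\<close> and the target variance \<open>u\<close>, and the last comes from the Gaussian side.
\<close>

lemma lazy_step_char_bound:
  fixes \<theta> a \<delta> u :: real
  assumes a: "\<bar>\<delta>\<bar> \<le> a" "a \<le> 1" and u: "0 \<le> u"
  defines "f \<equiv> \<lambda>x. iexp (\<theta> * (x - \<delta>))"
  shows "cmod (f 0 + of_real \<delta> * ((f 1 - f (-1)) / 2) + of_real a * ((f 1 + f (-1)) / 2 - f 0) - of_real (exp (- u / 2)))
    \<le> \<bar>\<theta>\<bar>^3 * a / 3 + \<theta>\<^sup>2 * \<delta>\<^sup>2 / 2 + \<bar>\<theta>\<^sup>2 * a - u\<bar> / 2 + u\<^sup>2 / 4"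
proof -
  define T where "T x = 1 + \<i> * (\<theta> * (x - \<delta>)) - of_real ((\<theta> * (x - \<delta>))\<^sup>2 / 2)" for x :: real
  define R where "R x = f x - T x" for x
  have R: "cmod (R x) \<le> \<bar>\<theta>\<bar>^3 * \<bar>x - \<delta>\<bar>^3 / 6" for x
  proof -
    have "(\<Sum>k\<le>2. (\<i> * (\<theta> * (x - \<delta>)))^k / fact k) = T x"
      by (simp add: T_def numeral_2_eq_2 power2_eq_square field_simps)
    then have "cmod (R x) \<le> \<bar>\<theta> * (x - \<delta>)\<bar>^3 / 6"
      using iexp_approx1[of "\<theta> * (x - \<delta>)" 2] by (simp add: R_def f_def fact_numeral)
    then show ?thesis by (simp add: abs_mult power_mult_distrib)
  qed
  have cube: "\<bar>x - \<delta>\<bar>^3 \<le> 2 * (x - \<delta>)\<^sup>2" if "x \<in> {-1, 0, 1}" for x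
  proof -
    have "\<bar>x - \<delta>\<bar> \<le> 2" using that a by auto
    then have "\<bar>x - \<delta>\<bar> * (x - \<delta>)\<^sup>2 \<le> 2 * (x - \<delta>)\<^sup>2" by (intro mult_right_mono) auto
    then show ?thesis by (simp add: power3_eq_cube power2_eq_square abs_mult_self_eq flip: abs_mult)
  qed
  have Rx: "cmod (R x) \<le> \<bar>\<theta>\<bar>^3 / 3 * (x - \<delta>)\<^sup>2" if "x \<in> {-1, 0, 1}" for x
  proof -
    have "\<bar>\<theta>\<bar>^3 * \<bar>x - \<delta>\<bar>^3 / 6 \<le> \<bar>\<theta>\<bar>^3 * (2 * (x - \<delta>)\<^sup>2) / 6"
      using cube[OF that] by (intro divide_right_mono mult_left_mono) auto
    then show ?thesis using R[of x] by simp
  qed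
  define w0 w1 wm where "w0 = 1 - a" and "w1 = (a + \<delta>) / 2" and "wm = (a - \<delta>) / 2"
  have w: "0 \<le> w0" "0 \<le> w1" "0 \<le> wm" using a by (auto simp: w0_def w1_def wm_def)
  have \<phi>: "f 0 + of_real \<delta> * ((f 1 - f (-1)) / 2) + of_real a * ((f 1 + f (-1)) / 2 - f 0)
    = of_real w0 * f 0 + of_real w1 * f 1 + of_real wm * f (-1)"
    by (simp add: w0_def w1_def wm_def field_simps)
  have T: "of_real w0 * T 0 + of_real w1 * T 1 + of_real wm * T (-1) = of_real (1 - \<theta>\<^sup>2 * (a - \<delta>\<^sup>2) / 2)"
    by (simp add: T_def w0_def w1_def wm_def complex_eq_iff power2_eq_square field_simps)
  have "cmod (of_real w0 * R 0 + of_real w1 * R 1 + of_real wm * R (-1))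
    \<le> w0 * cmod (R 0) + w1 * cmod (R 1) + wm * cmod (R (-1))"
    using w norm_triangle_ineq[of "of_real w0 * R 0 + of_real w1 * R 1" "of_real wm * R (-1)"]
      norm_triangle_ineq[of "of_real w0 * R 0" "of_real w1 * R 1"] by (simp add: norm_mult)
  also have "\<dots> \<le> w0 * (\<bar>\<theta>\<bar>^3 / 3 * (0 - \<delta>)\<^sup>2) + w1 * (\<bar>\<theta>\<bar>^3 / 3 * (1 - \<delta>)\<^sup>2) + wm * (\<bar>\<theta>\<bar>^3 / 3 * (-1 - \<delta>)\<^sup>2)"
    using w by (intro add_mono mult_left_mono Rx) auto
  also have "\<dots> = \<bar>\<theta>\<bar>^3 / 3 * (a - \<delta>\<^sup>2)"
    by (simp add: w0_def w1_def wm_def power2_eq_square field_simps)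
  also have "\<dots> \<le> \<bar>\<theta>\<bar>^3 / 3 * a" by (intro mult_left_mono) auto
  finally have 1: "cmod (of_real w0 * R 0 + of_real w1 * R 1 + of_real wm * R (-1)) \<le> \<bar>\<theta>\<bar>^3 * a / 3" by simp
  have "\<bar>(1 - \<theta>\<^sup>2 * (a - \<delta>\<^sup>2) / 2) - exp (- u / 2)\<bar>
    \<le> \<bar>exp (- (u / 2)) - (1 - u / 2)\<bar> + \<bar>\<theta>\<^sup>2 * a - u\<bar> / 2 + \<theta>\<^sup>2 * \<delta>\<^sup>2 / 2"
  proof -
    have e: "\<theta>\<^sup>2 * (a - \<delta>\<^sup>2) / 2 = \<theta>\<^sup>2 * a / 2 - \<theta>\<^sup>2 * \<delta>\<^sup>2 / 2" by (simp add: field_simps)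
    have "\<bar>1 - (A - D) - e\<bar> \<le> \<bar>e - (1 - u / 2)\<bar> + \<bar>B\<bar> / 2 + D"
      if "0 \<le> D" "B = 2 * A - u" for A B D e :: real
      using that abs_ge_self[of "e - (1 - u / 2)"] abs_ge_minus_self[of "e - (1 - u / 2)"]
        abs_ge_self[of B] abs_ge_minus_self[of B] by (intro abs_leI) linarith+
    from this[of "\<theta>\<^sup>2 * \<delta>\<^sup>2 / 2" "\<theta>\<^sup>2 * a - u" "\<theta>\<^sup>2 * a / 2" "exp (- (u / 2))"]
    show ?thesis unfolding e by simp
  qed
  also have "\<bar>exp (- (u / 2)) - (1 - u / 2)\<bar> \<le> u\<^sup>2 / 4"
    using abs_exp_minus_linear_le[of "u / 2"] u by (simp add: power_divide)
  finally have 2: "\<bar>(1 - \<theta>\<^sup>2 * (a - \<delta>\<^sup>2) / 2) - exp (- u / 2)\<bar> \<le> u\<^sup>2 / 4 + \<bar>\<theta>\<^sup>2 * a - u\<bar> / 2 + \<theta>\<^sup>2 * \<delta>\<^sup>2 / 2" by simp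
  have "f 0 + of_real \<delta> * ((f 1 - f (-1)) / 2) + of_real a * ((f 1 + f (-1)) / 2 - f 0) - of_real (exp (- u / 2))
    = (of_real w0 * R 0 + of_real w1 * R 1 + of_real wm * R (-1)) + of_real ((1 - \<theta>\<^sup>2 * (a - \<delta>\<^sup>2) / 2) - exp (- u / 2))"
    unfolding \<phi> of_real_diff[of "1 - \<theta>\<^sup>2 * (a - \<delta>\<^sup>2) / 2"] T[symmetric] R_def by (simp add: algebra_simps)
  also have "cmod \<dots> \<le> \<bar>\<theta>\<bar>^3 * a / 3 + (u\<^sup>2 / 4 + \<bar>\<theta>\<^sup>2 * a - u\<bar> / 2 + \<theta>\<^sup>2 * \<delta>\<^sup>2 / 2)"
    by (rule order_trans[OF norm_triangle_ineq add_mono[OF 1]]) (use 2 in \<open>simp only: norm_of_real\<close>)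
  finally show ?thesis by simp
qed

text \<open>
  Lindeberg's telescoping: multiplication by \<open>exp (- u j / 2)\<close> is a contraction, so the errors of the single
  replacements add up.
\<close>

lemma char_chain:
  fixes z :: "nat \<Rightarrow> complex" and u :: "nat \<Rightarrow> real"
  assumes "k \<le> n" "\<And>j. k \<le> j \<Longrightarrow> j < n \<Longrightarrow> 0 \<le> u j"
    and "\<And>j. k \<le> j \<Longrightarrow> j < n \<Longrightarrow> cmod (z (Suc j) - of_real (exp (- u j / 2)) * z j) \<le> u j * e"
  shows "cmod (z n - of_real (exp (- (\<Sum>j=k..<n. u j) / 2)) * z k) \<le> (\<Sum>j=k..<n. u j) * e"
  using assms
proof (induction rule: dec_induct)
  case (step n)
  let ?s = "\<Sum>j=k..<n. u j"
  have IH: "cmod (z n - of_real (exp (- ?s / 2)) * z k) \<le> ?s * e"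
    using step by (intro step.IH) auto
  have "exp (- (?s + u n) / 2) = exp (- u n / 2) * exp (- ?s / 2)"
    by (simp add: add_divide_distrib add.commute flip: exp_add)
  then have "z (Suc n) - of_real (exp (- (?s + u n) / 2)) * z k
    = (z (Suc n) - of_real (exp (- u n / 2)) * z n) + of_real (exp (- u n / 2)) * (z n - of_real (exp (- ?s / 2)) * z k)"
    by (simp add: algebra_simps)
  also have "cmod \<dots> \<le> u n * e + 1 * (?s * e)"
  proof (rule order_trans[OF norm_triangle_ineq add_mono])
    show "cmod (z (Suc n) - of_real (exp (- u n / 2)) * z n) \<le> u n * e" using step.prems(2)[of n] step.hyps by simp
    have "exp (- u n / 2) \<le> 1" using step.prems(1)[of n] step.hyps by simp
    then have "cmod (of_real (exp (- u n / 2)) * (z n - of_real (exp (- ?s / 2)) * z k)) \<le> 1 * cmod (z n - of_real (exp (- ?s / 2)) * z k)"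
      unfolding norm_mult by (intro mult_right_mono) auto
    then show "cmod (of_real (exp (- u n / 2)) * (z n - of_real (exp (- ?s / 2)) * z k)) \<le> 1 * (?s * e)"
      using IH by simp
  qed
  finally show ?case using step.hyps by (simp add: algebra_simps)
qed simp

section \<open>One step of the walk given the past\<close>

context erw_stops_array
begin

text \<open>
  All independent inputs in one family, so that a state of information is a set of sources.
\<close>

definition source_val :: "source \<Rightarrow> 'a \<Rightarrow> real" where
  "source_val i = (case i of
          Initial \<Rightarrow> X 1
        | Memory n \<Rightarrow> (\<lambda>\<omega>. real (U n \<omega>))
        | Move n \<Rightarrow> \<xi> n
        | Array_Memory n k \<Rightarrow> (\<lambda>\<omega>. real (V n k \<omega>))
        | Array_Move n k \<Rightarrow> \<eta> n k)"

definition sources :: "source set" where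
  "sources = {Initial} \<union> {Memory n |n. 1 \<le> n} \<union> {Move n |n. 1 \<le> n}
        \<union> {Array_Memory n k |n k. m n < k \<and> k \<le> n}
        \<union> {Array_Move n k |n k. m n < k \<and> k \<le> n}"

text \<open>
  The steps \<open>X 1, \<dots>, X n\<close> are functions of these sources.
\<close>

definition past :: "nat \<Rightarrow> source set" where
  "past n = {Initial} \<union> {Memory i |i. 1 \<le> i \<and> i < n} \<union> {Move i |i. 1 \<le> i \<and> i < n}"

text \<open>
  What is known before entry \<open>k\<close> of row \<open>n\<close> is drawn: the earlier entries of the row and the whole walk,
  its future beyond \<open>m n\<close> included.
\<close>

definition row_past :: "nat \<Rightarrow> nat \<Rightarrow> source set" where
  "row_past n k = {Initial} \<union> {Memory i |i. 1 \<le> i} \<union> {Move i |i. 1 \<le> i}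
     \<union> {Array_Memory n i |i. m n < i \<and> i < k} \<union> {Array_Move n i |i. m n < i \<and> i < k}"

definition \<alpha> :: real where "\<alpha> = p - q"
definition \<beta> :: real where "\<beta> = 1 - r"

lemma indep_sources: "indep_vars (\<lambda>_. borel) source_val sources"
  using indep unfolding source_val_def[abs_def] sources_def .

lemma source_val_simps [simp]:
  "source_val Initial = X 1" "source_val (Memory n) = (\<lambda>\<omega>. real (U n \<omega>))"
  "source_val (Move n) = \<xi> n" "source_val (Array_Memory n k) = (\<lambda>\<omega>. real (V n k \<omega>))"
  "source_val (Array_Move n k) = \<eta> n k"
  by (simp_all add: source_val_def)

lemma past_mono: "i \<le> j \<Longrightarrow> past i \<subseteq> past j"
  by (auto simp: past_def)

lemma past_subset_row_past: "past j \<subseteq> row_past n k"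
  by (auto simp: past_def row_past_def)

lemma past_subset_sources: "past n \<subseteq> sources"
  by (auto simp: past_def sources_def)

lemma row_past_subset_sources: "k \<le> Suc n \<Longrightarrow> row_past n k \<subseteq> sources"
  by (auto simp: row_past_def sources_def)

lemma random_variable_source [measurable]: "i \<in> sources \<Longrightarrow> random_variable borel (source_val i)"
  using indep_sources by (auto simp: indep_vars_def)

lemma measurable_of_known_sources:
  "J \<subseteq> sources \<Longrightarrow> f \<in> measurable (known source_val J) N \<Longrightarrow> random_variable N f"
  by (erule measurable_of_known) (auto intro!: random_variable_source)

lemma \<beta>_eq: "\<beta> = p + q" using pqr by (simp add: \<beta>_def)

lemma \<beta>_bounds: "0 < \<beta>" "\<beta> < 1" using r by (auto simp: \<beta>_def)

lemma \<alpha>_bounds: "\<bar>\<alpha>\<bar> \<le> \<beta>" "-1 < \<alpha>" "\<alpha> < 1" "-1 < \<beta>"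
  using p q r pqr by (auto simp: \<alpha>_def \<beta>_def)

lemma X_known:
  assumes "1 \<le> k"
  shows "X k \<in> borel_measurable (known source_val (past k))"
  using assms
proof (induction k rule: less_induct)
  case (less k)
  show ?case
  proof (cases "k = 1")
    case True
    have "source_val Initial \<in> borel_measurable (known source_val (past k))"
      by (rule measurable_known) (simp add: past_def)
    then show ?thesis by (simp add: True)
  next
    case False
    define n where "n = k - 1"
    have n: "k = n + 1" "1 \<le> n" using False less.prems by (auto simp: n_def)
    let ?N = "known source_val (past k)"
    have U_known [measurable]: "(\<lambda>\<omega>. real (U n \<omega>)) \<in> borel_measurable ?N"
      using measurable_known[of "Memory n" "past k" source_val] n by (simp add: past_def)
    have \<xi>_known [measurable]: "\<xi> n \<in> borel_measurable ?N"
      using measurable_known[of "Move n" "past k" source_val] n by (simp add: past_def)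
    have "(\<lambda>\<omega>. X (U n \<omega>) \<omega>) \<in> borel_measurable ?N"
    proof (rule measurable_random_index[OF U_known])
      show "U n \<omega> \<in> {1..n}" if "\<omega> \<in> space ?N" for \<omega>
        using measurable_space[OF U_measurable[OF n(2)]] that by simp
      fix u assume u: "u \<in> {1..n}"
      have "X u \<in> borel_measurable (known source_val (past u))" using u n by (intro less.IH) auto
      then show "X u \<in> borel_measurable ?N"
        by (rule measurable_known_mono) (use u n in \<open>auto intro!: past_mono\<close>)
    qed
    then have "(\<lambda>\<omega>. \<xi> n \<omega> * X (U n \<omega>) \<omega>) \<in> borel_measurable ?N" by measurable
    then show ?thesis
      by (rule measurable_cong[THEN iffD1, rotated]) (simp add: n(1) X_step[OF n(2), symmetric])
  qed
qed

lemma X_known_past: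
  assumes "past j \<subseteq> J" "1 \<le> k" "k \<le> j"
  shows "X k \<in> borel_measurable (known source_val J)"
  using assms past_mono[of k j] by (intro measurable_known_mono[OF X_known]) auto

lemma X_measurable [measurable]: "1 \<le> k \<Longrightarrow> random_variable borel (X k)"
  using measurable_of_known_sources[OF past_subset_sources X_known] .

lemma walk_known:
  assumes "past j \<subseteq> J" "k \<le> j"
  shows "walk X k \<in> borel_measurable (known source_val J)"
  unfolding walk_def[abs_def] using assms
  by (intro borel_measurable_sum X_known_past[OF assms(1)]) auto

lemma num_moves_known:
  assumes "past j \<subseteq> J" "k \<le> j"
  shows "num_moves X k \<in> borel_measurable (known source_val J)"
  unfolding num_moves_def[abs_def]
proof (rule borel_measurable_sum)
  fix i assume "i \<in> {1..k}"
  then have [measurable]: "X i \<in> borel_measurable (known source_val J)"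
    using assms by (intro X_known_past[OF assms(1)]) auto
  show "(\<lambda>\<omega>. of_bool (X i \<omega> \<noteq> 0) :: real) \<in> borel_measurable (known source_val J)"
    unfolding of_bool_def by measurable
qed

lemma walk_measurable [measurable]: "random_variable borel (walk X k)"
  by (rule measurable_of_known_sources[OF past_subset_sources walk_known[OF order_refl order_refl]])

lemma num_moves_measurable [measurable]: "random_variable borel (num_moves X k)"
  by (rule measurable_of_known_sources[OF past_subset_sources num_moves_known[OF order_refl order_refl]])

text \<open>
  \<open>Z\<close> copies, flips or drops one of \<open>X 1, \<dots>, X j\<close>, and all choices are independent of the sources in \<open>J\<close>.
  The next step of the walk and the entries of the array are instances; for the latter, \<open>J\<close> contains much
  more than the past of time \<open>j\<close>.
\<close>

definition fresh_step :: "source set \<Rightarrow> nat \<Rightarrow> ('a \<Rightarrow> real) \<Rightarrow> bool" where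
  "fresh_step J j Z \<longleftrightarrow> (\<exists>iV iE N. 1 \<le> j \<and> past j \<subseteq> J \<and> J \<subseteq> sources
     \<and> iV \<in> sources - J \<and> iE \<in> sources - J \<and> iV \<noteq> iE
     \<and> N \<in> measurable P (count_space {1..j})
     \<and> distr P (count_space {1..j}) N = uniform_count_measure {1..j}
     \<and> source_val iV = (\<lambda>\<omega>. real (N \<omega>))
     \<and> prob {\<omega> \<in> space P. source_val iE \<omega> = 1} = p
     \<and> prob {\<omega> \<in> space P. source_val iE \<omega> = -1} = q
     \<and> prob {\<omega> \<in> space P. source_val iE \<omega> = 0} = r
     \<and> (\<forall>\<omega>\<in>space P. Z \<omega> = source_val iE \<omega> * X (N \<omega>) \<omega>))"

lemma fresh_step_walk:
  assumes "1 \<le> j"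
  shows "fresh_step (past j) j (X (Suc j))"
  unfolding fresh_step_def
  by (rule exI[of _ "Memory j"], rule exI[of _ "Move j"], rule exI[of _ "U j"])
     (use assms past_subset_sources[of j] U_measurable U_uniform \<xi> X_step in \<open>auto simp: sources_def past_def\<close>)

lemma fresh_step_array:
  assumes "m n < k" "k \<le> n"
  shows "fresh_step (row_past n k) (m n) (\<lambda>\<omega>. \<eta> n k \<omega> * X (V n k \<omega>) \<omega>)"
  unfolding fresh_step_def
  by (rule exI[of _ "Array_Memory n k"], rule exI[of _ "Array_Move n k"], rule exI[of _ "V n k"])
     (use assms past_subset_row_past[of "m n" n k] row_past_subset_sources[of k n]
       V_measurable V_uniform \<eta> m[of n] in \<open>auto simp: sources_def row_past_def\<close>)

text \<open>
  The distributions of the inputs determine the possible values of the steps only almost surely. Pointwise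
  estimates are made for these sample points, which have full measure.
\<close>

definition regular :: "'a \<Rightarrow> bool" where
  "regular \<omega> \<longleftrightarrow> X 1 \<omega> \<in> {1, -1} \<and> (\<forall>k\<ge>1. X k \<omega> \<in> {-1, 0, 1})"

lemma AE_move_values:
  fixes Y :: "'a \<Rightarrow> real"
  assumes [measurable]: "random_variable borel Y"
    and "prob {\<omega> \<in> space P. Y \<omega> = 1} = p" "prob {\<omega> \<in> space P. Y \<omega> = -1} = q"
      "prob {\<omega> \<in> space P. Y \<omega> = 0} = r"
  shows "AE \<omega> in P. Y \<omega> \<in> {-1, 0, 1}"
proof -
  have "prob {\<omega> \<in> space P. Y \<omega> \<in> {-1, 0, 1}} = (\<Sum>v\<in>{-1, 0, 1}. prob {\<omega> \<in> space P. Y \<omega> = v})"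
  proof -
    have [simp]: "{\<omega> \<in> space P. Y \<omega> = v} \<in> events" for v
    proof -
      have "Y -` {v} \<inter> space P \<in> events" by (rule measurable_sets[OF assms(1)]) simp
      also have "Y -` {v} \<inter> space P = {\<omega> \<in> space P. Y \<omega> = v}" by auto
      finally show ?thesis .
    qed
    have "{\<omega> \<in> space P. Y \<omega> \<in> {-1, 0, 1}} = (\<Union>v\<in>{-1, 0, 1}. {\<omega> \<in> space P. Y \<omega> = v})" by auto
    then show ?thesis
      by (simp only:, subst finite_measure_finite_Union) (auto simp: disjoint_family_on_def)
  qed
  also have "\<dots> = 1" using assms pqr by simp
  finally show ?thesis by (subst (asm) prob_Collect_eq_1) auto
qed

lemma AE_regular: "AE \<omega> in P. regular \<omega>"
proof -
  have [measurable]: "random_variable borel (\<xi> n)" if "1 \<le> n" for n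
    using random_variable_source[of "Move n"] that by (simp add: sources_def)
  have 1: "AE \<omega> in P. X 1 \<omega> \<in> {1, -1}"
  proof -
    have "prob {\<omega> \<in> space P. X 1 \<omega> \<in> {1, -1}} = (\<Sum>v\<in>{1, -1}. prob {\<omega> \<in> space P. X 1 \<omega> = v})"
    proof -
      have "{\<omega> \<in> space P. X 1 \<omega> \<in> {1, -1}} = (\<Union>v\<in>{1, -1}. {\<omega> \<in> space P. X 1 \<omega> = v})" by auto
      then show ?thesis
        by (simp only:, subst finite_measure_finite_Union) (auto simp: disjoint_family_on_def)
    qed
    also have "\<dots> = 1" using X_1 by simp
    finally show ?thesis by (subst (asm) prob_Collect_eq_1) auto
  qed
  have "AE \<omega> in P. \<forall>n. 1 \<le> n \<longrightarrow> \<xi> n \<omega> \<in> {-1, 0, 1}"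
    unfolding AE_all_countable
  proof
    fix n show "AE \<omega> in P. 1 \<le> n \<longrightarrow> \<xi> n \<omega> \<in> {-1, 0, 1}"
    proof (cases "1 \<le> n")
      case True
      then have "AE \<omega> in P. \<xi> n \<omega> \<in> {-1, 0, 1}" using \<xi> by (intro AE_move_values) auto
      then show ?thesis by eventually_elim simp
    qed auto
  qed
  with 1 AE_space show ?thesis
  proof eventually_elim
    case (elim \<omega>)
    have "X k \<omega> \<in> {-1, 0, 1}" if "1 \<le> k" for k
      using that
    proof (induction k rule: less_induct)
      case (less k)
      show ?case
      proof (cases "k = 1")
        case False
        define n where "n = k - 1"
        have n: "k = n + 1" "1 \<le> n" using False less.prems by (auto simp: n_def)
        have "U n \<omega> \<in> {1..n}" using measurable_space[OF U_measurable[OF n(2)]] elim by simp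
        then have "X (U n \<omega>) \<omega> \<in> {-1, 0, 1}" using n by (intro less.IH) auto
        moreover have "\<xi> n \<omega> \<in> {-1, 0, 1}" using elim n by blast
        ultimately show ?thesis using X_step[OF n(2)] elim n(1) by auto
      qed (use elim in auto)
    qed
    then show ?case using elim by (simp add: regular_def)
  qed
qed

lemma num_moves_Suc: "regular \<omega> \<Longrightarrow> num_moves X (Suc n) \<omega> = num_moves X n \<omega> + (X (Suc n) \<omega>)\<^sup>2"
proof -
  assume "regular \<omega>"
  then have "X (Suc n) \<omega> \<in> {-1, 0, 1}" by (simp add: regular_def)
  then show ?thesis by (auto simp: num_moves_def)
qed

lemma walk_Suc: "walk X (Suc n) \<omega> = walk X n \<omega> + X (Suc n) \<omega>"
  by (simp add: walk_def)

lemma num_moves_sum_squares: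
  assumes "regular \<omega>"
  shows "num_moves X n \<omega> = (\<Sum>k=1..n. (X k \<omega>)\<^sup>2)"
proof (induction n)
  case (Suc n)
  then show ?case using num_moves_Suc[OF assms] by simp
qed (simp add: num_moves_def)

lemma num_moves_1: "regular \<omega> \<Longrightarrow> num_moves X 1 \<omega> = 1"
  by (auto simp: num_moves_def regular_def)

lemma num_moves_le: "num_moves X n \<omega> \<le> real n"
proof -
  have "num_moves X n \<omega> \<le> (\<Sum>k=1..n. 1)"
    unfolding num_moves_def by (intro sum_mono) auto
  then show ?thesis by simp
qed

lemma num_moves_nonneg: "0 \<le> num_moves X n \<omega>"
  unfolding num_moves_def by (intro sum_nonneg) auto

lemma num_moves_mono: "i \<le> j \<Longrightarrow> num_moves X i \<omega> \<le> num_moves X j \<omega>"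
  unfolding num_moves_def by (intro sum_mono2) auto

lemma num_moves_ge_1: "regular \<omega> \<Longrightarrow> 1 \<le> n \<Longrightarrow> 1 \<le> num_moves X n \<omega>"
  using num_moves_1[of \<omega>] num_moves_mono[of 1 n \<omega>] by simp

lemma abs_walk_le: "regular \<omega> \<Longrightarrow> \<bar>walk X n \<omega>\<bar> \<le> num_moves X n \<omega>"
proof (induction n)
  case (Suc n)
  have "\<bar>X (Suc n) \<omega>\<bar> \<le> (X (Suc n) \<omega>)\<^sup>2" using Suc.prems by (auto simp: regular_def dest: spec[of _ "Suc n"])
  then show ?case using Suc num_moves_Suc[OF Suc.prems, of n] by (simp add: walk_Suc)
qed (simp add: walk_def num_moves_def)

lemma fresh_step_measurable:
  assumes "fresh_step J j Z"
  shows "random_variable borel Z" and "AE \<omega> in P. Z \<omega> \<in> {-1, 0, 1}"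
    and "1 \<le> j" "past j \<subseteq> J" "J \<subseteq> sources"
proof -
  obtain iV iE N where Z: "1 \<le> j" "past j \<subseteq> J" "J \<subseteq> sources"
     "iV \<in> sources - J" "iE \<in> sources - J" "iV \<noteq> iE"
     "N \<in> measurable P (count_space {1..j})"
     "distr P (count_space {1..j}) N = uniform_count_measure {1..j}"
     "source_val iV = (\<lambda>\<omega>. real (N \<omega>))"
     "prob {\<omega> \<in> space P. source_val iE \<omega> = 1} = p"
     "prob {\<omega> \<in> space P. source_val iE \<omega> = -1} = q"
     "prob {\<omega> \<in> space P. source_val iE \<omega> = 0} = r"
     "\<forall>\<omega>\<in>space P. Z \<omega> = source_val iE \<omega> * X (N \<omega>) \<omega>"
    using assms unfolding fresh_step_def by blast
  have sE: "random_variable borel (source_val iE)" and sV: "random_variable borel (source_val iV)"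
    using random_variable_source[of iE] random_variable_source[of iV] Z(4,5) by blast+
  have N: "N \<omega> \<in> {1..j}" if "\<omega> \<in> space P" for \<omega> using measurable_space[OF Z(7) that] by simp
  have [measurable]: "random_variable borel (\<lambda>\<omega>. X (N \<omega>) \<omega>)"
  proof (rule measurable_random_index[OF sV[unfolded Z(9)] N])
    show "random_variable borel (X u)" if "u \<in> {1..j}" for u using that by simp
  qed
  have "random_variable borel (\<lambda>\<omega>. source_val iE \<omega> * X (N \<omega>) \<omega>)" using sE by measurable
  then show "random_variable borel Z"
    by (rule measurable_cong[THEN iffD1, rotated]) (rule Z(13)[rule_format, symmetric])
  have "AE \<omega> in P. source_val iE \<omega> \<in> {-1, 0, 1}"
    using sE Z(10-12) by (rule AE_move_values)
  then show "AE \<omega> in P. Z \<omega> \<in> {-1, 0, 1}"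
    using AE_regular AE_space
  proof eventually_elim
    case (elim \<omega>)
    have "X (N \<omega>) \<omega> \<in> {-1, 0, 1}" using elim(2) N[OF elim(3)] by (simp add: regular_def)
    then show ?case using elim Z(13) by auto
  qed
qed (use assms in \<open>auto simp: fresh_step_def\<close>)

text \<open>
  The conditional expectation of \<open>F Z\<close> for a fresh step \<open>Z\<close>: given the past, \<open>Z\<close> is \<open>1\<close> or \<open>-1\<close> with
  probabilities \<open>(\<beta> \<Sigma>\<^sub>j \<plusminus> \<alpha> W\<^sub>j) / (2 j)\<close> and \<open>0\<close> otherwise. Grouping by \<open>W\<^sub>j\<close> and \<open>\<Sigma>\<^sub>j\<close> separates the odd
  part of \<open>F\<close> from the even one.
\<close>

definition mean_step :: "nat \<Rightarrow> (real \<Rightarrow> 'a \<Rightarrow> 'b::real_normed_field) \<Rightarrow> 'a \<Rightarrow> 'b" where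
  "mean_step j F \<omega> = F 0 \<omega>
      + of_real (\<alpha> * walk X j \<omega> / real j) * ((F 1 \<omega> - F (-1) \<omega>) / 2)
      + of_real (\<beta> * num_moves X j \<omega> / real j) * ((F 1 \<omega> + F (-1) \<omega>) / 2 - F 0 \<omega>)"

text \<open>
  On \<open>{-1, 0, 1}\<close> every function of \<open>x\<close> is a linear combination of \<open>1\<close>, \<open>x\<close> and \<open>x\<^sup>2\<close>, so the average over the
  copied step depends on the past only through the sums \<open>W\<^sub>j\<close> of the \<open>X u\<close> and \<open>\<Sigma>\<^sub>j\<close> of the \<open>(X u)\<^sup>2\<close>.
\<close>

lemma fresh_step_expectation:
  fixes F :: "real \<Rightarrow> 'a \<Rightarrow> 'b::{real_normed_field, banach, second_countable_topology}"
  assumes Z: "fresh_step J j Z"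
    and F: "(\<lambda>(x, \<omega>). F x \<omega>) \<in> borel_measurable (borel \<Otimes>\<^sub>M known source_val J)"
    and bdd: "AE \<omega> in P. \<forall>x\<in>{-1, 0, 1}. norm (F x \<omega>) \<le> B"
  shows "(\<integral>\<omega>. F (Z \<omega>) \<omega> \<partial>P) = (\<integral>\<omega>. mean_step j F \<omega> \<partial>P)"
proof -
  obtain iV iE N where Z: "1 \<le> j" "past j \<subseteq> J" "J \<subseteq> sources"
     "iV \<in> sources - J" "iE \<in> sources - J" "iV \<noteq> iE"
     "N \<in> measurable P (count_space {1..j})"
     "distr P (count_space {1..j}) N = uniform_count_measure {1..j}"
     "source_val iV = (\<lambda>\<omega>. real (N \<omega>))"
     "prob {\<omega> \<in> space P. source_val iE \<omega> = 1} = p"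
     "prob {\<omega> \<in> space P. source_val iE \<omega> = -1} = q"
     "prob {\<omega> \<in> space P. source_val iE \<omega> = 0} = r"
     "\<forall>\<omega>\<in>space P. Z \<omega> = source_val iE \<omega> * X (N \<omega>) \<omega>"
    using Z unfolding fresh_step_def by blast
  have X_J: "X u \<in> borel_measurable (known source_val J)" if "u \<in> {1..j}" for u
    using that by (intro X_known_past[OF Z(2)]) auto
  have F_slice: "F x \<in> borel_measurable (known source_val J)" for x
  proof -
    have "(\<lambda>\<omega>. (x, \<omega>)) \<in> measurable (known source_val J) (borel \<Otimes>\<^sub>M known source_val J)" by measurable
    from measurable_compose[OF this F] show ?thesis by simp
  qed
  have [measurable]: "random_variable borel (F x)" for x
    using measurable_of_known_sources[OF Z(3) F_slice] .
  have "(\<integral>\<omega>. F (Z \<omega>) \<omega> \<partial>P) = (\<integral>\<omega>. F (source_val iE \<omega> * X (N \<omega>) \<omega>) \<omega> \<partial>P)"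
    using Z(13) by (intro Bochner_Integration.integral_cong) auto
  also have "\<dots> = (\<integral>\<omega>. (\<Sum>u=1..j. of_real p * F (X u \<omega>) \<omega> + of_real q * F (- X u \<omega>) \<omega> + of_real r * F 0 \<omega>) / of_nat j \<partial>P)"
  proof (rule fresh_draw[OF indep_sources Z(3-12) pqr X_J F _ Z(1)])
    fix u and v :: real assume uv: "u \<in> {1..j}" "v \<in> {1, -1, 0}"
    show "AE \<omega> in P. norm (F (v * X u \<omega>) \<omega>) \<le> B"
      using bdd AE_regular
    proof eventually_elim
      case (elim \<omega>)
      have "v * X u \<omega> \<in> {-1, 0, 1}" using elim(2) uv by (auto simp: regular_def)
      then show ?case using elim(1) by blast
    qed
  qed
  also have "\<dots> = (\<integral>\<omega>. mean_step j F \<omega> \<partial>P)"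
  proof (rule integral_cong_AE)
    have vX [measurable]: "random_variable borel (\<lambda>\<omega>. F (v * X u \<omega>) \<omega>)" if "u \<in> {1..j}" for u v
    proof (rule measurable_of_known_sources[OF Z(3)])
      note [measurable] = X_J[OF that]
      have "(\<lambda>\<omega>. (v * X u \<omega>, \<omega>)) \<in> measurable (known source_val J) (borel \<Otimes>\<^sub>M known source_val J)" by measurable
      from measurable_compose[OF this F] show "(\<lambda>\<omega>. F (v * X u \<omega>) \<omega>) \<in> borel_measurable (known source_val J)" by simp
    qed
    have [measurable]: "random_variable borel (\<lambda>\<omega>. F (X u \<omega>) \<omega>)"
      "random_variable borel (\<lambda>\<omega>. F (- X u \<omega>) \<omega>)" if "u \<in> {1..j}" for u
      using vX[OF that, of 1] vX[OF that, of "-1"] by simp_all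
    show "random_variable borel (\<lambda>\<omega>. (\<Sum>u=1..j. of_real p * F (X u \<omega>) \<omega> + of_real q * F (- X u \<omega>) \<omega> + of_real r * F 0 \<omega>) / of_nat j)"
      by measurable
    show "random_variable borel (\<lambda>\<omega>. mean_step j F \<omega>)"
      unfolding mean_step_def by measurable
    show "AE \<omega> in P. (\<Sum>u=1..j. of_real p * F (X u \<omega>) \<omega> + of_real q * F (- X u \<omega>) \<omega> + of_real r * F 0 \<omega>) / of_nat j =
      mean_step j F \<omega>"
      using AE_regular
    proof eventually_elim
      case (elim \<omega>)
      let ?o = "of_real :: real \<Rightarrow> 'b"
      define d where "d = (F 1 \<omega> - F (-1) \<omega>) / 2"
      define a where "a = (F 1 \<omega> + F (-1) \<omega>) / 2 - F 0 \<omega>"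
      have F1: "F 1 \<omega> = a + F 0 \<omega> + d" "F (-1) \<omega> = a + F 0 \<omega> - d"
        by (simp_all add: a_def d_def field_simps)
      have r': "?o r = 1 - ?o p - ?o q" using pqr by (metis add_diff_cancel_left' diff_diff_eq of_real_1 of_real_diff)
      have summand: "?o p * F (X u \<omega>) \<omega> + ?o q * F (- X u \<omega>) \<omega> + ?o r * F 0 \<omega>
          = F 0 \<omega> + ?o \<alpha> * d * ?o (X u \<omega>) + ?o \<beta> * a * ?o ((X u \<omega>)\<^sup>2)" if "u \<in> {1..j}" for u
      proof -
        have "X u \<omega> \<in> {-1, 0, 1}" using elim that by (auto simp: regular_def)
        then show ?thesis
          by (elim insertE) (simp_all add: F1 \<alpha>_def \<beta>_eq r' algebra_simps)
      qed
      have "(\<Sum>u=1..j. ?o p * F (X u \<omega>) \<omega> + ?o q * F (- X u \<omega>) \<omega> + ?o r * F 0 \<omega>)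
        = (\<Sum>u=1..j. F 0 \<omega> + ?o \<alpha> * d * ?o (X u \<omega>) + ?o \<beta> * a * ?o ((X u \<omega>)\<^sup>2))"
        by (intro sum.cong refl summand)
      also have "\<dots> = of_nat j * F 0 \<omega> + ?o \<alpha> * d * ?o (walk X j \<omega>) + ?o \<beta> * a * ?o (num_moves X j \<omega>)"
        by (simp add: sum.distrib walk_def num_moves_sum_squares[OF elim] sum_distrib_left)
      finally show ?case
        using Z(1) unfolding mean_step_def d_def[symmetric] a_def[symmetric] by (simp add: field_simps)
    qed
  qed
  finally show ?thesis .
qed

section \<open>The number of moves\<close>

lemma integrable_weighted_moves:
  assumes [measurable]: "random_variable borel g" and "AE \<omega> in P. \<bar>g \<omega>\<bar> \<le> B"
  shows "integrable P (\<lambda>\<omega>. g \<omega> * num_moves X j \<omega>)"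
proof (rule integrable_const_bound[where B="B * real j"])
  show "AE \<omega> in P. norm (g \<omega> * num_moves X j \<omega>) \<le> B * real j"
    using assms(2)
  proof eventually_elim
    case (elim \<omega>)
    have "\<bar>g \<omega>\<bar> * \<bar>num_moves X j \<omega>\<bar> \<le> B * real j"
      using elim num_moves_le[of j \<omega>] num_moves_nonneg[of j \<omega>] by (intro mult_mono) auto
    then show ?case by (simp add: abs_mult)
  qed
qed simp

text \<open>
  A fresh step is a move with probability \<open>\<beta> \<Sigma>\<^sub>j / j\<close>, so that \<open>\<Sigma>\<^sub>j\<close> grows by the factor \<open>1 + \<beta> / j\<close> on
  average. The weight \<open>g\<close> makes this a statement given the past of time \<open>k\<close>.
\<close>

lemma moves_mean:
  assumes g: "g \<in> borel_measurable (known source_val (past k))" and bdd: "AE \<omega> in P. \<bar>g \<omega>\<bar> \<le> B"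
    and "1 \<le> k" "k \<le> j"
  shows "expectation (\<lambda>\<omega>. g \<omega> * num_moves X j \<omega>)
    = expectation (\<lambda>\<omega>. g \<omega> * num_moves X k \<omega>) * (growth \<beta> j / growth \<beta> k)"
  using assms(4)
proof (induction rule: dec_induct)
  case base
  then show ?case using growth_pos[of \<beta> k] \<alpha>_bounds assms by simp
next
  case (step j)
  have j: "1 \<le> j" using step assms by simp
  have [measurable]: "g \<in> borel_measurable (known source_val (past j))"
    using measurable_known_mono[OF g past_mono] step by auto
  have [measurable]: "num_moves X j \<in> borel_measurable (known source_val (past j))"
    by (rule num_moves_known) auto
  have gm: "random_variable borel g" using measurable_of_known_sources[OF past_subset_sources g] .
  have [measurable]: "random_variable borel (X (Suc j))" "random_variable borel g" using gm by auto
  define F where "F x \<omega> = g \<omega> * (num_moves X j \<omega> + x\<^sup>2)" for x :: real and \<omega>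
  have "expectation (\<lambda>\<omega>. g \<omega> * num_moves X (Suc j) \<omega>) = expectation (\<lambda>\<omega>. F (X (Suc j) \<omega>) \<omega>)"
  proof (rule integral_cong_AE)
    show "AE \<omega> in P. g \<omega> * num_moves X (Suc j) \<omega> = F (X (Suc j) \<omega>) \<omega>"
      using AE_regular by eventually_elim (simp add: F_def num_moves_Suc)
  qed (auto simp: F_def)
  also have "\<dots> = expectation (\<lambda>\<omega>. mean_step j F \<omega>)"
  proof (rule fresh_step_expectation[OF fresh_step_walk[OF j]])
    show "(\<lambda>(x, \<omega>). F x \<omega>) \<in> borel_measurable (borel \<Otimes>\<^sub>M known source_val (past j))"
      unfolding F_def by measurable
    show "AE \<omega> in P. \<forall>x\<in>{-1, 0, 1}. norm (F x \<omega>) \<le> B * (real j + 1)"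
      using bdd
    proof eventually_elim
      case (elim \<omega>)
      have "\<bar>g \<omega>\<bar> * \<bar>num_moves X j \<omega> + x\<^sup>2\<bar> \<le> B * (real j + 1)" if "x \<in> {-1, 0, 1}" for x
        using that elim num_moves_le[of j \<omega>] num_moves_nonneg[of j \<omega>] by (intro mult_mono) auto
      then show ?case by (simp add: F_def abs_mult)
    qed
  qed
  also have "\<dots> = expectation (\<lambda>\<omega>. (1 + \<beta> / real j) * (g \<omega> * num_moves X j \<omega>))"
    by (intro Bochner_Integration.integral_cong) (auto simp: mean_step_def F_def algebra_simps)
  also have "\<dots> = (1 + \<beta> / real j) * expectation (\<lambda>\<omega>. g \<omega> * num_moves X j \<omega>)"
    by simp
  finally show ?case
    using step.IH growth_Suc[of \<beta> j] j \<alpha>_bounds by simp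
qed

lemma expectation_num_moves:
  assumes "1 \<le> k"
  shows "expectation (num_moves X k) = growth \<beta> k / growth \<beta> 1"
proof -
  have "expectation (num_moves X 1) = expectation (\<lambda>\<omega>. 1)"
    by (rule integral_cong_AE) (use AE_regular in \<open>auto elim!: eventually_mono simp: num_moves_1[simplified]\<close>)
  then show ?thesis
    using moves_mean[of "\<lambda>_. 1" 1 1 k] assms prob_space by simp
qed

text \<open>
  The quotient \<open>\<Sigma>\<^sub>j / b\<^sub>j\<close> with \<open>b\<^sub>j = growth \<beta> j\<close> is a martingale, and the conditional mean of its squared
  increment at time \<open>j\<close> is at most \<open>\<beta> \<Sigma>\<^sub>j / (j b\<^sub>j\<^sub>+\<^sub>1\<^sup>2)\<close>. By \<open>moves_mean\<close> the expectations of these bounds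
  are at most the differences \<open>1 / b\<^sub>j - 1 / b\<^sub>j\<^sub>+\<^sub>1\<close> times a quantity that depends on time \<open>k\<close> only.
\<close>

lemma moves_variance:
  assumes g: "g \<in> borel_measurable (known source_val (past k))" and bdd: "AE \<omega> in P. 0 \<le> g \<omega> \<and> g \<omega> \<le> B"
    and k: "1 \<le> k" "k \<le> j"
  shows "expectation (\<lambda>\<omega>. g \<omega> * (num_moves X j \<omega> / growth \<beta> j - num_moves X k \<omega> / growth \<beta> k)\<^sup>2)
    \<le> expectation (\<lambda>\<omega>. g \<omega> * num_moves X k \<omega>) / growth \<beta> k * (1 / growth \<beta> k - 1 / growth \<beta> j)"
  using k(2)
proof (induction rule: dec_induct)
  case (step j)
  have j: "1 \<le> j" using step assms by simp
  have g_j [measurable]: "g \<in> borel_measurable (known source_val (past j))"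
    using measurable_known_mono[OF g past_mono] step by auto
  have [measurable]: "num_moves X j \<in> borel_measurable (known source_val (past j))"
    "num_moves X k \<in> borel_measurable (known source_val (past j))"
    using step by (auto intro: num_moves_known)
  have gm: "random_variable borel g" using measurable_of_known_sources[OF past_subset_sources g] .
  have [measurable]: "random_variable borel (X (Suc j))" "random_variable borel g" using gm by auto
  have bdd': "AE \<omega> in P. \<bar>g \<omega>\<bar> \<le> B" using bdd by eventually_elim auto
  let ?b = "growth \<beta> j" and ?b' = "growth \<beta> (Suc j)" and ?c = "growth \<beta> k"
  have b: "?b > 0" "?b' > 0" "?c > 0" "?b \<le> ?b'" "?b' = ?b * (1 + \<beta> / real j)"
    using growth_pos[of \<beta> j] growth_pos[of \<beta> "Suc j"] growth_pos[of \<beta> k] growth_mono[of \<beta> j "Suc j"] growth_Suc[of \<beta> j] j k \<alpha>_bounds \<beta>_bounds by auto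
  have bnd: "\<bar>num_moves X i \<omega> / c\<bar> \<le> real i / c" if "c > 0" for i c \<omega>
    using num_moves_le[of i \<omega>] num_moves_nonneg[of i \<omega>] that by (simp add: divide_right_mono)
  have int: "integrable P (\<lambda>\<omega>. g \<omega> * (num_moves X j \<omega> / ?b - num_moves X k \<omega> / ?c)\<^sup>2)"
  proof (rule integrable_const_bound[where B="B * (real j / ?b + real k / ?c)\<^sup>2"])
    show "AE \<omega> in P. norm (g \<omega> * (num_moves X j \<omega> / ?b - num_moves X k \<omega> / ?c)\<^sup>2) \<le> B * (real j / ?b + real k / ?c)\<^sup>2"
      using bdd
    proof eventually_elim
      case (elim \<omega>)
      have "\<bar>num_moves X j \<omega> / ?b - num_moves X k \<omega> / ?c\<bar> \<le> real j / ?b + real k / ?c"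
        using bnd[OF b(1), of j \<omega>] bnd[OF b(3), of k \<omega>] by linarith
      then have "(num_moves X j \<omega> / ?b - num_moves X k \<omega> / ?c)\<^sup>2 \<le> (real j / ?b + real k / ?c)\<^sup>2"
        by (metis abs_ge_zero power2_abs power_mono)
      then show ?case using elim by (auto simp: abs_mult intro!: mult_mono)
    qed
  qed simp
  define F where "F x \<omega> = g \<omega> * ((num_moves X j \<omega> + x\<^sup>2) / ?b' - num_moves X k \<omega> / ?c)\<^sup>2" for x :: real and \<omega>
  have "expectation (\<lambda>\<omega>. g \<omega> * (num_moves X (Suc j) \<omega> / ?b' - num_moves X k \<omega> / ?c)\<^sup>2) = expectation (\<lambda>\<omega>. F (X (Suc j) \<omega>) \<omega>)"
  proof (rule integral_cong_AE)
    show "AE \<omega> in P. g \<omega> * (num_moves X (Suc j) \<omega> / ?b' - num_moves X k \<omega> / ?c)\<^sup>2 = F (X (Suc j) \<omega>) \<omega>"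
      using AE_regular by eventually_elim (simp add: F_def num_moves_Suc)
  qed (auto simp: F_def)
  also have "\<dots> = expectation (\<lambda>\<omega>. mean_step j F \<omega>)"
  proof (rule fresh_step_expectation[OF fresh_step_walk[OF j]])
    show "(\<lambda>(x, \<omega>). F x \<omega>) \<in> borel_measurable (borel \<Otimes>\<^sub>M known source_val (past j))"
      unfolding F_def by measurable
    show "AE \<omega> in P. \<forall>x\<in>{-1, 0, 1}. norm (F x \<omega>) \<le> B * ((real j + 1) / ?b' + real k / ?c)\<^sup>2"
      using bdd
    proof eventually_elim
      case (elim \<omega>)
      show ?case
      proof
        fix x :: real assume x: "x \<in> {-1, 0, 1}"
        have "\<bar>(num_moves X j \<omega> + x\<^sup>2) / ?b'\<bar> \<le> (real j + 1) / ?b'"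
          using x num_moves_le[of j \<omega>] num_moves_nonneg[of j \<omega>] b by (auto simp: divide_right_mono)
        then have "\<bar>(num_moves X j \<omega> + x\<^sup>2) / ?b' - num_moves X k \<omega> / ?c\<bar> \<le> (real j + 1) / ?b' + real k / ?c"
          using bnd[OF b(3), of k \<omega>] by linarith
        then have "((num_moves X j \<omega> + x\<^sup>2) / ?b' - num_moves X k \<omega> / ?c)\<^sup>2 \<le> ((real j + 1) / ?b' + real k / ?c)\<^sup>2"
          by (metis abs_ge_zero power2_abs power_mono)
        then show "norm (F x \<omega>) \<le> B * ((real j + 1) / ?b' + real k / ?c)\<^sup>2"
          using elim unfolding F_def by (auto simp: abs_mult intro!: mult_mono)
      qed
    qed
  qed
  also have "\<dots> \<le> expectation (\<lambda>\<omega>. g \<omega> * (num_moves X j \<omega> / ?b - num_moves X k \<omega> / ?c)\<^sup>2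
      + \<beta> / (real j * ?b'\<^sup>2) * (g \<omega> * num_moves X j \<omega>))"
  proof (rule integral_mono_AE')
    show "integrable P (\<lambda>\<omega>. g \<omega> * (num_moves X j \<omega> / ?b - num_moves X k \<omega> / ?c)\<^sup>2
      + \<beta> / (real j * ?b'\<^sup>2) * (g \<omega> * num_moves X j \<omega>))"
      using int integrable_weighted_moves[OF gm bdd'] by simp
    have eq: "mean_step j F \<omega>
      = g \<omega> * ((num_moves X j \<omega> / ?b - num_moves X k \<omega> / ?c)\<^sup>2
        - (\<beta> * num_moves X j \<omega> / real j / ?b')\<^sup>2) + \<beta> / (real j * ?b'\<^sup>2) * (g \<omega> * num_moves X j \<omega>)" for \<omega>
    proof -
      define A where "A = num_moves X j \<omega> / ?b' - num_moves X k \<omega> / ?c"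
      \<comment> \<open>\<open>h\<close> is the conditional mean of the increase of \<open>\<Sigma> / ?b'\<close>, so that the mixed term completes the square\<close>
      define h where "h = \<beta> * num_moves X j \<omega> / real j / ?b'"
      have "num_moves X j \<omega> / ?b = num_moves X j \<omega> * (1 + \<beta> / real j) / ?b'"
        unfolding b(5) using b(1,2) j by (metis b(5) divide_divide_eq_right mult.commute mult_divide_mult_cancel_right nonzero_mult_div_cancel_left order_less_irrefl times_divide_eq_right zero_less_mult_pos)
      then have D: "num_moves X j \<omega> / ?b - num_moves X k \<omega> / ?c = A + h"
        by (simp add: A_def h_def algebra_simps add_divide_distrib)
      have F0: "F 0 \<omega> = g \<omega> * A\<^sup>2" by (simp add: F_def A_def)
      have F1: "F 1 \<omega> = g \<omega> * (A + 1 / ?b')\<^sup>2" "F (-1) \<omega> = g \<omega> * (A + 1 / ?b')\<^sup>2"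
        by (simp_all add: F_def A_def add_divide_distrib algebra_simps)
      have h': "\<beta> / (real j * ?b'\<^sup>2) * (g \<omega> * num_moves X j \<omega>) = g \<omega> * h / ?b'"
        by (simp add: h_def power2_eq_square mult.left_commute mult.assoc)
      have h'': "\<beta> * num_moves X j \<omega> / real j = h * ?b'" using b by (simp add: h_def)
      show ?thesis
        unfolding mean_step_def D F0 F1 h' h'' h_def[symmetric] using b(2)
        by (simp add: power2_eq_square field_simps)
    qed
    show "AE \<omega> in P. mean_step j F \<omega>
      \<le> g \<omega> * (num_moves X j \<omega> / ?b - num_moves X k \<omega> / ?c)\<^sup>2
      + \<beta> / (real j * ?b'\<^sup>2) * (g \<omega> * num_moves X j \<omega>)"
      using bdd by eventually_elim (unfold eq, auto intro!: mult_left_mono)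
    show "AE \<omega> in P. 0 \<le> g \<omega> * (num_moves X j \<omega> / ?b - num_moves X k \<omega> / ?c)\<^sup>2
      + \<beta> / (real j * ?b'\<^sup>2) * (g \<omega> * num_moves X j \<omega>)"
      using bdd
    proof eventually_elim
      case (elim \<omega>)
      then have "0 \<le> g \<omega> * num_moves X j \<omega>" by (simp add: num_moves_nonneg)
      then show ?case using elim \<beta>_bounds by (intro add_nonneg_nonneg mult_nonneg_nonneg) (auto simp: num_moves_nonneg)
    qed
  qed
  also have "\<dots> = expectation (\<lambda>\<omega>. g \<omega> * (num_moves X j \<omega> / ?b - num_moves X k \<omega> / ?c)\<^sup>2)
      + \<beta> / (real j * ?b'\<^sup>2) * expectation (\<lambda>\<omega>. g \<omega> * num_moves X j \<omega>)"
    using int integrable_weighted_moves[OF gm bdd'] by simp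
  also have "\<beta> / (real j * ?b'\<^sup>2) * expectation (\<lambda>\<omega>. g \<omega> * num_moves X j \<omega>)
      \<le> expectation (\<lambda>\<omega>. g \<omega> * num_moves X k \<omega>) / ?c * (1 / ?b - 1 / ?b')"
  proof -
    have E: "0 \<le> expectation (\<lambda>\<omega>. g \<omega> * num_moves X k \<omega>)"
      using bdd by (intro integral_nonneg_AE) (auto elim!: eventually_mono intro!: mult_nonneg_nonneg num_moves_nonneg)
    have "\<beta> / (real j * ?b'\<^sup>2) * ?b = \<beta> / (real j * ?b') * (?b / ?b')"
      by (simp add: power2_eq_square)
    also have "\<dots> \<le> \<beta> / (real j * ?b') * 1"
      using b(1-4) \<beta>_bounds by (intro mult_left_mono) auto
    also have "\<dots> = 1 / ?b - 1 / ?b'"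
    proof -
      have "1 / ?b - 1 / ?b' = (?b' - ?b) / (?b * ?b')" using b(1,2) by (simp add: diff_divide_distrib)
      also have "?b' - ?b = ?b * (\<beta> / real j)" unfolding b(5) by (simp add: algebra_simps)
      finally show ?thesis using b(1) by simp
    qed
    finally have "\<beta> / (real j * ?b'\<^sup>2) * ?b \<le> 1 / ?b - 1 / ?b'" .
    then have "(expectation (\<lambda>\<omega>. g \<omega> * num_moves X k \<omega>) / ?c) * (\<beta> / (real j * ?b'\<^sup>2) * ?b)
      \<le> (expectation (\<lambda>\<omega>. g \<omega> * num_moves X k \<omega>) / ?c) * (1 / ?b - 1 / ?b')"
      using E b by (intro mult_left_mono) auto
    moreover have "k \<le> j" using step by simp
    ultimately show ?thesis
      unfolding moves_mean[OF g bdd' k(1) \<open>k \<le> j\<close>] by (simp add: ac_simps)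
  qed
  also have "expectation (\<lambda>\<omega>. g \<omega> * (num_moves X j \<omega> / ?b - num_moves X k \<omega> / ?c)\<^sup>2)
      + expectation (\<lambda>\<omega>. g \<omega> * num_moves X k \<omega>) / ?c * (1 / ?b - 1 / ?b')
    \<le> expectation (\<lambda>\<omega>. g \<omega> * num_moves X k \<omega>) / ?c * (1 / ?c - 1 / ?b')"
    using step.IH by (simp only: right_diff_distrib)
  finally show ?case by simp
qed simp

text \<open>
  Given the past, \<open>1 / \<Sigma>\<^sub>j\<close> decreases by \<open>\<beta> / (j (\<Sigma>\<^sub>j + 1))\<close> on average, which is at least the fraction
  \<open>\<beta> / (2 j)\<close> of its value because \<open>\<Sigma>\<^sub>j \<ge> 1\<close>.
\<close>

lemma expectation_inverse_moves_le:
  assumes "1 \<le> n"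
  shows "expectation (\<lambda>\<omega>. 1 / num_moves X n \<omega>) \<le> growth (\<beta> / 2) 1 / growth (\<beta> / 2) n"
  using assms
proof (induction rule: dec_induct)
  case base
  have "expectation (\<lambda>\<omega>. 1 / num_moves X 1 \<omega>) = expectation (\<lambda>\<omega>. 1)"
    by (rule integral_cong_AE) (use AE_regular in \<open>auto elim!: eventually_mono simp: num_moves_1[simplified]\<close>)
  then show ?case using growth_pos[of "\<beta> / 2" 1] \<beta>_bounds prob_space by simp
next
  case (step j)
  have j: "1 \<le> j" using step by simp
  have [measurable]: "num_moves X j \<in> borel_measurable (known source_val (past j))"
    by (rule num_moves_known) auto
  have [measurable]: "random_variable borel (X (Suc j))" by auto
  define F where "F x \<omega> = 1 / (num_moves X j \<omega> + x\<^sup>2)" for x :: real and \<omega>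
  have "expectation (\<lambda>\<omega>. 1 / num_moves X (Suc j) \<omega>) = expectation (\<lambda>\<omega>. F (X (Suc j) \<omega>) \<omega>)"
  proof (rule integral_cong_AE)
    show "AE \<omega> in P. 1 / num_moves X (Suc j) \<omega> = F (X (Suc j) \<omega>) \<omega>"
      using AE_regular by eventually_elim (simp add: F_def num_moves_Suc)
  qed (auto simp: F_def)
  also have "\<dots> = expectation (\<lambda>\<omega>. mean_step j F \<omega>)"
  proof (rule fresh_step_expectation[OF fresh_step_walk[OF j]])
    show "(\<lambda>(x, \<omega>). F x \<omega>) \<in> borel_measurable (borel \<Otimes>\<^sub>M known source_val (past j))"
      unfolding F_def by measurable
    show "AE \<omega> in P. \<forall>x\<in>{-1, 0, 1}. norm (F x \<omega>) \<le> 1"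
      using AE_regular
    proof eventually_elim
      case (elim \<omega>)
      have "1 \<le> num_moves X j \<omega>" using num_moves_ge_1[OF elim j] .
      then show ?case by (auto simp: F_def divide_le_eq)
    qed
  qed
  also have "\<dots> \<le> expectation (\<lambda>\<omega>. 1 / num_moves X j \<omega> * (1 / (1 + \<beta> / 2 / real j)))"
  proof (rule integral_mono_AE')
    show "integrable P (\<lambda>\<omega>. 1 / num_moves X j \<omega> * (1 / (1 + \<beta> / 2 / real j)))"
    proof (rule integrable_mult_left, rule integrable_const_bound[where B=1, OF eventually_mono[OF AE_regular]])
      fix \<omega> assume "regular \<omega>"
      then have "1 \<le> num_moves X j \<omega>" using num_moves_ge_1 j by blast
      then show "norm (1 / num_moves X j \<omega>) \<le> 1" by simp
    qed simp
    show "AE \<omega> in P. 0 \<le> 1 / num_moves X j \<omega> * (1 / (1 + \<beta> / 2 / real j))"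
      using AE_regular by eventually_elim (use \<beta>_bounds in \<open>auto simp: num_moves_nonneg\<close>)
    show "AE \<omega> in P. mean_step j F \<omega>
      \<le> 1 / num_moves X j \<omega> * (1 / (1 + \<beta> / 2 / real j))"
      using AE_regular
    proof eventually_elim
      case (elim \<omega>)
      define t where "t = num_moves X j \<omega>"
      define c where "c = \<beta> / real j"
      have t: "1 \<le> t" using num_moves_ge_1[OF elim j] by (simp add: t_def)
      have c: "0 \<le> c" using \<beta>_bounds by (simp add: c_def)
      have "mean_step j F \<omega>
        = 1 / t + c * t * (1 / (t + 1) - 1 / t)"
      proof -
        have f: "F 1 \<omega> = 1 / (t + 1)" "F (-1) \<omega> = 1 / (t + 1)" "F 0 \<omega> = 1 / t"
          by (simp_all add: F_def t_def)
        have half: "(y + y) / 2 = y" for y :: real by simp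
        show ?thesis unfolding mean_step_def f half by (simp add: t_def c_def)
      qed
      also have "t * (1 / (t + 1) - 1 / t) = - (1 / (t + 1))"
      proof -
        have pos: "0 < t" "0 < t * t" using t by (auto intro: mult_pos_pos)
        then have "t + t * t \<noteq> 0" by linarith
        with pos(1) show ?thesis by (simp add: field_simps)
      qed
      then have "1 / t + c * t * (1 / (t + 1) - 1 / t) = 1 / t - c / (t + 1)" by (simp add: mult.assoc)
      also have "\<dots> \<le> 1 / t - c / (2 * t)"
        using t c by (intro diff_left_mono divide_left_mono) auto
      also have "\<dots> = 1 / t * (1 - c / 2)" using t by (simp add: field_simps)
      also have "\<dots> \<le> 1 / t * (1 / (1 + c / 2))"
        using t c by (intro mult_left_mono) (auto simp: field_simps)
      finally show ?case by (simp add: t_def c_def mult.commute)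
    qed
  qed
  also have "\<dots> = expectation (\<lambda>\<omega>. 1 / num_moves X j \<omega>) * (1 / (1 + \<beta> / 2 / real j))"
    by (rule integral_mult_left_zero)
  also have "\<dots> \<le> growth (\<beta> / 2) 1 / growth (\<beta> / 2) j * (1 / (1 + \<beta> / 2 / real j))"
    using step.IH \<beta>_bounds by (intro mult_right_mono) auto
  also have "\<dots> = growth (\<beta> / 2) 1 / growth (\<beta> / 2) (Suc j)"
    using growth_Suc[of "\<beta> / 2" j] j \<beta>_bounds by simp
  finally show ?case .
qed

text \<open>
  The \<open>L\<^sup>2\<close> norm of \<open>1 / sqrt \<Sigma>\<^sub>k\<close>, the scale of the relative error in predicting \<open>\<Sigma>\<close> from time \<open>k\<close> on.
\<close>

definition scarcity :: "nat \<Rightarrow> real" where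
  "scarcity k = sqrt (expectation (\<lambda>\<omega>. 1 / num_moves X k \<omega>))"

lemma scarcity_nonneg: "0 \<le> scarcity k"
  unfolding scarcity_def by (simp add: integral_nonneg num_moves_nonneg)

lemma scarcity_tendsto_0: "scarcity \<longlonglongrightarrow> 0"
proof -
  have "(\<lambda>n. expectation (\<lambda>\<omega>. 1 / num_moves X n \<omega>)) \<longlonglongrightarrow> 0"
  proof (rule tendsto_sandwich[OF _ _ tendsto_const])
    show "\<forall>\<^sub>F n in sequentially. expectation (\<lambda>\<omega>. 1 / num_moves X n \<omega>) \<le> growth (\<beta> / 2) 1 / growth (\<beta> / 2) n"
      using eventually_ge_at_top[of 1] by eventually_elim (rule expectation_inverse_moves_le)
    show "(\<lambda>n. growth (\<beta> / 2) 1 / growth (\<beta> / 2) n) \<longlonglongrightarrow> 0"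
      using \<beta>_bounds by (intro real_tendsto_divide_at_top[OF tendsto_const] growth_filterlim) auto
  qed (simp add: integral_nonneg num_moves_nonneg)
  from tendsto_real_sqrt[OF this] show ?thesis by (simp add: scarcity_def[abs_def])
qed

lemma inverse_moves_bounds:
  assumes "regular \<omega>" "1 \<le> k"
  shows "0 < 1 / num_moves X k \<omega>" "1 / num_moves X k \<omega> \<le> 1"
    "0 < 1 / sqrt (num_moves X k \<omega>)" "1 / sqrt (num_moves X k \<omega>) \<le> 1"
  using num_moves_ge_1[OF assms] by auto

lemma expectation_inverse_sqrt_moves_le:
  assumes "1 \<le> k"
  shows "expectation (\<lambda>\<omega>. 1 / sqrt (num_moves X k \<omega>)) \<le> scarcity k"
proof -
  have ae: "AE \<omega> in P. 0 < 1 / num_moves X k \<omega> \<and> 1 / num_moves X k \<omega> \<le> 1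
      \<and> 0 < 1 / sqrt (num_moves X k \<omega>) \<and> 1 / sqrt (num_moves X k \<omega>) \<le> 1"
    using AE_regular by eventually_elim (use inverse_moves_bounds[OF _ assms] in blast)
  have "expectation (\<lambda>\<omega>. 1 / sqrt (num_moves X k \<omega>)) \<le> sqrt (expectation (\<lambda>\<omega>. (1 / sqrt (num_moves X k \<omega>))\<^sup>2))"
  proof (rule expectation_le_sqrt_second_moment)
    show "integrable P (\<lambda>\<omega>. 1 / sqrt (num_moves X k \<omega>))"
      by (rule integrable_const_bound[where B=1, OF eventually_mono[OF ae]])
         (auto simp only: real_norm_def abs_of_pos, measurable)
    show "integrable P (\<lambda>\<omega>. (1 / sqrt (num_moves X k \<omega>))\<^sup>2)"
    proof (rule integrable_const_bound[where B=1, OF eventually_mono[OF ae]])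
      fix \<omega> assume "0 < 1 / num_moves X k \<omega> \<and> 1 / num_moves X k \<omega> \<le> 1
        \<and> 0 < 1 / sqrt (num_moves X k \<omega>) \<and> 1 / sqrt (num_moves X k \<omega>) \<le> 1"
      then have "(1 / sqrt (num_moves X k \<omega>))\<^sup>2 \<le> 1\<^sup>2" by (intro power_mono) auto
      then show "norm ((1 / sqrt (num_moves X k \<omega>))\<^sup>2) \<le> 1" by simp
    qed measurable
  qed
  then show ?thesis by (simp add: scarcity_def power_divide num_moves_nonneg)
qed

text \<open>
  The relative error of \<open>\<Sigma>\<^sub>k b\<^sub>j / b\<^sub>k\<close> as a prediction of \<open>\<Sigma>\<^sub>j\<close>, with \<open>b\<^sub>j = growth \<beta> j\<close>.
\<close>

definition deviation :: "nat \<Rightarrow> nat \<Rightarrow> 'a \<Rightarrow> real" where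
  "deviation k j \<omega> = num_moves X j \<omega> * growth \<beta> k / (num_moves X k \<omega> * growth \<beta> j) - 1"

lemma deviation_measurable [measurable]: "random_variable borel (deviation k j)"
  unfolding deviation_def by measurable

lemma deviation_bound:
  assumes "regular \<omega>" "1 \<le> k" "k \<le> j"
  shows "\<bar>deviation k j \<omega>\<bar> \<le> real j + 1"
proof -
  let ?t = "num_moves X k \<omega>" and ?s = "num_moves X j \<omega>"
  have t: "1 \<le> ?t" "0 \<le> ?s" "?s \<le> real j" using num_moves_ge_1[OF assms(1,2)] num_moves_nonneg num_moves_le by auto
  have b: "0 < growth \<beta> k" "growth \<beta> k \<le> growth \<beta> j"
    using growth_pos[of \<beta> k] growth_mono[of \<beta> k j] assms \<beta>_bounds by auto
  have "?s * growth \<beta> k / (?t * growth \<beta> j) = (?s / ?t) * (growth \<beta> k / growth \<beta> j)" by simp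
  also have "\<dots> \<le> real j * 1"
  proof (rule mult_mono)
    have "real j * 1 \<le> real j * ?t" using t by (intro mult_left_mono) auto
    then show "?s / ?t \<le> real j" using t by (simp add: divide_le_eq)
  qed (use t b in auto)
  finally have "?s * growth \<beta> k / (?t * growth \<beta> j) \<le> real j" by simp
  moreover have "0 \<le> ?s * growth \<beta> k / (?t * growth \<beta> j)" using t b by auto
  ultimately show ?thesis unfolding deviation_def by linarith
qed

lemma deviation_integrable:
  assumes "1 \<le> k" "k \<le> j"
  shows "integrable P (\<lambda>\<omega>. \<bar>deviation k j \<omega>\<bar>)" "integrable P (\<lambda>\<omega>. (deviation k j \<omega>)\<^sup>2)"
proof -
  show "integrable P (\<lambda>\<omega>. \<bar>deviation k j \<omega>\<bar>)"
    by (rule integrable_const_bound[where B="real j + 1"])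
       (rule eventually_mono[OF AE_regular], simp add: deviation_bound[OF _ assms], simp)
  show "integrable P (\<lambda>\<omega>. (deviation k j \<omega>)\<^sup>2)"
  proof (rule integrable_const_bound[where B="(real j + 1)\<^sup>2"])
    show "AE \<omega> in P. norm ((deviation k j \<omega>)\<^sup>2) \<le> (real j + 1)\<^sup>2"
      using AE_regular
    proof eventually_elim
      case (elim \<omega>)
      have "\<bar>deviation k j \<omega>\<bar>\<^sup>2 \<le> (real j + 1)\<^sup>2"
        using deviation_bound[OF elim assms] by (intro power_mono) auto
      then show ?case by simp
    qed
  qed simp
qed

text \<open>
  This is \<open>moves_variance\<close> with the weight \<open>1 / \<Sigma>\<^sub>k\<^sup>2\<close>.
\<close>

lemma expectation_abs_deviation_le:
  assumes k: "1 \<le> k" "k \<le> j"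
  shows "expectation (\<lambda>\<omega>. \<bar>deviation k j \<omega>\<bar>) \<le> scarcity k"
proof -
  let ?g = "\<lambda>\<omega>. (1 / num_moves X k \<omega>)\<^sup>2"
  have [measurable]: "num_moves X k \<in> borel_measurable (known source_val (past k))"
    by (rule num_moves_known) auto
  have b: "0 < growth \<beta> k" "0 < growth \<beta> j" using growth_pos k \<alpha>_bounds by auto
  have "expectation (\<lambda>\<omega>. (deviation k j \<omega>)\<^sup>2)
    = expectation (\<lambda>\<omega>. (growth \<beta> k)\<^sup>2 * (?g \<omega> * (num_moves X j \<omega> / growth \<beta> j - num_moves X k \<omega> / growth \<beta> k)\<^sup>2))"
  proof (rule integral_cong_AE)
    show "AE \<omega> in P. (deviation k j \<omega>)\<^sup>2 = (growth \<beta> k)\<^sup>2 * (?g \<omega> * (num_moves X j \<omega> / growth \<beta> j - num_moves X k \<omega> / growth \<beta> k)\<^sup>2)"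
      using AE_regular
    proof eventually_elim
      case (elim \<omega>)
      have "num_moves X k \<omega> > 0" using num_moves_ge_1[OF elim k(1)] by simp
      then have "deviation k j \<omega> = growth \<beta> k * (1 / num_moves X k \<omega>) * (num_moves X j \<omega> / growth \<beta> j - num_moves X k \<omega> / growth \<beta> k)"
        using b by (simp add: deviation_def field_simps)
      then show ?case by (simp only: power_mult_distrib mult.assoc)
    qed
  qed (auto simp: deviation_def)
  also have "\<dots> = (growth \<beta> k)\<^sup>2 * expectation (\<lambda>\<omega>. ?g \<omega> * (num_moves X j \<omega> / growth \<beta> j - num_moves X k \<omega> / growth \<beta> k)\<^sup>2)"
    by simp
  also have "\<dots> \<le> (growth \<beta> k)\<^sup>2 * (expectation (\<lambda>\<omega>. ?g \<omega> * num_moves X k \<omega>) / growth \<beta> k * (1 / growth \<beta> k - 1 / growth \<beta> j))"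
  proof (rule mult_left_mono[OF moves_variance[OF _ _ k]])
    show "AE \<omega> in P. 0 \<le> ?g \<omega> \<and> ?g \<omega> \<le> 1"
      using AE_regular
    proof eventually_elim
      case (elim \<omega>)
      have "?g \<omega> \<le> 1\<^sup>2" by (intro power_mono inverse_moves_bounds elim k) (auto simp: num_moves_nonneg)
      then show ?case by simp
    qed
  qed auto
  also have "expectation (\<lambda>\<omega>. ?g \<omega> * num_moves X k \<omega>) = expectation (\<lambda>\<omega>. 1 / num_moves X k \<omega>)"
    by (rule integral_cong_AE) (use AE_regular in \<open>auto elim!: eventually_mono simp: power2_eq_square\<close>)
  also have "(growth \<beta> k)\<^sup>2 * (expectation (\<lambda>\<omega>. 1 / num_moves X k \<omega>) / growth \<beta> k * (1 / growth \<beta> k - 1 / growth \<beta> j))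
    = expectation (\<lambda>\<omega>. 1 / num_moves X k \<omega>) * (1 - growth \<beta> k / growth \<beta> j)"
    using b by (simp add: power2_eq_square field_simps)
  also have "\<dots> \<le> expectation (\<lambda>\<omega>. 1 / num_moves X k \<omega>)"
    using b growth_mono[of \<beta> k j] k \<beta>_bounds
    by (intro mult_right_le_one_le integral_nonneg) (auto simp: num_moves_nonneg)
  finally have *: "expectation (\<lambda>\<omega>. (deviation k j \<omega>)\<^sup>2) \<le> expectation (\<lambda>\<omega>. 1 / num_moves X k \<omega>)" .
  have "expectation (\<lambda>\<omega>. \<bar>deviation k j \<omega>\<bar>) \<le> sqrt (expectation (\<lambda>\<omega>. \<bar>deviation k j \<omega>\<bar>\<^sup>2))"
    using deviation_integrable[OF k] by (intro expectation_le_sqrt_second_moment) auto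
  also have "\<dots> \<le> scarcity k" unfolding scarcity_def using * by simp
  finally show ?thesis .
qed

text \<open>
  With \<open>b = growth \<beta>\<close> and since \<open>\<bar>W\<^sub>j\<bar> \<le> \<Sigma>\<^sub>j\<close>, this bounds the mean of \<open>(W\<^sub>j / j)\<^sup>2 / \<Sigma>\<^sub>k\<close> by
  \<open>4 b\<^sub>j / (b\<^sub>1 j)\<close> times \<open>b\<^sub>j / (b\<^sub>k j)\<close>, which is the mean of \<open>\<Sigma>\<^sub>j / (\<Sigma>\<^sub>k j)\<close>. The first factor tends to 0, so
  the squared drift is negligible against the variance.
\<close>

lemma expectation_moves_squared_le:
  assumes k: "1 \<le> k" "k \<le> j"
  shows "expectation (\<lambda>\<omega>. (num_moves X j \<omega>)\<^sup>2 / num_moves X k \<omega>)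
    \<le> 4 * (growth \<beta> j)\<^sup>2 / (growth \<beta> k * growth \<beta> 1)"
proof -
  let ?g = "\<lambda>\<omega>. 1 / num_moves X k \<omega>" and ?b = "growth \<beta> j" and ?c = "growth \<beta> k"
  let ?D = "\<lambda>\<omega>. num_moves X j \<omega> / ?b - num_moves X k \<omega> / ?c"
  have [measurable]: "num_moves X k \<in> borel_measurable (known source_val (past k))"
    by (rule num_moves_known) auto
  have b: "0 < ?c" "0 < ?b" "0 < growth \<beta> 1" "growth \<beta> 1 \<le> ?c"
    using growth_pos growth_mono[of \<beta> 1 k] k \<alpha>_bounds \<beta>_bounds by auto
  have gb: "AE \<omega> in P. 0 \<le> ?g \<omega> \<and> ?g \<omega> \<le> 1"
    using AE_regular by eventually_elim (use inverse_moves_bounds k in \<open>auto simp: num_moves_nonneg\<close>)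
  have var: "expectation (\<lambda>\<omega>. ?g \<omega> * (?D \<omega>)\<^sup>2) \<le> 1 / (?c * growth \<beta> 1)"
  proof -
    have "expectation (\<lambda>\<omega>. ?g \<omega> * num_moves X k \<omega>) = expectation (\<lambda>\<omega>. 1)"
    proof (rule integral_cong_AE)
      show "AE \<omega> in P. ?g \<omega> * num_moves X k \<omega> = 1"
        using AE_regular
      proof eventually_elim
        case (elim \<omega>)
        then show ?case using num_moves_ge_1[OF elim k(1)] by simp
      qed
    qed auto
    then have "expectation (\<lambda>\<omega>. ?g \<omega> * (?D \<omega>)\<^sup>2) \<le> 1 / ?c * (1 / ?c - 1 / ?b)"
      using moves_variance[OF _ gb k] prob_space by simp
    also have "\<dots> \<le> 1 / ?c * (1 / growth \<beta> 1)"
    proof (rule mult_left_mono)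
      have "1 / ?c \<le> 1 / growth \<beta> 1" using b by (intro divide_left_mono) auto
      then show "1 / ?c - 1 / ?b \<le> 1 / growth \<beta> 1" using b by (smt (verit) divide_pos_pos)
    qed (use b in auto)
    finally show ?thesis by simp
  qed
  have bnd: "\<bar>num_moves X i \<omega> / c\<bar> \<le> real i / c" if "c > 0" for i c \<omega>
    using num_moves_le[of i \<omega>] num_moves_nonneg[of i \<omega>] that by (simp add: divide_right_mono)
  have intD: "integrable P (\<lambda>\<omega>. ?g \<omega> * (?D \<omega>)\<^sup>2)"
  proof (rule integrable_const_bound[where B="1 * (real j / ?b + real k / ?c)\<^sup>2"])
    show "AE \<omega> in P. norm (?g \<omega> * (?D \<omega>)\<^sup>2) \<le> 1 * (real j / ?b + real k / ?c)\<^sup>2"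
      using gb
    proof eventually_elim
      case (elim \<omega>)
      have "\<bar>?D \<omega>\<bar> \<le> real j / ?b + real k / ?c"
        using bnd[OF b(2), of j \<omega>] bnd[OF b(1), of k \<omega>] by linarith
      then have D2: "(?D \<omega>)\<^sup>2 \<le> (real j / ?b + real k / ?c)\<^sup>2"
        by (metis abs_ge_zero power2_abs power_mono)
      have "norm (?g \<omega> * (?D \<omega>)\<^sup>2) = ?g \<omega> * (?D \<omega>)\<^sup>2" using elim by (simp add: abs_mult)
      also have "\<dots> \<le> 1 * (real j / ?b + real k / ?c)\<^sup>2" using elim D2 by (intro mult_mono) auto
      finally show ?case .
    qed
  qed simp
  have intk: "integrable P (num_moves X k)"
    using integrable_weighted_moves[of "\<lambda>_. 1" 1 k] by simp
  have "expectation (\<lambda>\<omega>. (num_moves X j \<omega>)\<^sup>2 / num_moves X k \<omega>)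
    \<le> expectation (\<lambda>\<omega>. 2 * ?b\<^sup>2 * (?g \<omega> * (?D \<omega>)\<^sup>2) + 2 * ?b\<^sup>2 / ?c\<^sup>2 * num_moves X k \<omega>)"
  proof (rule integral_mono_AE')
    show "integrable P (\<lambda>\<omega>. 2 * ?b\<^sup>2 * (?g \<omega> * (?D \<omega>)\<^sup>2) + 2 * ?b\<^sup>2 / ?c\<^sup>2 * num_moves X k \<omega>)"
      by (intro Bochner_Integration.integrable_add integrable_mult_right intD intk)
    show "AE \<omega> in P. 0 \<le> 2 * ?b\<^sup>2 * (?g \<omega> * (?D \<omega>)\<^sup>2) + 2 * ?b\<^sup>2 / ?c\<^sup>2 * num_moves X k \<omega>"
      by (auto intro!: AE_I2 add_nonneg_nonneg simp: num_moves_nonneg)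
    show "AE \<omega> in P. (num_moves X j \<omega>)\<^sup>2 / num_moves X k \<omega>
      \<le> 2 * ?b\<^sup>2 * (?g \<omega> * (?D \<omega>)\<^sup>2) + 2 * ?b\<^sup>2 / ?c\<^sup>2 * num_moves X k \<omega>"
      using AE_regular
    proof eventually_elim
      case (elim \<omega>)
      define t where "t = num_moves X k \<omega>"
      have t: "1 \<le> t" using num_moves_ge_1[OF elim k(1)] by (simp add: t_def)
      have "num_moves X j \<omega> / ?b = ?D \<omega> + t / ?c" by (simp add: t_def)
      moreover have "(x + y)\<^sup>2 \<le> 2 * x\<^sup>2 + 2 * y\<^sup>2" for x y :: real
        using zero_le_power2[of "x - y"] by (simp add: power2_eq_square algebra_simps)
      ultimately have "(num_moves X j \<omega> / ?b)\<^sup>2 \<le> 2 * (?D \<omega>)\<^sup>2 + 2 * (t / ?c)\<^sup>2" by metis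
      then have "?b\<^sup>2 / t * (num_moves X j \<omega> / ?b)\<^sup>2 \<le> ?b\<^sup>2 / t * (2 * (?D \<omega>)\<^sup>2 + 2 * (t / ?c)\<^sup>2)"
        using t by (intro mult_left_mono) auto
      moreover have "?b\<^sup>2 / t * (num_moves X j \<omega> / ?b)\<^sup>2 = (num_moves X j \<omega>)\<^sup>2 / t"
        using b by (simp add: power_divide)
      moreover have "?b\<^sup>2 / t * (2 * (?D \<omega>)\<^sup>2 + 2 * (t / ?c)\<^sup>2)
        = 2 * ?b\<^sup>2 * (1 / t * (?D \<omega>)\<^sup>2) + 2 * ?b\<^sup>2 / ?c\<^sup>2 * t"
      proof -
        have "?b\<^sup>2 / t * (2 * d\<^sup>2 + 2 * (t / ?c)\<^sup>2) = 2 * ?b\<^sup>2 * (1 / t * d\<^sup>2) + 2 * ?b\<^sup>2 / ?c\<^sup>2 * t" for d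
          using t b(1) by (simp add: field_simps power2_eq_square)
        then show ?thesis .
      qed
      ultimately show ?case unfolding t_def by linarith
    qed
  qed
  also have "\<dots> = 2 * ?b\<^sup>2 * expectation (\<lambda>\<omega>. ?g \<omega> * (?D \<omega>)\<^sup>2) + 2 * ?b\<^sup>2 / ?c\<^sup>2 * expectation (num_moves X k)"
    by (simp only: Bochner_Integration.integral_add[OF integrable_mult_right[OF intD] integrable_mult_right[OF intk]]
        integral_mult_right_zero)
  also have "\<dots> \<le> 2 * ?b\<^sup>2 * (1 / (?c * growth \<beta> 1)) + 2 * ?b\<^sup>2 / ?c\<^sup>2 * (?c / growth \<beta> 1)"
    using var expectation_num_moves[OF k(1)] by (intro add_mono mult_left_mono) auto
  also have "\<dots> = 4 * ?b\<^sup>2 / (?c * growth \<beta> 1)"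
    using b by (simp add: power2_eq_square)
  finally show ?thesis .
qed

section \<open>A central limit estimate for martingale differences\<close>

text \<open>
  The conditional variance of \<open>w / sqrt \<Sigma>\<^sub>k\<close> times a centred fresh step at time \<open>j\<close>, after \<open>\<Sigma>\<^sub>j\<close> has been
  replaced by its prediction \<open>\<Sigma>\<^sub>k b\<^sub>j / b\<^sub>k\<close> and the squared drift has been dropped. The random factor
  \<open>\<Sigma>\<^sub>k\<close> cancels, which is why the sums are normed by \<open>sqrt \<Sigma>\<^sub>k\<close>.
\<close>

definition step_variance :: "nat \<Rightarrow> nat \<Rightarrow> real \<Rightarrow> real" where
  "step_variance k j w = w\<^sup>2 * \<beta> * growth \<beta> j / (growth \<beta> k * real j)"

text \<open>
  The terms account for the third moments, the squared drift, the deviation of \<open>\<Sigma>\<^sub>j\<close> from its prediction, and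
  the expansion of the Gaussian factor, in this order. The bound \<open>K\<close> is for the weights.
\<close>

definition char_error :: "nat \<Rightarrow> real \<Rightarrow> real" where
  "char_error k K = K / 3 * scarcity k + 2 * \<alpha>\<^sup>2 / (\<beta> * growth \<beta> 1) * (growth \<beta> k / real k)
     + scarcity k / 2 + K\<^sup>2 * \<beta> / (4 * real k)"

lemma char_error_tendsto_0: "(\<lambda>k. char_error k K) \<longlonglongrightarrow> 0"
proof -
  have "(\<lambda>k. char_error k K) \<longlonglongrightarrow> K / 3 * 0 + 2 * \<alpha>\<^sup>2 / (\<beta> * growth \<beta> 1) * 0 + 0 / 2 + 0"
    unfolding char_error_def
    using \<beta>_bounds \<alpha>_bounds
    by (intro tendsto_add tendsto_mult tendsto_divide tendsto_const scarcity_tendsto_0 growth_over_id_tendsto_0)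
       (auto, real_asymp)
  then show ?thesis by simp
qed

lemma step_variance_nonneg: "1 \<le> k \<Longrightarrow> 1 \<le> j \<Longrightarrow> 0 \<le> step_variance k j w"
  unfolding step_variance_def using growth_pos[of \<beta> k] growth_pos[of \<beta> j] \<beta>_bounds by auto

lemma step_variance_le:
  assumes "1 \<le> k" "k \<le> j" "\<bar>w\<bar> \<le> K"
  shows "step_variance k j w \<le> K\<^sup>2 * \<beta> / real k"
proof -
  have "step_variance k j w = w\<^sup>2 * (\<beta> / growth \<beta> k * (growth \<beta> j / real j))"
    by (simp add: step_variance_def)
  also have "\<dots> \<le> K\<^sup>2 * (\<beta> / growth \<beta> k * (growth \<beta> k / real k))"
  proof (intro mult_mono mult_left_mono)
    show "w\<^sup>2 \<le> K\<^sup>2" using assms(3) by (metis abs_ge_zero power2_abs power_mono)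
    show "growth \<beta> j / real j \<le> growth \<beta> k / real k"
      using assms \<beta>_bounds by (intro growth_over_id_antimono) auto
  qed (use \<beta>_bounds growth_pos[of \<beta> k] growth_pos[of \<beta> j] assms in auto)
  also have "\<dots> = K\<^sup>2 * \<beta> / real k" using growth_pos[of \<beta> k] assms \<alpha>_bounds by simp
  finally show ?thesis .
qed

text \<open>
  Conditioning on \<open>J\<close> reduces the difference to \<open>lazy_step_char_bound\<close> with the random parameters
  \<open>\<theta> = w / sqrt \<Sigma>\<^sub>k\<close>, \<open>\<delta> = \<alpha> W\<^sub>j / j\<close> and \<open>a = \<beta> \<Sigma>\<^sub>j / j\<close>; its error terms are then integrated by means of the
  moment estimates for the number of moves.
\<close>

lemma fresh_step_char:
  assumes Z: "fresh_step J j Z" and k: "1 \<le> k" "k \<le> j"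
    and G: "G \<in> borel_measurable (known source_val J)" and bdd: "\<And>\<omega>. cmod (G \<omega>) \<le> 1"
    and w: "\<bar>w\<bar> \<le> K"
  shows "cmod (expectation (\<lambda>\<omega>. G \<omega> * iexp (w * (Z \<omega> - \<alpha> * walk X j \<omega> / real j) / sqrt (num_moves X k \<omega>)))
      - of_real (exp (- step_variance k j w / 2)) * expectation G) \<le> step_variance k j w * char_error k K"
proof -
  note Zm = fresh_step_measurable[OF Z]
  define u where "u = step_variance k j w"
  have u: "0 \<le> u" "u \<le> K\<^sup>2 * \<beta> / real k"
    using step_variance_nonneg[of k j w] step_variance_le[OF k w] k by (auto simp: u_def)
  have b: "0 < growth \<beta> k" "0 < growth \<beta> j" "0 < growth \<beta> 1"
    using growth_pos k \<alpha>_bounds by auto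
  have j: "1 \<le> j" using k by simp
  have [measurable]: "G \<in> borel_measurable (known source_val J)"
    "walk X j \<in> borel_measurable (known source_val J)"
    "num_moves X k \<in> borel_measurable (known source_val J)"
    using G walk_known[OF Zm(4) order_refl] num_moves_known[OF Zm(4) k(2)] by auto
  have [measurable]: "random_variable borel G" using measurable_of_known_sources[OF Zm(5) G] .
  have [measurable]: "random_variable borel Z" by (rule Zm)
  define \<theta> where "\<theta> \<omega> = w / sqrt (num_moves X k \<omega>)" for \<omega>
  define \<delta> where "\<delta> \<omega> = \<alpha> * walk X j \<omega> / real j" for \<omega>
  define a where "a \<omega> = \<beta> * num_moves X j \<omega> / real j" for \<omega>
  define f where "f x \<omega> = iexp (\<theta> \<omega> * (x - \<delta> \<omega>))" for x \<omega>
  have [measurable]: "\<theta> \<in> borel_measurable (known source_val J)" "\<delta> \<in> borel_measurable (known source_val J)"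
    unfolding \<theta>_def \<delta>_def by measurable
  have [measurable]: "random_variable borel \<theta>" "random_variable borel \<delta>" "random_variable borel a"
    unfolding \<theta>_def \<delta>_def a_def by measurable
  define \<phi> where "\<phi> \<omega> = f 0 \<omega> + of_real (\<delta> \<omega>) * ((f 1 \<omega> - f (-1) \<omega>) / 2) + of_real (a \<omega>) * ((f 1 \<omega> + f (-1) \<omega>) / 2 - f 0 \<omega>)" for \<omega>
  have [measurable]: "random_variable borel \<phi>" unfolding \<phi>_def f_def by measurable
  have intG: "integrable P G" by (rule integrable_const_bound[where B=1]) (use bdd in auto)
  have "expectation (\<lambda>\<omega>. G \<omega> * iexp (w * (Z \<omega> - \<alpha> * walk X j \<omega> / real j) / sqrt (num_moves X k \<omega>)))
    = expectation (\<lambda>\<omega>. G \<omega> * f (Z \<omega>) \<omega>)"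
    by (simp add: f_def \<theta>_def \<delta>_def)
  also have "\<dots> = expectation (\<lambda>\<omega>. mean_step j (\<lambda>x \<omega>. G \<omega> * f x \<omega>) \<omega>)"
  proof (rule fresh_step_expectation[OF Z, where B=1])
    show "(\<lambda>(x, \<omega>). G \<omega> * f x \<omega>) \<in> borel_measurable (borel \<Otimes>\<^sub>M known source_val J)"
      unfolding f_def by measurable
    show "AE \<omega> in P. \<forall>x\<in>{-1, 0, 1}. cmod (G \<omega> * f x \<omega>) \<le> 1"
      using bdd by (auto simp: norm_mult f_def)
  qed
  also have "\<dots> = expectation (\<lambda>\<omega>. G \<omega> * \<phi> \<omega>)"
    by (intro Bochner_Integration.integral_cong) (auto simp: mean_step_def \<phi>_def \<delta>_def a_def algebra_simps diff_divide_distrib add_divide_distrib)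
  finally have eq: "expectation (\<lambda>\<omega>. G \<omega> * iexp (w * (Z \<omega> - \<alpha> * walk X j \<omega> / real j) / sqrt (num_moves X k \<omega>)))
    = expectation (\<lambda>\<omega>. G \<omega> * \<phi> \<omega>)" .
  define c1 where "c1 = \<bar>w\<bar>^3 * \<beta> / (3 * real j)"
  define c2 where "c2 = w\<^sup>2 * \<alpha>\<^sup>2 / (2 * (real j)\<^sup>2)"
  define g where "g \<omega> = 1 / (num_moves X k \<omega> * sqrt (num_moves X k \<omega>))" for \<omega>
  have g_k: "g \<in> borel_measurable (known source_val (past k))"
  proof -
    have [measurable]: "num_moves X k \<in> borel_measurable (known source_val (past k))"
      by (rule num_moves_known) auto
    show ?thesis unfolding g_def by measurable
  qed
  have gm [measurable]: "random_variable borel g" unfolding g_def by measurable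
  have g_bdd: "AE \<omega> in P. \<bar>g \<omega>\<bar> \<le> 1"
    using AE_regular
  proof eventually_elim
    case (elim \<omega>)
    have "1 * 1 \<le> num_moves X k \<omega> * sqrt (num_moves X k \<omega>)"
      using num_moves_ge_1[OF elim k(1)] by (intro mult_mono) auto
    then show ?case by (simp add: g_def)
  qed
  \<comment> \<open>an integrable majorant for the bound of \<open>lazy_step_char_bound\<close>\<close>
  define H where "H \<omega> = c1 * (g \<omega> * num_moves X j \<omega>) + c2 * ((num_moves X j \<omega>)\<^sup>2 / num_moves X k \<omega>)
    + u / 2 * \<bar>deviation k j \<omega>\<bar> + u\<^sup>2 / 4" for \<omega>
  have pointwise: "cmod (\<phi> \<omega> - of_real (exp (- u / 2))) \<le> H \<omega>" if \<omega>: "regular \<omega>" for \<omega>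
  proof -
    define t where "t = num_moves X k \<omega>"
    define y where "y = num_moves X j \<omega>"
    have t: "1 \<le> t" using num_moves_ge_1[OF \<omega> k(1)] by (simp add: t_def)
    have y: "0 \<le> y" "y \<le> real j" using num_moves_nonneg num_moves_le by (auto simp: y_def)
    have W: "\<bar>walk X j \<omega>\<bar> \<le> y" using abs_walk_le[OF \<omega>] by (simp add: y_def)
    have "\<bar>\<delta> \<omega>\<bar> = \<bar>\<alpha>\<bar> * \<bar>walk X j \<omega>\<bar> / real j" by (simp add: \<delta>_def abs_mult)
    also have "\<dots> \<le> \<beta> * y / real j"
      using W \<alpha>_bounds \<beta>_bounds y by (intro divide_right_mono mult_mono) auto
    finally have \<delta>a: "\<bar>\<delta> \<omega>\<bar> \<le> a \<omega>" by (simp add: a_def y_def)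
    have "\<beta> * y \<le> 1 * real j" using y \<beta>_bounds by (intro mult_mono) auto
    then have a1: "a \<omega> \<le> 1" using j by (simp add: a_def y_def divide_le_eq)
    have sq: "(sqrt t)\<^sup>2 = t" "\<bar>sqrt t\<bar>^3 = t * sqrt t" using t by (auto simp: power3_eq_cube)
    have T1: "\<bar>\<theta> \<omega>\<bar>^3 * a \<omega> / 3 = c1 * (g \<omega> * y)"
    proof -
      have "\<bar>\<theta> \<omega>\<bar>^3 = \<bar>w\<bar>^3 / (t * sqrt t)"
        using sq(2) by (simp add: \<theta>_def abs_divide power_divide flip: t_def)
      then show ?thesis by (simp add: a_def c1_def g_def mult_ac flip: t_def y_def)
    qed
    have T2: "(\<theta> \<omega>)\<^sup>2 * (\<delta> \<omega>)\<^sup>2 / 2 \<le> c2 * (y\<^sup>2 / t)"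
    proof -
      have "(walk X j \<omega>)\<^sup>2 \<le> y\<^sup>2" using W by (metis abs_ge_zero power2_abs power_mono)
      then have "w\<^sup>2 / t * (\<alpha>\<^sup>2 * (walk X j \<omega>)\<^sup>2 / (real j)\<^sup>2) / 2 \<le> w\<^sup>2 / t * (\<alpha>\<^sup>2 * y\<^sup>2 / (real j)\<^sup>2) / 2"
        using t by (intro divide_right_mono mult_left_mono) auto
      moreover have "(\<theta> \<omega>)\<^sup>2 * (\<delta> \<omega>)\<^sup>2 / 2 = w\<^sup>2 / t * (\<alpha>\<^sup>2 * (walk X j \<omega>)\<^sup>2 / (real j)\<^sup>2) / 2"
        unfolding \<theta>_def \<delta>_def power_divide power_mult_distrib t_def[symmetric] sq(1) ..
      moreover have "c2 * (y\<^sup>2 / t) = w\<^sup>2 / t * (\<alpha>\<^sup>2 * y\<^sup>2 / (real j)\<^sup>2) / 2"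
        by (simp add: c2_def mult_ac)
      ultimately show ?thesis by simp
    qed
    have T3: "\<bar>(\<theta> \<omega>)\<^sup>2 * a \<omega> - u\<bar> / 2 = u / 2 * \<bar>deviation k j \<omega>\<bar>"
    proof -
      have "(\<theta> \<omega>)\<^sup>2 * a \<omega> = w\<^sup>2 / t * (\<beta> * y / real j)"
        using sq(1) by (simp add: \<theta>_def a_def t_def y_def power_divide)
      also have "\<dots> = u * (y * growth \<beta> k / (t * growth \<beta> j))"
        using b t by (simp add: u_def step_variance_def)
      finally have "(\<theta> \<omega>)\<^sup>2 * a \<omega> - u = u * deviation k j \<omega>"
        by (simp add: deviation_def t_def y_def right_diff_distrib)
      then show ?thesis using u by (simp add: abs_mult)
    qed
    have "cmod (\<phi> \<omega> - of_real (exp (- u / 2))) \<le> \<bar>\<theta> \<omega>\<bar>^3 * a \<omega> / 3 + (\<theta> \<omega>)\<^sup>2 * (\<delta> \<omega>)\<^sup>2 / 2 + \<bar>(\<theta> \<omega>)\<^sup>2 * a \<omega> - u\<bar> / 2 + u\<^sup>2 / 4"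
      unfolding \<phi>_def f_def by (rule lazy_step_char_bound[OF \<delta>a a1 u(1)])
    then show ?thesis using T1 T2 T3 by (simp add: H_def t_def y_def)
  qed
  have intg: "integrable P (\<lambda>\<omega>. g \<omega> * num_moves X j \<omega>)"
    by (rule integrable_weighted_moves[OF gm g_bdd])
  have ints: "integrable P (\<lambda>\<omega>. (num_moves X j \<omega>)\<^sup>2 / num_moves X k \<omega>)"
  proof (rule integrable_const_bound[where B="(real j)\<^sup>2"])
    show "AE \<omega> in P. norm ((num_moves X j \<omega>)\<^sup>2 / num_moves X k \<omega>) \<le> (real j)\<^sup>2"
      using AE_regular
    proof eventually_elim
      case (elim \<omega>)
      have "(num_moves X j \<omega>)\<^sup>2 / num_moves X k \<omega> \<le> (real j)\<^sup>2 / 1"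
        using num_moves_ge_1[OF elim k(1)] num_moves_le[of j \<omega>] num_moves_nonneg[of j \<omega>]
        by (intro frac_le power_mono) auto
      then show ?case by (simp add: num_moves_nonneg)
    qed
  qed simp
  have intd: "integrable P (\<lambda>\<omega>. \<bar>deviation k j \<omega>\<bar>)" by (rule deviation_integrable[OF k])
  have intH: "integrable P H"
    unfolding H_def using intg ints intd
    by (intro Bochner_Integration.integrable_add integrable_mult_right integrable_const)
  have int\<phi>: "integrable P (\<lambda>\<omega>. G \<omega> * (\<phi> \<omega> - of_real (exp (- u / 2))))"
  proof (rule Bochner_Integration.integrable_bound[OF intH])
    show "AE \<omega> in P. norm (G \<omega> * (\<phi> \<omega> - of_real (exp (- u / 2)))) \<le> norm (H \<omega>)"
      using AE_regular
    proof eventually_elim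
      case (elim \<omega>)
      have "cmod (G \<omega>) * cmod (\<phi> \<omega> - of_real (exp (- u / 2))) \<le> 1 * H \<omega>"
        using bdd pointwise[OF elim] by (intro mult_mono) auto
      then show ?case by (simp add: norm_mult)
    qed
  qed measurable
  have "expectation (\<lambda>\<omega>. G \<omega> * \<phi> \<omega>) - of_real (exp (- u / 2)) * expectation G
    = expectation (\<lambda>\<omega>. G \<omega> * (\<phi> \<omega> - of_real (exp (- u / 2))))"
  proof -
    have "expectation (\<lambda>\<omega>. G \<omega> * \<phi> \<omega>) = expectation (\<lambda>\<omega>. G \<omega> * (\<phi> \<omega> - of_real (exp (- u / 2))) + of_real (exp (- u / 2)) * G \<omega>)"
      by (intro Bochner_Integration.integral_cong) (auto simp: algebra_simps)
    also have "\<dots> = expectation (\<lambda>\<omega>. G \<omega> * (\<phi> \<omega> - of_real (exp (- u / 2)))) + of_real (exp (- u / 2)) * expectation G"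
      using int\<phi> intG by (subst Bochner_Integration.integral_add) auto
    finally show ?thesis by simp
  qed
  also have "cmod \<dots> \<le> expectation (\<lambda>\<omega>. cmod (G \<omega> * (\<phi> \<omega> - of_real (exp (- u / 2)))))"
    by (rule integral_norm_bound)
  also have "\<dots> \<le> expectation H"
  proof (rule integral_mono_AE[OF integrable_norm[OF int\<phi>] intH])
    show "AE \<omega> in P. cmod (G \<omega> * (\<phi> \<omega> - of_real (exp (- u / 2)))) \<le> H \<omega>"
      using AE_regular
    proof eventually_elim
      case (elim \<omega>)
      have "cmod (G \<omega>) * cmod (\<phi> \<omega> - of_real (exp (- u / 2))) \<le> 1 * H \<omega>"
        using bdd pointwise[OF elim] by (intro mult_mono) auto
      then show ?case by (simp add: norm_mult)
    qed
  qed
  also have "\<dots> = c1 * expectation (\<lambda>\<omega>. g \<omega> * num_moves X j \<omega>) + c2 * expectation (\<lambda>\<omega>. (num_moves X j \<omega>)\<^sup>2 / num_moves X k \<omega>)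
     + u / 2 * expectation (\<lambda>\<omega>. \<bar>deviation k j \<omega>\<bar>) + u\<^sup>2 / 4"
    unfolding H_def using intg ints intd prob_space
    by (simp add: Bochner_Integration.integral_add del: times_divide_eq_right times_divide_eq_left)
  also have "\<dots> \<le> c1 * (scarcity k * (growth \<beta> j / growth \<beta> k)) + c2 * (4 * (growth \<beta> j)\<^sup>2 / (growth \<beta> k * growth \<beta> 1))
     + u / 2 * scarcity k + u * (K\<^sup>2 * \<beta> / real k) / 4"
  proof (intro add_mono mult_left_mono divide_right_mono)
    have "expectation (\<lambda>\<omega>. g \<omega> * num_moves X k \<omega>) = expectation (\<lambda>\<omega>. 1 / sqrt (num_moves X k \<omega>))"
    proof (rule integral_cong_AE)
      show "AE \<omega> in P. g \<omega> * num_moves X k \<omega> = 1 / sqrt (num_moves X k \<omega>)"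
        using AE_regular
      proof eventually_elim
        case (elim \<omega>)
        then show ?case using num_moves_ge_1[OF elim k(1)] by (simp add: g_def)
      qed
    qed auto
    then show "expectation (\<lambda>\<omega>. g \<omega> * num_moves X j \<omega>) \<le> scarcity k * (growth \<beta> j / growth \<beta> k)"
      using moves_mean[OF g_k g_bdd k] expectation_inverse_sqrt_moves_le[OF k(1)] b
      by (simp add: divide_right_mono mult_right_mono)
    have "u * u \<le> u * (K\<^sup>2 * \<beta> / real k)" using u by (intro mult_left_mono)
    then show "u\<^sup>2 \<le> u * (K\<^sup>2 * \<beta> / real k)" by (simp only: power2_eq_square[of u])
    show "expectation (\<lambda>\<omega>. (num_moves X j \<omega>)\<^sup>2 / num_moves X k \<omega>) \<le> 4 * (growth \<beta> j)\<^sup>2 / (growth \<beta> k * growth \<beta> 1)"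
      by (rule expectation_moves_squared_le[OF k])
    show "expectation (\<lambda>\<omega>. \<bar>deviation k j \<omega>\<bar>) \<le> scarcity k"
      by (rule expectation_abs_deviation_le[OF k])
    show "0 \<le> c1" "0 \<le> c2" "0 \<le> u / 2" using u \<beta>_bounds by (simp_all add: c1_def c2_def)
  qed simp
  also have "\<dots> \<le> u * char_error k K"
  proof -
    have "c1 * (scarcity k * (growth \<beta> j / growth \<beta> k)) = \<bar>w\<bar> * (u / 3 * scarcity k)"
      by (simp add: c1_def u_def step_variance_def power3_eq_cube power2_eq_square mult_ac)
    also have "\<dots> \<le> K * (u / 3 * scarcity k)"
      using w u scarcity_nonneg[of k] by (intro mult_right_mono) auto
    also have "K * (u / 3 * scarcity k) = u * (K / 3 * scarcity k)" by simp
    finally have 1: "c1 * (scarcity k * (growth \<beta> j / growth \<beta> k)) \<le> u * (K / 3 * scarcity k)" .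
    have "c2 * (4 * (growth \<beta> j)\<^sup>2 / (growth \<beta> k * growth \<beta> 1)) = u * (2 * \<alpha>\<^sup>2 / (\<beta> * growth \<beta> 1) * (growth \<beta> j / real j))"
    proof -
      have "(x * y / (2 * (real j)\<^sup>2)) * (4 * B\<^sup>2 / (C * D)) = (x * z * B / (C * real j)) * (2 * y / (z * D) * (B / real j))"
        if "0 < z" for x y z B C D :: real
        using that by (simp add: power2_eq_square mult_ac)
      then show ?thesis unfolding c2_def u_def step_variance_def using \<beta>_bounds(1) .
    qed
    also have "\<dots> \<le> u * (2 * \<alpha>\<^sup>2 / (\<beta> * growth \<beta> 1) * (growth \<beta> k / real k))"
      using u \<beta>_bounds b k by (intro mult_left_mono growth_over_id_antimono) auto
    finally have 2: "c2 * (4 * (growth \<beta> j)\<^sup>2 / (growth \<beta> k * growth \<beta> 1)) \<le> u * (2 * \<alpha>\<^sup>2 / (\<beta> * growth \<beta> 1) * (growth \<beta> k / real k))" .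
    have 3: "u / 2 * scarcity k = u * (scarcity k / 2)" "u * (K\<^sup>2 * \<beta> / real k) / 4 = u * (K\<^sup>2 * \<beta> / (4 * real k))" by simp_all
    show ?thesis unfolding char_error_def distrib_left 3 using 1 2 by linarith
  qed
  finally show ?thesis unfolding eq u_def .
qed

definition increment :: "nat \<Rightarrow> 'a \<Rightarrow> real" where
  "increment j \<omega> = X (Suc j) \<omega> - \<alpha> * walk X j \<omega> / real j"

definition row_noise :: "nat \<Rightarrow> nat \<Rightarrow> 'a \<Rightarrow> real" where
  "row_noise n i \<omega> = \<eta> n i \<omega> * X (V n i \<omega>) \<omega> - \<alpha> * walk X (m n) \<omega> / real (m n)"

lemma increment_known:
  assumes "1 \<le> j" "j < N"
  shows "increment j \<in> borel_measurable (known source_val (past N))"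
proof -
  have [measurable]: "X (Suc j) \<in> borel_measurable (known source_val (past N))"
    "walk X j \<in> borel_measurable (known source_val (past N))"
    using assms by (auto intro!: X_known_past[OF order_refl] walk_known[OF order_refl])
  show ?thesis unfolding increment_def by measurable
qed

lemma row_noise_known:
  assumes "m n < i" "i \<le> n" "i < l"
  shows "row_noise n i \<in> borel_measurable (known source_val (row_past n l))"
proof -
  let ?N = "known source_val (row_past n l)"
  have V_known: "(\<lambda>\<omega>. real (V n i \<omega>)) \<in> borel_measurable ?N"
    using measurable_known[of "Array_Memory n i" "row_past n l" source_val] assms by (simp add: row_past_def)
  have [measurable]: "\<eta> n i \<in> borel_measurable ?N"
    using measurable_known[of "Array_Move n i" "row_past n l" source_val] assms by (simp add: row_past_def)
  have [measurable]: "walk X (m n) \<in> borel_measurable ?N"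
    by (rule walk_known[OF past_subset_row_past order_refl])
  have [measurable]: "(\<lambda>\<omega>. X (V n i \<omega>) \<omega>) \<in> borel_measurable ?N"
  proof (rule measurable_random_index[OF V_known])
    show "V n i \<omega> \<in> {1..m n}" if "\<omega> \<in> space ?N" for \<omega>
      using measurable_space[OF V_measurable[OF assms(1,2)]] that by simp
    show "X u \<in> borel_measurable ?N" if "u \<in> {1..m n}" for u
      using that by (intro X_known_past[OF past_subset_row_past[of "m n"]]) auto
  qed
  show ?thesis unfolding row_noise_def by measurable
qed

lemma row_noise_sum_measurable [measurable]:
  "random_variable borel (\<lambda>\<omega>. \<Sum>i=m n..<n. row_noise n (Suc i) \<omega>)"
  using row_past_subset_sources[of "Suc n" n]
  by (intro borel_measurable_sum measurable_of_known_sources[OF _ row_noise_known[where l="Suc n"]]) auto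

definition walk_part :: "nat \<Rightarrow> (nat \<Rightarrow> real) \<Rightarrow> nat \<Rightarrow> 'a \<Rightarrow> real" where
  "walk_part k w N \<omega> = (\<Sum>j=k..<N. w j * increment j \<omega>) / sqrt (num_moves X k \<omega>)"

definition row_part :: "nat \<Rightarrow> nat \<Rightarrow> nat \<Rightarrow> 'a \<Rightarrow> real" where
  "row_part k n l \<omega> = (\<Sum>i=m n..<l. row_noise n (Suc i) \<omega>) / sqrt (num_moves X k \<omega>)"

lemma walk_part_known:
  assumes "1 \<le> k" "k \<le> N"
  shows "walk_part k w N \<in> borel_measurable (known source_val (past N))"
proof -
  have [measurable]: "num_moves X k \<in> borel_measurable (known source_val (past N))"
    by (rule num_moves_known[OF order_refl assms(2)])
  have [measurable]: "(\<lambda>\<omega>. \<Sum>j=k..<N. w j * increment j \<omega>) \<in> borel_measurable (known source_val (past N))"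
    using assms by (intro borel_measurable_sum borel_measurable_times increment_known) auto
  show ?thesis unfolding walk_part_def[abs_def] by measurable
qed

lemma row_part_known:
  assumes "l \<le> n"
  shows "row_part k n l \<in> borel_measurable (known source_val (row_past n (Suc l)))"
proof -
  have [measurable]: "num_moves X k \<in> borel_measurable (known source_val (row_past n (Suc l)))"
    by (rule num_moves_known[OF past_subset_row_past order_refl])
  have [measurable]: "(\<lambda>\<omega>. \<Sum>i=m n..<l. row_noise n (Suc i) \<omega>) \<in> borel_measurable (known source_val (row_past n (Suc l)))"
    using assms by (intro borel_measurable_sum row_noise_known) auto
  show ?thesis unfolding row_part_def[abs_def] by measurable
qed

lemma walk_part_measurable [measurable]:
  assumes "1 \<le> k" shows "random_variable borel (walk_part k w N)"
proof (cases "k \<le> N")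
  case True
  show ?thesis by (rule measurable_of_known_sources[OF past_subset_sources walk_part_known[OF assms True]])
qed (simp add: walk_part_def[abs_def])

lemma row_part_measurable [measurable]:
  assumes "l \<le> n" shows "random_variable borel (row_part k n l)"
  by (rule measurable_of_known_sources[OF row_past_subset_sources row_part_known[OF assms]]) (use assms in simp)

lemma walk_part_char:
  assumes k: "1 \<le> k" "k \<le> N" and w: "\<And>j. k \<le> j \<Longrightarrow> j < N \<Longrightarrow> \<bar>w j\<bar> \<le> K"
  shows "cmod (expectation (\<lambda>\<omega>. iexp (walk_part k w N \<omega>)) - of_real (exp (- (\<Sum>j=k..<N. step_variance k j (w j)) / 2)))
     \<le> (\<Sum>j=k..<N. step_variance k j (w j)) * char_error k K"
proof -
  define z where "z j = expectation (\<lambda>\<omega>. iexp (walk_part k w j \<omega>))" for j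
  have "cmod (z N - of_real (exp (- (\<Sum>j=k..<N. step_variance k j (w j)) / 2)) * z k)
    \<le> (\<Sum>j=k..<N. step_variance k j (w j)) * char_error k K"
  proof (rule char_chain[OF k(2)])
    fix j assume j: "k \<le> j" "j < N"
    show "0 \<le> step_variance k j (w j)" using k j by (intro step_variance_nonneg) auto
    have [measurable]: "walk_part k w j \<in> borel_measurable (known source_val (past j))"
      by (rule walk_part_known[OF k(1) j(1)])
    have "walk_part k w (Suc j) \<omega> = walk_part k w j \<omega> + w j * (X (Suc j) \<omega> - \<alpha> * walk X j \<omega> / real j) / sqrt (num_moves X k \<omega>)" for \<omega>
      using j by (simp add: walk_part_def increment_def add_divide_distrib)
    then have z: "z (Suc j) = expectation (\<lambda>\<omega>. iexp (walk_part k w j \<omega>) * iexp (w j * (X (Suc j) \<omega> - \<alpha> * walk X j \<omega> / real j) / sqrt (num_moves X k \<omega>)))"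
      unfolding z_def by (simp only: of_real_add distrib_left exp_add)
    show "cmod (z (Suc j) - of_real (exp (- step_variance k j (w j) / 2)) * z j) \<le> step_variance k j (w j) * char_error k K"
      unfolding z unfolding z_def
      using j k by (intro fresh_step_char[OF fresh_step_walk] w) auto
  qed
  moreover have "z k = 1" by (simp add: z_def walk_part_def prob_space)
  ultimately show ?thesis by (simp add: z_def)
qed

text \<open>
  The walk from time \<open>k\<close> to \<open>N\<close> and the row are treated in one chain of fresh steps. Here \<open>N\<close> may exceed
  \<open>m n\<close>: the entries of the row are fresh even when the later walk is known.
\<close>

lemma char_bound:
  assumes k: "1 \<le> k" "k \<le> N" "k \<le> m n" and n: "1 \<le> n"
    and w: "\<And>j. k \<le> j \<Longrightarrow> j < N \<Longrightarrow> \<bar>w j\<bar> \<le> K" and v: "\<bar>v\<bar> \<le> K"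
  defines "\<tau> \<equiv> (\<Sum>j=k..<N. step_variance k j (w j)) + real (n - m n) * step_variance k (m n) v"
  shows "cmod (expectation (\<lambda>\<omega>. iexp (walk_part k w N \<omega> + v * row_part k n n \<omega>)) - of_real (exp (- \<tau> / 2)))
     \<le> \<tau> * char_error k K"
proof -
  define A where "A = (\<Sum>j=k..<N. step_variance k j (w j))"
  define B where "B = real (n - m n) * step_variance k (m n) v"
  define y where "y l = expectation (\<lambda>\<omega>. iexp (walk_part k w N \<omega> + v * row_part k n l \<omega>))" for l
  have mn: "m n \<le> n" "1 \<le> m n" using m[OF n] by auto
  have B_sum: "(\<Sum>i=m n..<n. step_variance k (m n) v) = B" using mn by (simp add: B_def of_nat_diff)
  have B0: "0 \<le> B" using step_variance_nonneg[OF k(1) mn(2)] by (simp add: B_def)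
  have "cmod (y n - of_real (exp (- (\<Sum>i=m n..<n. step_variance k (m n) v) / 2)) * y (m n))
    \<le> (\<Sum>i=m n..<n. step_variance k (m n) v) * char_error k K"
  proof (rule char_chain[OF mn(1)])
    fix l assume l: "m n \<le> l" "l < n"
    show "0 \<le> step_variance k (m n) v" by (rule step_variance_nonneg[OF k(1) mn(2)])
    let ?N = "known source_val (row_past n (Suc l))"
    have [measurable]: "walk_part k w N \<in> borel_measurable ?N"
      by (rule measurable_known_mono[OF walk_part_known[OF k(1,2)] past_subset_row_past])
    have [measurable]: "row_part k n l \<in> borel_measurable ?N"
      using l by (intro row_part_known) auto
    have step: "fresh_step (row_past n (Suc l)) (m n) (\<lambda>\<omega>. \<eta> n (Suc l) \<omega> * X (V n (Suc l) \<omega>) \<omega>)"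
      using l by (intro fresh_step_array) auto
    have "walk_part k w N \<omega> + v * row_part k n (Suc l) \<omega> = (walk_part k w N \<omega> + v * row_part k n l \<omega>)
       + v * (\<eta> n (Suc l) \<omega> * X (V n (Suc l) \<omega>) \<omega> - \<alpha> * walk X (m n) \<omega> / real (m n)) / sqrt (num_moves X k \<omega>)" for \<omega>
      using l by (simp add: row_part_def row_noise_def add_divide_distrib distrib_left)
    then have y: "y (Suc l) = expectation (\<lambda>\<omega>. iexp (walk_part k w N \<omega> + v * row_part k n l \<omega>)
       * iexp (v * (\<eta> n (Suc l) \<omega> * X (V n (Suc l) \<omega>) \<omega> - \<alpha> * walk X (m n) \<omega> / real (m n)) / sqrt (num_moves X k \<omega>)))"
      unfolding y_def by (simp only: of_real_add[of "_ + _"] distrib_left[of \<i>] exp_add)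
    show "cmod (y (Suc l) - of_real (exp (- step_variance k (m n) v / 2)) * y l) \<le> step_variance k (m n) v * char_error k K"
      unfolding y unfolding y_def
      by (rule fresh_step_char[OF step k(1,3) _ _ v]) auto
  qed
  then have 2: "cmod (y n - of_real (exp (- B / 2)) * y (m n)) \<le> B * char_error k K"
    by (simp only: B_sum)
  have "y (m n) = expectation (\<lambda>\<omega>. iexp (walk_part k w N \<omega>))" by (simp add: y_def row_part_def)
  then have 1: "cmod (y (m n) - of_real (exp (- A / 2))) \<le> A * char_error k K"
    using walk_part_char[OF k(1,2) w] by (simp add: A_def)
  have "exp (- \<tau> / 2) = exp (- B / 2) * exp (- A / 2)"
    by (simp add: \<tau>_def A_def[symmetric] B_def[symmetric] add_divide_distrib add.commute flip: exp_add)
  then have "y n - of_real (exp (- \<tau> / 2)) = (y n - of_real (exp (- B / 2)) * y (m n))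
      + of_real (exp (- B / 2)) * (y (m n) - of_real (exp (- A / 2)))"
    by (simp add: algebra_simps)
  also have "cmod \<dots> \<le> B * char_error k K + 1 * (A * char_error k K)"
  proof (rule order_trans[OF norm_triangle_ineq add_mono[OF 2]])
    have "exp (- B / 2) \<le> 1" using B0 by simp
    then have "cmod (of_real (exp (- B / 2)) * (y (m n) - of_real (exp (- A / 2)))) \<le> 1 * cmod (y (m n) - of_real (exp (- A / 2)))"
      unfolding norm_mult by (intro mult_right_mono) auto
    then show "cmod (of_real (exp (- B / 2)) * (y (m n) - of_real (exp (- A / 2)))) \<le> 1 * (A * char_error k K)"
      using 1 by simp
  qed
  finally show ?thesis by (simp add: y_def \<tau>_def A_def B_def algebra_simps)
qed

lemma abs_drift_le_1:
  assumes "regular \<omega>" "1 \<le> j"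
  shows "\<bar>\<alpha> * walk X j \<omega> / real j\<bar> \<le> 1"
proof -
  have "\<bar>\<alpha>\<bar> * \<bar>walk X j \<omega>\<bar> \<le> 1 * real j"
    using abs_walk_le[OF assms(1), of j] num_moves_le[of j \<omega>] \<alpha>_bounds by (intro mult_mono) auto
  then show ?thesis using assms(2) by (simp add: abs_mult divide_le_eq)
qed

lemma AE_row_noise_bound:
  assumes "1 \<le> n"
  shows "AE \<omega> in P. \<forall>i. m n < i \<and> i \<le> n \<longrightarrow> \<bar>row_noise n i \<omega>\<bar> \<le> 2"
  unfolding AE_all_countable
proof
  fix i
  show "AE \<omega> in P. m n < i \<and> i \<le> n \<longrightarrow> \<bar>row_noise n i \<omega>\<bar> \<le> 2"
  proof (cases "m n < i \<and> i \<le> n")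
    case True
    then have "AE \<omega> in P. \<eta> n i \<omega> * X (V n i \<omega>) \<omega> \<in> {-1, 0, 1}"
      using fresh_step_measurable(2)[OF fresh_step_array] by auto
    then show ?thesis
      using AE_regular
    proof eventually_elim
      case (elim \<omega>)
      have "\<bar>\<alpha> * walk X (m n) \<omega> / real (m n)\<bar> \<le> 1"
        using m[OF assms] by (intro abs_drift_le_1 elim) auto
      moreover have "\<bar>\<eta> n i \<omega> * X (V n i \<omega>) \<omega>\<bar> \<le> 1" using elim(1) by auto
      ultimately show ?case unfolding row_noise_def by linarith
    qed
  qed auto
qed

text \<open>
  The centred entries of a row are orthogonal, since each has mean 0 given the earlier ones and the walk.
\<close>

lemma row_noise_second_moment:
  assumes n: "1 \<le> n" and l: "m n \<le> l" "l \<le> n"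
  shows "expectation (\<lambda>\<omega>. (\<Sum>i=m n..<l. row_noise n (Suc i) \<omega>)\<^sup>2)
    \<le> real (l - m n) * (\<beta> * growth \<beta> (m n) / (growth \<beta> 1 * real (m n)))"
  using l
proof (induction rule: dec_induct)
  case (step l)
  have mn: "m n \<le> n" "1 \<le> m n" using m[OF n] by auto
  let ?N = "known source_val (row_past n (Suc l))"
  define Q where "Q \<omega> = (\<Sum>i=m n..<l. row_noise n (Suc i) \<omega>)" for \<omega>
  have Q_known [measurable]: "Q \<in> borel_measurable ?N"
    unfolding Q_def[abs_def] using step by (intro borel_measurable_sum row_noise_known) auto
  have fresh: "fresh_step (row_past n (Suc l)) (m n) (\<lambda>\<omega>. \<eta> n (Suc l) \<omega> * X (V n (Suc l) \<omega>) \<omega>)"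
    using step by (intro fresh_step_array) auto
  have [measurable]: "random_variable borel Q"
    using measurable_of_known_sources[OF fresh_step_measurable(5)[OF fresh] Q_known] .
  have [measurable]: "walk X (m n) \<in> borel_measurable ?N"
    by (rule walk_known[OF past_subset_row_past order_refl])
  define \<delta> where "\<delta> \<omega> = \<alpha> * walk X (m n) \<omega> / real (m n)" for \<omega>
  have [measurable]: "\<delta> \<in> borel_measurable ?N" "random_variable borel \<delta>" unfolding \<delta>_def by measurable
  define a where "a \<omega> = \<beta> * num_moves X (m n) \<omega> / real (m n)" for \<omega>
  define F where "F x \<omega> = (Q \<omega> + (x - \<delta> \<omega>))\<^sup>2" for x \<omega>
  have Q_bdd: "AE \<omega> in P. \<bar>Q \<omega>\<bar> \<le> 2 * real n \<and> \<bar>\<delta> \<omega>\<bar> \<le> 1"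
    using AE_row_noise_bound[OF n] AE_regular
  proof eventually_elim
    case (elim \<omega>)
    have "\<bar>Q \<omega>\<bar> \<le> (\<Sum>i=m n..<l. \<bar>row_noise n (Suc i) \<omega>\<bar>)" unfolding Q_def by (rule sum_abs)
    also have "\<dots> \<le> (\<Sum>i=m n..<l. 2)" using elim(1) step by (intro sum_mono) auto
    also have "\<dots> \<le> 2 * real n" using step by simp
    finally have 1: "\<bar>Q \<omega>\<bar> \<le> 2 * real n" .
    have "\<bar>\<delta> \<omega>\<bar> \<le> 1" unfolding \<delta>_def by (rule abs_drift_le_1[OF elim(2) mn(2)])
    with 1 show ?case by simp
  qed
  have intQ: "integrable P (\<lambda>\<omega>. (Q \<omega>)\<^sup>2)"
  proof (rule integrable_const_bound[where B="(2 * real n)\<^sup>2"])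
    show "AE \<omega> in P. norm ((Q \<omega>)\<^sup>2) \<le> (2 * real n)\<^sup>2"
      using Q_bdd
    proof eventually_elim
      case (elim \<omega>)
      then have "\<bar>Q \<omega>\<bar>\<^sup>2 \<le> (2 * real n)\<^sup>2" by (intro power_mono) auto
      then show ?case by simp
    qed
  qed simp
  have inta: "integrable P a"
    unfolding a_def using integrable_weighted_moves[of "\<lambda>_. 1" 1 "m n"] by simp
  have "expectation (\<lambda>\<omega>. (\<Sum>i=m n..<Suc l. row_noise n (Suc i) \<omega>)\<^sup>2)
    = expectation (\<lambda>\<omega>. F (\<eta> n (Suc l) \<omega> * X (V n (Suc l) \<omega>) \<omega>) \<omega>)"
    using step by (simp add: F_def Q_def row_noise_def \<delta>_def)
  also have "\<dots> = expectation (\<lambda>\<omega>. mean_step (m n) F \<omega>)"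
  proof (rule fresh_step_expectation[OF fresh])
    show "(\<lambda>(x, \<omega>). F x \<omega>) \<in> borel_measurable (borel \<Otimes>\<^sub>M ?N)" unfolding F_def by measurable
    show "AE \<omega> in P. \<forall>x\<in>{-1, 0, 1}. norm (F x \<omega>) \<le> (2 * real n + 2)\<^sup>2"
      using Q_bdd
    proof eventually_elim
      case (elim \<omega>)
      show ?case
      proof
        fix x :: real assume "x \<in> {-1, 0, 1}"
        then have "\<bar>x\<bar> \<le> 1" by auto
        then have "\<bar>Q \<omega> + (x - \<delta> \<omega>)\<bar> \<le> 2 * real n + 2" using elim by linarith
        then have "\<bar>Q \<omega> + (x - \<delta> \<omega>)\<bar>\<^sup>2 \<le> (2 * real n + 2)\<^sup>2" by (intro power_mono) auto
        then show "norm (F x \<omega>) \<le> (2 * real n + 2)\<^sup>2" by (simp add: F_def)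
      qed
    qed
  qed
  also have "\<dots> \<le> expectation (\<lambda>\<omega>. (Q \<omega>)\<^sup>2 + a \<omega>)"
  proof (rule integral_mono_AE')
    show "integrable P (\<lambda>\<omega>. (Q \<omega>)\<^sup>2 + a \<omega>)" using intQ inta by simp
    have "F 0 \<omega> + of_real (\<delta> \<omega>) * ((F 1 \<omega> - F (-1) \<omega>) / 2) + of_real (a \<omega>) * ((F 1 \<omega> + F (-1) \<omega>) / 2 - F 0 \<omega>)
       = (Q \<omega>)\<^sup>2 - (\<delta> \<omega>)\<^sup>2 + a \<omega>" for \<omega>
      by (simp add: F_def power2_eq_square field_simps)
    then show "AE \<omega> in P. mean_step (m n) F \<omega> \<le> (Q \<omega>)\<^sup>2 + a \<omega>"
      by (simp add: mean_step_def \<delta>_def[symmetric] a_def[symmetric])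
    show "AE \<omega> in P. 0 \<le> (Q \<omega>)\<^sup>2 + a \<omega>"
      using \<beta>_bounds by (auto intro!: AE_I2 add_nonneg_nonneg simp: a_def num_moves_nonneg)
  qed
  also have "\<dots> = expectation (\<lambda>\<omega>. (Q \<omega>)\<^sup>2) + expectation a"
    using intQ inta by simp
  also have "expectation a = \<beta> * growth \<beta> (m n) / (growth \<beta> 1 * real (m n))"
    using expectation_num_moves[OF mn(2)] by (simp add: a_def[abs_def])
  also have "expectation (\<lambda>\<omega>. (Q \<omega>)\<^sup>2) \<le> real (l - m n) * (\<beta> * growth \<beta> (m n) / (growth \<beta> 1 * real (m n)))"
    unfolding Q_def using step by simp
  moreover have "real (Suc l - m n) = real (l - m n) + 1" using step.hyps by (simp add: Suc_diff_le)
  ultimately show ?case by (simp only: distrib_right mult_1)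
qed simp

lemma char_bound_scaled:
  assumes k: "1 \<le> k" "k \<le> N" "k \<le> m n" and n: "1 \<le> n"
    and w: "\<And>j. k \<le> j \<Longrightarrow> j < N \<Longrightarrow> \<bar>w j\<bar> \<le> K" and v: "\<bar>v\<bar> \<le> K"
  defines "\<tau> \<equiv> (\<Sum>j=k..<N. step_variance k j (w j)) + real (n - m n) * step_variance k (m n) v"
  shows "cmod (expectation (\<lambda>\<omega>. iexp (t * (walk_part k w N \<omega> + v * row_part k n n \<omega>))) - of_real (exp (- (t\<^sup>2 * \<tau>) / 2)))
     \<le> t\<^sup>2 * \<tau> * char_error k (\<bar>t\<bar> * K)"
proof -
  have sv: "step_variance k j (t * y) = t\<^sup>2 * step_variance k j y" for j y
    by (simp add: step_variance_def power_mult_distrib)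
  have "t * (walk_part k w N \<omega> + v * row_part k n n \<omega>) = walk_part k (\<lambda>j. t * w j) N \<omega> + (t * v) * row_part k n n \<omega>" for \<omega>
    by (simp add: walk_part_def algebra_simps sum_distrib_left)
  moreover have "(\<Sum>j=k..<N. step_variance k j (t * w j)) + real (n - m n) * step_variance k (m n) (t * v) = t\<^sup>2 * \<tau>"
    by (simp add: \<tau>_def sv distrib_left sum_distrib_left)
  moreover have "\<bar>t * w j\<bar> \<le> \<bar>t\<bar> * K" if "k \<le> j" "j < N" for j
    using w[OF that] by (simp add: abs_mult mult_left_mono)
  moreover have "\<bar>t * v\<bar> \<le> \<bar>t\<bar> * K" using v by (simp add: abs_mult mult_left_mono)
  ultimately show ?thesis
    using char_bound[OF k n, of "\<lambda>j. t * w j" "\<bar>t\<bar> * K" "t * v"] by simp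
qed

lemma char_limit:
  assumes k: "filterlim k at_top sequentially" and s: "\<tau> \<longlonglongrightarrow> v"
    and bound: "\<forall>\<^sub>F n in sequentially. cmod (expectation (\<lambda>\<omega>. iexp (t * A n \<omega>)) - of_real (exp (- (t\<^sup>2 * \<tau> n) / 2)))
     \<le> t\<^sup>2 * \<tau> n * char_error (k n) (\<bar>t\<bar> * K)"
    and v: "0 \<le> v"
  shows "(\<lambda>n. expectation (\<lambda>\<omega>. iexp (t * A n \<omega>))) \<longlonglongrightarrow> char (centered_normal v) t"
proof -
  have "(\<lambda>n. t\<^sup>2 * \<tau> n * char_error (k n) (\<bar>t\<bar> * K)) \<longlonglongrightarrow> t\<^sup>2 * v * 0"
    by (intro tendsto_mult tendsto_const s filterlim_compose[OF char_error_tendsto_0 k])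
  then have "(\<lambda>n. expectation (\<lambda>\<omega>. iexp (t * A n \<omega>)) - of_real (exp (- (t\<^sup>2 * \<tau> n) / 2))) \<longlonglongrightarrow> 0"
    by (intro Lim_null_comparison[OF bound]) simp
  moreover have "(\<lambda>n. complex_of_real (exp (- (t\<^sup>2 * \<tau> n) / 2))) \<longlonglongrightarrow> of_real (exp (- (t\<^sup>2 * v) / 2))"
    by (intro tendsto_intros s) simp
  ultimately have "(\<lambda>n. expectation (\<lambda>\<omega>. iexp (t * A n \<omega>)) - of_real (exp (- (t\<^sup>2 * \<tau> n) / 2)) + of_real (exp (- (t\<^sup>2 * \<tau> n) / 2))) \<longlonglongrightarrow> 0 + of_real (exp (- (t\<^sup>2 * v) / 2))"
    by (rule tendsto_add)
  then show ?thesis using char_centered_normal[OF v, of t] by simp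
qed

text \<open>
  The increments of the martingale \<open>W / growth \<alpha>\<close>.
\<close>

lemma walk_telescope:
  assumes "1 \<le> k" "k \<le> N"
  shows "walk X N \<omega> / growth \<alpha> N - walk X k \<omega> / growth \<alpha> k = (\<Sum>j=k..<N. increment j \<omega> / growth \<alpha> (Suc j))"
  using assms(2)
proof (induction rule: dec_induct)
  case (step n)
  have n: "1 \<le> n" using step assms by simp
  have a: "growth \<alpha> (Suc n) = growth \<alpha> n * (1 + \<alpha> / real n)" "0 < growth \<alpha> (Suc n)" "0 < growth \<alpha> n"
    using growth_Suc[of \<alpha> n] growth_pos[of \<alpha> n] growth_pos[of \<alpha> "Suc n"] n \<alpha>_bounds by auto
  have "walk X n \<omega> / growth \<alpha> n = walk X n \<omega> * (1 + \<alpha> / real n) / growth \<alpha> (Suc n)"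
  proof -
    have "1 + \<alpha> / real n \<noteq> 0" using a(1,2) by auto
    then show ?thesis unfolding a(1) by simp
  qed
  then have "walk X (Suc n) \<omega> / growth \<alpha> (Suc n) - walk X n \<omega> / growth \<alpha> n = increment n \<omega> / growth \<alpha> (Suc n)"
    by (simp add: walk_Suc increment_def algebra_simps diff_divide_distrib add_divide_distrib)
  then show ?case using step by simp
qed simp

lemma array_walk_measurable [measurable]: "random_variable borel (array_walk m X V \<eta> n)"
  unfolding array_walk_def[abs_def]
proof (rule borel_measurable_sum)
  fix k assume k: "k \<in> {1..n}"
  show "random_variable borel (array_step m X V \<eta> n k)"
  proof (cases "k \<le> m n")
    case True
    then show ?thesis using k by (simp add: array_step_def[abs_def])
  next
    case False
    then have "random_variable borel (\<lambda>\<omega>. \<eta> n k \<omega> * X (V n k \<omega>) \<omega>)"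
      using k by (intro fresh_step_measurable(1)[OF fresh_step_array]) auto
    then show ?thesis using False by (simp add: array_step_def[abs_def])
  qed
qed

text \<open>
  Each of the \<open>n - m n\<close> row entries has the conditional mean \<open>\<alpha> W / m n\<close> with \<open>W = walk X (m n)\<close>.
\<close>

lemma array_walk_decomposition:
  assumes "1 \<le> n"
  defines "\<rho> \<equiv> real (m n) / real n"
  shows "\<rho> * array_walk m X V \<eta> n \<omega> = (\<rho> + \<alpha> * (1 - \<rho>)) * walk X (m n) \<omega> + \<rho> * (\<Sum>i=m n..<n. row_noise n (Suc i) \<omega>)"
proof -
  have mn: "1 \<le> m n" "m n \<le> n" using m[OF assms(1)] by auto
  define D where "D = \<alpha> * walk X (m n) \<omega> / real (m n)"
  have "array_walk m X V \<eta> n \<omega> = (\<Sum>k=1..m n. array_step m X V \<eta> n k \<omega>) + (\<Sum>k=Suc (m n)..n. array_step m X V \<eta> n k \<omega>)"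
    unfolding array_walk_def using mn sum.ub_add_nat[of 1 "m n" "\<lambda>k. array_step m X V \<eta> n k \<omega>" "n - m n"] by simp
  also have "(\<Sum>k=1..m n. array_step m X V \<eta> n k \<omega>) = walk X (m n) \<omega>"
    by (simp add: walk_def array_step_def)
  also have "(\<Sum>k=Suc (m n)..n. array_step m X V \<eta> n k \<omega>) = (\<Sum>i=m n..<n. array_step m X V \<eta> n (Suc i) \<omega>)"
    using mn by (intro sum.reindex_bij_witness[of _ Suc "\<lambda>k. k - 1"]) auto
  also have "\<dots> = (\<Sum>i=m n..<n. row_noise n (Suc i) \<omega> + D)"
    by (intro sum.cong) (auto simp: array_step_def row_noise_def D_def)
  also have "\<dots> = (\<Sum>i=m n..<n. row_noise n (Suc i) \<omega>) + (real n - real (m n)) * D"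
    using mn by (simp add: sum.distrib of_nat_diff)
  finally have T: "array_walk m X V \<eta> n \<omega> = walk X (m n) \<omega> + ((\<Sum>i=m n..<n. row_noise n (Suc i) \<omega>) + (real n - real (m n)) * D)" .
  have "\<rho> * ((real n - real (m n)) * D) = \<alpha> * (1 - \<rho>) * walk X (m n) \<omega>"
    using mn assms(1) by (simp add: \<rho>_def D_def field_simps)
  then show ?thesis unfolding T by (simp add: algebra_simps)
qed

end

section \<open>The array with converging ratio\<close>

locale erw_stops_limit = erw_stops_array +
  fixes \<gamma> :: real
  assumes m_at_top: "filterlim m at_top sequentially"
    and ratio_tendsto: "(\<lambda>n. real (m n) / real n) \<longlonglongrightarrow> \<gamma>"
begin

definition ratio :: "nat \<Rightarrow> real" where "ratio n = real (m n) / real n"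

text \<open>
  The factor with which the walk at time \<open>m n\<close> enters \<open>\<gamma>\<^sub>n T\<^sub>n\<close>, as a function of the ratio.
\<close>

definition mix :: "real \<Rightarrow> real" where "mix g = g + \<alpha> * (1 - g)"

lemma ratio_lim: "ratio \<longlonglongrightarrow> \<gamma>"
  using ratio_tendsto by (simp add: ratio_def[abs_def])

lemma mix_lim: "(\<lambda>n. mix (ratio n)) \<longlonglongrightarrow> mix \<gamma>"
  unfolding mix_def by (intro tendsto_intros ratio_lim)

lemma ratio_bounds: "0 \<le> ratio n" "1 \<le> n \<Longrightarrow> ratio n \<le> 1" "1 \<le> n \<Longrightarrow> 0 < ratio n"
  using m[of n] by (auto simp: ratio_def)

lemma \<gamma>_bounds: "0 \<le> \<gamma>" "\<gamma> \<le> 1"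
proof -
  show "0 \<le> \<gamma>" by (rule LIMSEQ_le_const[OF ratio_lim]) (use ratio_bounds in auto)
  show "\<gamma> \<le> 1" by (rule LIMSEQ_le_const2[OF ratio_lim]) (use ratio_bounds in blast)
qed

lemma abs_mix_le_1: "0 \<le> g \<Longrightarrow> g \<le> 1 \<Longrightarrow> \<bar>mix g\<bar> \<le> 1"
proof -
  assume g: "0 \<le> g" "g \<le> 1"
  have "\<bar>\<alpha>\<bar> * (1 - g) \<le> 1 * (1 - g)" using g \<alpha>_bounds by (intro mult_right_mono) auto
  then have "\<bar>\<alpha> * (1 - g)\<bar> \<le> 1 - g" using g by (simp add: abs_mult)
  then show ?thesis using g unfolding mix_def by linarith
qed

lemma row_variance_limit:
  "(\<lambda>n. real (n - m n) * (\<beta> * (ratio n)\<^sup>2 / real (m n))) \<longlonglongrightarrow> \<beta> * \<gamma> * (1 - \<gamma>)"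
proof (rule Lim_transform_eventually)
  show "(\<lambda>n. \<beta> * ratio n * (1 - ratio n)) \<longlonglongrightarrow> \<beta> * \<gamma> * (1 - \<gamma>)"
    by (intro tendsto_intros ratio_lim)
  show "\<forall>\<^sub>F n in sequentially. \<beta> * ratio n * (1 - ratio n) = real (n - m n) * (\<beta> * (ratio n)\<^sup>2 / real (m n))"
    using eventually_ge_at_top[of 1]
  proof eventually_elim
    case (elim n)
    have "m n \<le> n" "1 \<le> m n" using m[OF elim] by auto
    then show ?case using elim by (simp add: ratio_def of_nat_diff power2_eq_square field_simps)
  qed
qed

text \<open>
  With \<open>f\<close> as in the proof, \<open>f n / sqrt \<Sigma>\<^sub>k\<close> for \<open>k = k n\<close> is the norming predicted at time \<open>k\<close>, where \<open>h\<close>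
  is a deterministic substitute for \<open>L\<close>. So normed, \<open>\<gamma>\<^sub>n T\<^sub>n\<close> is the sum of a part \<open>A\<close> to which
  \<open>char_bound\<close> applies and a multiple \<open>B\<close> of the walk at time \<open>k\<close>, which is negligible by the assumption
  on \<open>start\<close>. The factor \<open>R\<close> passes to the norming by \<open>sqrt (\<Sigma>\<^sub>m L)\<close>. Below the critical parameter this is
  used with \<open>h = L = 1\<close>, at it with \<open>L = ln \<Sigma>\<^sub>m\<close> and \<open>h = \<beta> ln m\<close>, where the row disappears because
  \<open>1 / h\<close> tends to 0.
\<close>

lemma clt_up_to_critical:
  fixes L :: "nat \<Rightarrow> 'a \<Rightarrow> real" and h :: "nat \<Rightarrow> real"
  assumes k: "filterlim k at_top sequentially" "\<forall>\<^sub>F n in sequentially. k n \<le> m n"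
    and h: "\<forall>\<^sub>F n in sequentially. 0 < h n" and L [measurable]: "\<And>n. random_variable borel (L n)"
    and L_nonneg: "\<And>n \<omega>. 0 \<le> L n \<omega>"
    and bounded: "\<forall>\<^sub>F n in sequentially. 1 \<le> K\<^sup>2 * h n \<and> (\<forall>j. k n \<le> j \<longrightarrow> j < m n \<longrightarrow> clock \<alpha> \<beta> (Suc j) \<le> K\<^sup>2 * (clock \<alpha> \<beta> (m n) * h n))"
    and K: "0 \<le> K"
    and variance: "(\<lambda>n. \<beta> * (\<Sum>j=k n..<m n. clock_tick \<alpha> \<beta> j) / (clock \<alpha> \<beta> (m n) * h n)) \<longlonglongrightarrow> \<sigma>"
    and row: "(\<lambda>n. 1 / h n) \<longlonglongrightarrow> \<iota>"
    and start: "(\<lambda>n. (real (k n))\<^sup>2 * clock \<alpha> \<beta> (k n) / (clock \<alpha> \<beta> (m n) * h n)) \<longlonglongrightarrow> 0"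
    and norming: "vanishes_in_prob (\<lambda>n \<omega>. (1 + deviation (k n) (m n) \<omega>) * (L n \<omega> / h n) - 1)"
  shows "converges_in_distribution P (\<lambda>n \<omega>. ratio n * array_walk m X V \<eta> n \<omega> / sqrt (num_moves X (m n) \<omega> * L n \<omega>))
     (centered_normal ((mix \<gamma>)\<^sup>2 * \<sigma> + \<beta> * \<gamma> * (1 - \<gamma>) * \<iota>))"
proof -
  define \<sigma>' where "\<sigma>' = (mix \<gamma>)\<^sup>2 * \<sigma> + \<beta> * \<gamma> * (1 - \<gamma>) * \<iota>"
  define f where "f n = sqrt (growth \<beta> (k n) / (growth \<beta> (m n) * h n))" for n
  define w where "w n j = mix (ratio n) * growth \<alpha> (m n) * f n / growth \<alpha> (Suc j)" for n j
  define v where "v n = ratio n * f n" for n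
  define A where "A n \<omega> = walk_part (k n) (w n) (m n) \<omega> + v n * row_part (k n) n n \<omega>" for n \<omega>
  define B where "B n \<omega> = mix (ratio n) * growth \<alpha> (m n) * f n / growth \<alpha> (k n) * walk X (k n) \<omega> / sqrt (num_moves X (k n) \<omega>)" for n \<omega>
  define R where "R n \<omega> = 1 / sqrt ((1 + deviation (k n) (m n) \<omega>) * (L n \<omega> / h n))" for n \<omega>
  define C where "C n \<omega> = ratio n * array_walk m X V \<eta> n \<omega> / sqrt (num_moves X (m n) \<omega> * L n \<omega>)" for n \<omega>
  define \<tau> where "\<tau> n = (\<Sum>j=k n..<m n. step_variance (k n) j (w n j)) + real (n - m n) * step_variance (k n) (m n) (v n)" for n
  have k1: "\<forall>\<^sub>F n in sequentially. 1 \<le> k n" using k(1) by (simp add: filterlim_at_top)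
  have good: "\<forall>\<^sub>F n in sequentially. 1 \<le> n \<and> 1 \<le> k n \<and> k n \<le> m n \<and> m n \<le> n \<and> 0 < h n"
    using eventually_ge_at_top[of 1] k1 k(2) h by eventually_elim (use m in auto)
  have f2: "(f n)\<^sup>2 = growth \<beta> (k n) / (growth \<beta> (m n) * h n)" "0 < f n"
    if "1 \<le> k n" "k n \<le> m n" "0 < h n" for n
  proof -
    have "0 < growth \<beta> (k n) / (growth \<beta> (m n) * h n)"
      using growth_pos[of \<beta> "k n"] growth_pos[of \<beta> "m n"] that \<alpha>_bounds by auto
    then show "(f n)\<^sup>2 = growth \<beta> (k n) / (growth \<beta> (m n) * h n)" "0 < f n" by (simp_all add: f_def)
  qed
  have pos: "0 < growth \<alpha> i" "0 < growth \<beta> i" if "1 \<le> i" for i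
    using growth_pos that \<alpha>_bounds by auto
  have w2: "(w n j)\<^sup>2 = (mix (ratio n))\<^sup>2 * (growth \<beta> (k n) / (clock \<alpha> \<beta> (m n) * h n * (growth \<alpha> (Suc j))\<^sup>2))"
    if "1 \<le> k n" "k n \<le> m n" "0 < h n" for n j
    using f2[OF that] pos[of "m n"] that
    by (simp add: w_def power_mult_distrib power_divide clock_def)
  have tau_eq: "\<tau> n = (mix (ratio n))\<^sup>2 * (\<beta> * (\<Sum>j=k n..<m n. clock_tick \<alpha> \<beta> j) / (clock \<alpha> \<beta> (m n) * h n))
      + real (n - m n) * (\<beta> * (ratio n)\<^sup>2 / real (m n)) * (1 / h n)"
    if n: "1 \<le> k n" "k n \<le> m n" "0 < h n" for n
  proof -
    have "step_variance (k n) j (w n j) = (mix (ratio n))\<^sup>2 * \<beta> / (clock \<alpha> \<beta> (m n) * h n) * clock_tick \<alpha> \<beta> j" for j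
      unfolding step_variance_def w2[OF n] clock_tick_def using pos[of "k n"] n by (simp add: mult_ac)
    then have "(\<Sum>j=k n..<m n. step_variance (k n) j (w n j)) = (mix (ratio n))\<^sup>2 * \<beta> / (clock \<alpha> \<beta> (m n) * h n) * (\<Sum>j=k n..<m n. clock_tick \<alpha> \<beta> j)"
      by (simp add: sum_distrib_left)
    moreover have "step_variance (k n) (m n) (v n) = \<beta> * (ratio n)\<^sup>2 / real (m n) * (1 / h n)"
      unfolding step_variance_def v_def power_mult_distrib f2(1)[OF n] using pos[of "k n"] pos[of "m n"] n by (simp add: mult_ac)
    ultimately show ?thesis unfolding \<tau>_def by (simp add: mult_ac)
  qed
  have tau_lim: "\<tau> \<longlonglongrightarrow> \<sigma>'"
  proof (rule Lim_transform_eventually)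
    show "(\<lambda>n. (mix (ratio n))\<^sup>2 * (\<beta> * (\<Sum>j=k n..<m n. clock_tick \<alpha> \<beta> j) / (clock \<alpha> \<beta> (m n) * h n))
      + real (n - m n) * (\<beta> * (ratio n)\<^sup>2 / real (m n)) * (1 / h n)) \<longlonglongrightarrow> \<sigma>'"
      unfolding \<sigma>'_def by (intro tendsto_add tendsto_mult tendsto_power mix_lim variance row row_variance_limit)
    show "\<forall>\<^sub>F n in sequentially. (mix (ratio n))\<^sup>2 * (\<beta> * (\<Sum>j=k n..<m n. clock_tick \<alpha> \<beta> j) / (clock \<alpha> \<beta> (m n) * h n))
      + real (n - m n) * (\<beta> * (ratio n)\<^sup>2 / real (m n)) * (1 / h n) = \<tau> n"
      using good by eventually_elim (simp add: tau_eq)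
  qed
  have tau_nonneg: "\<forall>\<^sub>F n in sequentially. 0 \<le> \<tau> n"
    using good unfolding \<tau>_def
    by eventually_elim (auto intro!: add_nonneg_nonneg sum_nonneg mult_nonneg_nonneg step_variance_nonneg)
  have \<sigma>'0: "0 \<le> \<sigma>'" by (rule tendsto_lowerbound[OF tau_lim tau_nonneg]) simp
  have weights: "\<forall>\<^sub>F n in sequentially. \<bar>v n\<bar> \<le> K \<and> (\<forall>j. k n \<le> j \<longrightarrow> j < m n \<longrightarrow> \<bar>w n j\<bar> \<le> K)"
    using good bounded
  proof eventually_elim
    case (elim n)
    then have n: "1 \<le> k n" "k n \<le> m n" "0 < h n" by auto
    have mix2: "(mix (ratio n))\<^sup>2 \<le> 1"
      using abs_mix_le_1[of "ratio n"] ratio_bounds[of n] elim(1) by (simp add: abs_square_le_1)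
    have c: "0 < clock \<alpha> \<beta> (m n)" using clock_pos n \<alpha>_bounds by auto
    have "(w n j)\<^sup>2 \<le> K\<^sup>2" if j: "k n \<le> j" "j < m n" for j
    proof -
      have "growth \<beta> (k n) / (clock \<alpha> \<beta> (m n) * h n * (growth \<alpha> (Suc j))\<^sup>2)
          \<le> growth \<beta> (Suc j) / (clock \<alpha> \<beta> (m n) * h n * (growth \<alpha> (Suc j))\<^sup>2)"
        using n j c \<beta>_bounds by (intro divide_right_mono growth_mono) auto
      also have "\<dots> = clock \<alpha> \<beta> (Suc j) / (clock \<alpha> \<beta> (m n) * h n)" by (simp add: clock_def)
      also have "\<dots> \<le> K\<^sup>2" using elim(2) j c n by (simp add: divide_le_eq)
      finally have "growth \<beta> (k n) / (clock \<alpha> \<beta> (m n) * h n * (growth \<alpha> (Suc j))\<^sup>2) \<le> K\<^sup>2" .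
      moreover have "0 \<le> growth \<beta> (k n) / (clock \<alpha> \<beta> (m n) * h n * (growth \<alpha> (Suc j))\<^sup>2)"
        using pos(2)[of "k n"] n c by auto
      ultimately have "(mix (ratio n))\<^sup>2 * (growth \<beta> (k n) / (clock \<alpha> \<beta> (m n) * h n * (growth \<alpha> (Suc j))\<^sup>2)) \<le> 1 * K\<^sup>2"
        using mix2 by (intro mult_mono) auto
      then show ?thesis unfolding w2[OF n] by simp
    qed
    moreover have "(v n)\<^sup>2 \<le> K\<^sup>2"
    proof -
      have "(ratio n)\<^sup>2 \<le> 1\<^sup>2" using ratio_bounds[of n] elim(1) by (intro power_mono) auto
      then have "(v n)\<^sup>2 \<le> 1 * (growth \<beta> (k n) / (growth \<beta> (m n) * h n))"
        unfolding v_def power_mult_distrib f2(1)[OF n] using pos[of "k n"] pos[of "m n"] n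
        by (intro mult_right_mono) auto
      also have "\<dots> \<le> 1 * (growth \<beta> (m n) / (growth \<beta> (m n) * h n))"
        using pos(2)[of "m n"] n \<beta>_bounds by (intro mult_left_mono divide_right_mono growth_mono) auto
      also have "\<dots> = 1 / h n" using pos(2)[of "m n"] n by simp
      also have "\<dots> \<le> K\<^sup>2" using elim(2) n by (simp add: divide_le_eq)
      finally show ?thesis .
    qed
    moreover have "\<bar>x\<bar> \<le> K" if "x\<^sup>2 \<le> K\<^sup>2" for x
      using that K by (metis abs_le_square_iff abs_of_nonneg)
    ultimately show ?case by blast
  qed
  have charA: "(\<lambda>n. expectation (\<lambda>\<omega>. iexp (t * A n \<omega>))) \<longlonglongrightarrow> char (centered_normal \<sigma>') t" for t
  proof (rule char_limit[OF k(1) tau_lim _ \<sigma>'0])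
    show "\<forall>\<^sub>F n in sequentially. cmod (expectation (\<lambda>\<omega>. iexp (t * A n \<omega>)) - of_real (exp (- (t\<^sup>2 * \<tau> n) / 2)))
     \<le> t\<^sup>2 * \<tau> n * char_error (k n) (\<bar>t\<bar> * K)"
      using good weights unfolding A_def \<tau>_def by eventually_elim (rule char_bound_scaled, auto)
  qed
  have Bbound: "\<forall>\<^sub>F n in sequentially. AE \<omega> in P. min 1 \<bar>B n \<omega>\<bar> \<le> sqrt ((real (k n))\<^sup>2 * clock \<alpha> \<beta> (k n) / (clock \<alpha> \<beta> (m n) * h n))"
    using good
  proof eventually_elim
    case (elim n)
    then have n: "1 \<le> k n" "k n \<le> m n" "0 < h n" by auto
    have mix1: "\<bar>mix (ratio n)\<bar> \<le> 1"
      using elim ratio_bounds[of n] by (intro abs_mix_le_1) auto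
    show ?case using AE_regular
    proof eventually_elim
      case (elim \<omega>)
      define t where "t = num_moves X (k n) \<omega>"
      have t: "1 \<le> t" "t \<le> real (k n)" using num_moves_ge_1[OF elim n(1)] num_moves_le by (auto simp: t_def)
      have "\<bar>walk X (k n) \<omega>\<bar> / sqrt t \<le> real (k n) / 1"
        using abs_walk_le[OF elim, of "k n"] t by (intro frac_le) (auto simp: t_def)
      moreover have "\<bar>mix (ratio n)\<bar> * (growth \<alpha> (m n) * f n / growth \<alpha> (k n)) \<le> 1 * (growth \<alpha> (m n) * f n / growth \<alpha> (k n))"
        using mix1 pos(1)[of "m n"] pos(1)[of "k n"] n f2(2)[OF n]
        by (intro mult_right_mono) auto
      ultimately have "(\<bar>mix (ratio n)\<bar> * (growth \<alpha> (m n) * f n / growth \<alpha> (k n))) * (\<bar>walk X (k n) \<omega>\<bar> / sqrt t)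
        \<le> (1 * (growth \<alpha> (m n) * f n / growth \<alpha> (k n))) * (real (k n) / 1)"
        using mix1 pos(1)[of "m n"] pos(1)[of "k n"] n f2(2)[OF n] t by (intro mult_mono) auto
      moreover have "\<bar>B n \<omega>\<bar> = (\<bar>mix (ratio n)\<bar> * (growth \<alpha> (m n) * f n / growth \<alpha> (k n))) * (\<bar>walk X (k n) \<omega>\<bar> / sqrt t)"
        using pos(1)[of "m n"] pos(1)[of "k n"] n f2(2)[OF n] t
        by (simp add: B_def abs_mult abs_divide t_def)
      moreover have "(growth \<alpha> (m n) * f n / growth \<alpha> (k n)) * real (k n) = sqrt ((real (k n))\<^sup>2 * clock \<alpha> \<beta> (k n) / (clock \<alpha> \<beta> (m n) * h n))"
      proof (rule real_sqrt_unique[symmetric])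
        show "(growth \<alpha> (m n) * f n / growth \<alpha> (k n) * real (k n))\<^sup>2 = (real (k n))\<^sup>2 * clock \<alpha> \<beta> (k n) / (clock \<alpha> \<beta> (m n) * h n)"
          unfolding power_mult_distrib power_divide f2(1)[OF n] clock_def by (simp add: mult_ac)
        show "0 \<le> growth \<alpha> (m n) * f n / growth \<alpha> (k n) * real (k n)"
          using pos(1)[of "m n"] pos(1)[of "k n"] n f2(2)[OF n] by auto
      qed
      ultimately show ?case by simp
    qed
  qed
  have meas: "random_variable borel (walk_part (k n) (w n) (m n))" for n
  proof (cases "1 \<le> k n")
    case False
    then have "k n = 0" by simp
    then show ?thesis by (simp add: walk_part_def[abs_def] num_moves_def)
  qed (rule walk_part_measurable)
  have [measurable]: "random_variable borel (A n)" for n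
    unfolding A_def[abs_def] using meas by measurable
  have [measurable]: "random_variable borel (B n)" "random_variable borel (R n)" "random_variable borel (C n)" for n
    unfolding B_def[abs_def] R_def[abs_def] C_def[abs_def] by measurable
  have "converges_in_distribution P C (centered_normal \<sigma>')"
  proof (rule slutsky[where A=A and B=B and R=R])
    show "real_distribution (centered_normal \<sigma>')" by (rule real_distribution_centered_normal[OF \<sigma>'0])
    show "(\<lambda>n. expectation (\<lambda>\<omega>. iexp (t * A n \<omega>))) \<longlonglongrightarrow> char (centered_normal \<sigma>') t" for t by (rule charA)
    show "vanishes_in_prob B"
    proof (rule vanishes_in_probI[OF _ _ Bbound])
      from tendsto_real_sqrt[OF start]
      show "(\<lambda>n. expectation (\<lambda>\<omega>. sqrt ((real (k n))\<^sup>2 * clock \<alpha> \<beta> (k n) / (clock \<alpha> \<beta> (m n) * h n)))) \<longlonglongrightarrow> 0"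
        by (simp add: prob_space)
    qed auto
    show "vanishes_in_prob (\<lambda>n \<omega>. R n \<omega> - 1)"
    proof (rule vanishes_in_probI)
      let ?z = "\<lambda>n \<omega>. (1 + deviation (k n) (m n) \<omega>) * (L n \<omega> / h n) - 1"
      show "\<forall>\<^sub>F n in sequentially. integrable P (\<lambda>\<omega>. 2 * min 1 \<bar>?z n \<omega>\<bar>)"
        by (intro always_eventually allI integrable_mult_right integrable_min_1_abs) measurable
      show "\<forall>\<^sub>F n in sequentially. AE \<omega> in P. min 1 \<bar>R n \<omega> - 1\<bar> \<le> 2 * min 1 \<bar>?z n \<omega>\<bar>"
        using good
      proof eventually_elim
        case (elim n)
        then have n: "1 \<le> k n" "k n \<le> m n" "0 < h n" by auto
        have "0 \<le> 1 + ?z n \<omega>" for \<omega>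
          using n pos(2)[of "k n"] pos(2)[of "m n"] L_nonneg[of n \<omega>] by (simp add: deviation_def num_moves_nonneg)
        from min_1_inverse_sqrt_le[OF this] show ?case by (simp add: R_def)
      qed
      show "(\<lambda>n. expectation (\<lambda>\<omega>. 2 * min 1 \<bar>?z n \<omega>\<bar>)) \<longlonglongrightarrow> 0"
        using tendsto_mult_right_zero[OF norming[unfolded vanishes_in_prob_def], of 2] by simp
    qed measurable
    show "\<forall>\<^sub>F n in sequentially. AE \<omega> in P. C n \<omega> = (A n \<omega> + B n \<omega>) * R n \<omega>"
      using good
    proof eventually_elim
      case (elim n)
      then have n: "1 \<le> k n" "k n \<le> m n" "0 < h n" "1 \<le> n" "1 \<le> m n" by auto
      show ?case using AE_regular
      proof eventually_elim
        case (elim \<omega>)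
        define t where "t = num_moves X (k n) \<omega>"
        have t: "1 \<le> t" using num_moves_ge_1[OF elim n(1)] by (simp add: t_def)
        have S: "1 \<le> num_moves X (m n) \<omega>" using num_moves_ge_1[OF elim n(5)] .
        let ?a = "growth \<alpha> (m n)"
        have "(\<Sum>j=k n..<m n. w n j * increment j \<omega>) = mix (ratio n) * ?a * f n * (\<Sum>j=k n..<m n. increment j \<omega> / growth \<alpha> (Suc j))"
          by (simp add: w_def sum_distrib_left mult_ac)
        also have "\<dots> = mix (ratio n) * ?a * f n * (walk X (m n) \<omega> / ?a - walk X (k n) \<omega> / growth \<alpha> (k n))"
          by (simp only: walk_telescope[OF n(1,2)])
        finally have "walk_part (k n) (w n) (m n) \<omega> = f n * (mix (ratio n) * walk X (m n) \<omega>) / sqrt t - B n \<omega>"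
          using pos(1)[OF n(5)] by (simp add: walk_part_def B_def t_def right_diff_distrib diff_divide_distrib mult_ac)
        then have "A n \<omega> + B n \<omega> = f n * (mix (ratio n) * walk X (m n) \<omega> + ratio n * (\<Sum>i=m n..<n. row_noise n (Suc i) \<omega>)) / sqrt t"
          by (simp add: A_def row_part_def v_def t_def add_divide_distrib distrib_left mult_ac)
        also have "\<dots> = f n / sqrt t * (ratio n * array_walk m X V \<eta> n \<omega>)"
          using array_walk_decomposition[OF n(4), of \<omega>] by (simp add: ratio_def mix_def)
        finally have AB: "A n \<omega> + B n \<omega> = f n / sqrt t * (ratio n * array_walk m X V \<eta> n \<omega>)" .
        have FR: "f n / sqrt t * R n \<omega> = 1 / sqrt (num_moves X (m n) \<omega> * L n \<omega>)"
        proof -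
          have "f n / sqrt t * R n \<omega>
             = sqrt ((growth \<beta> (k n) / (growth \<beta> (m n) * h n)) / t / ((1 + deviation (k n) (m n) \<omega>) * (L n \<omega> / h n)))"
            unfolding f_def R_def by (simp only: real_sqrt_divide times_divide_eq_right mult_1_right)
          also have "(growth \<beta> (k n) / (growth \<beta> (m n) * h n)) / t / ((1 + deviation (k n) (m n) \<omega>) * (L n \<omega> / h n))
             = 1 / (num_moves X (m n) \<omega> * L n \<omega>)"
            using pos(2)[OF n(1)] pos(2)[OF n(5)] n(3) t S
            by (simp add: deviation_def t_def[symmetric])
          also have "sqrt \<dots> = 1 / sqrt (num_moves X (m n) \<omega> * L n \<omega>)" by (simp only: real_sqrt_divide real_sqrt_one)
          finally show ?thesis .
        qed
        have "C n \<omega> = (ratio n * array_walk m X V \<eta> n \<omega>) * (f n / sqrt t * R n \<omega>)"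
          unfolding FR C_def by simp
        then show ?case unfolding AB by (simp only: mult_ac)
      qed
    qed
  qed measurable
  then show ?thesis unfolding C_def[abs_def] \<sigma>'_def .
qed

section \<open>Below and at the critical parameter\<close>

lemma vanishes_deviation:
  assumes k: "filterlim k at_top sequentially" "\<forall>\<^sub>F n in sequentially. k n \<le> m n"
  shows "vanishes_in_prob (\<lambda>n \<omega>. deviation (k n) (m n) \<omega>)"
proof (rule vanishes_in_probI)
  have k1: "\<forall>\<^sub>F n in sequentially. 1 \<le> k n" using k(1) by (simp add: filterlim_at_top)
  show "\<forall>\<^sub>F n in sequentially. integrable P (\<lambda>\<omega>. \<bar>deviation (k n) (m n) \<omega>\<bar>)"
    using k1 k(2) by eventually_elim (rule deviation_integrable)
  show "\<forall>\<^sub>F n in sequentially. AE \<omega> in P. min 1 \<bar>deviation (k n) (m n) \<omega>\<bar> \<le> \<bar>deviation (k n) (m n) \<omega>\<bar>"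
    by auto
  show "(\<lambda>n. expectation (\<lambda>\<omega>. \<bar>deviation (k n) (m n) \<omega>\<bar>)) \<longlonglongrightarrow> 0"
  proof (rule tendsto_sandwich[OF _ _ tendsto_const])
    show "\<forall>\<^sub>F n in sequentially. expectation (\<lambda>\<omega>. \<bar>deviation (k n) (m n) \<omega>\<bar>) \<le> scarcity (k n)"
      using k1 k(2) by eventually_elim (rule expectation_abs_deviation_le)
    show "(\<lambda>n. scarcity (k n)) \<longlonglongrightarrow> 0"
      by (rule filterlim_compose[OF scarcity_tendsto_0 k(1)])
  qed (simp add: integral_nonneg)
qed simp

text \<open>
  By \<open>clock_telescope\<close> the sum of ticks is the increase of the clock divided by a number between
  \<open>\<beta> - 2 * \<alpha> - \<alpha>\<^sup>2 / k\<close> and \<open>\<beta> - 2 * \<alpha>\<close>.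
\<close>

lemma subcritical_variance:
  assumes sub: "\<alpha> < \<beta> / 2" and k: "filterlim k at_top sequentially" "\<forall>\<^sub>F n in sequentially. k n \<le> m n"
    and start: "(\<lambda>n. clock \<alpha> \<beta> (k n) / clock \<alpha> \<beta> (m n)) \<longlonglongrightarrow> 0"
  shows "(\<lambda>n. \<beta> * (\<Sum>j=k n..<m n. clock_tick \<alpha> \<beta> j) / clock \<alpha> \<beta> (m n)) \<longlonglongrightarrow> \<beta> / (\<beta> - 2 * \<alpha>)"
proof -
  define d where "d = \<beta> - 2 * \<alpha>"
  have d: "0 < d" using sub by (simp add: d_def)
  let ?s = "\<lambda>n. (\<Sum>j=k n..<m n. clock_tick \<alpha> \<beta> j)" and ?c = "clock \<alpha> \<beta>"
  have kreal: "filterlim (\<lambda>n. real (k n)) at_top sequentially"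
    using filterlim_compose[OF filterlim_real_sequentially k(1)] .
  have small: "(\<lambda>n. d - \<alpha>\<^sup>2 / real (k n)) \<longlonglongrightarrow> d - 0"
    by (intro tendsto_intros real_tendsto_divide_at_top[OF tendsto_const kreal])
  have "\<forall>\<^sub>F n in sequentially. 0 < d - \<alpha>\<^sup>2 / real (k n)"
    using order_tendstoD(1)[OF small, of 0] d by simp
  moreover have "\<forall>\<^sub>F n in sequentially. 1 \<le> k n" using k(1) by (simp add: filterlim_at_top)
  ultimately have ev: "\<forall>\<^sub>F n in sequentially. (1 - ?c (k n) / ?c (m n)) / d \<le> ?s n / ?c (m n)
      \<and> ?s n / ?c (m n) \<le> (1 - ?c (k n) / ?c (m n)) / (d - \<alpha>\<^sup>2 / real (k n))"
    using k(2)
  proof eventually_elim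
    case (elim n)
    have c: "0 < ?c (m n)" "0 < ?c (k n)" using clock_pos \<alpha>_bounds elim by auto
    have tele: "(\<Sum>j=k n..<m n. clock_tick \<alpha> \<beta> j * (d - \<alpha>\<^sup>2 / real j)) = ?c (m n) - ?c (k n)"
    proof -
      have "(\<Sum>j=k n..<m n. clock_tick \<alpha> \<beta> j * (d - \<alpha>\<^sup>2 / real j)) = - (\<Sum>j=k n..<m n. clock_tick \<alpha> \<beta> j * (2 * \<alpha> - \<beta> + \<alpha>\<^sup>2 / real j))"
        unfolding sum_negf[symmetric] by (intro sum.cong) (auto simp: d_def algebra_simps)
      then show ?thesis using clock_telescope[OF \<alpha>_bounds(2,4) elim(2,3)] by simp
    qed
    have tick: "0 \<le> clock_tick \<alpha> \<beta> j" if "k n \<le> j" for j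
      using clock_tick_pos[of \<alpha> \<beta> j] that elim \<alpha>_bounds by (intro less_imp_le) auto
    have "?c (m n) - ?c (k n) \<le> (\<Sum>j=k n..<m n. clock_tick \<alpha> \<beta> j * d)"
      unfolding tele[symmetric] using tick by (intro sum_mono mult_left_mono) auto
    then have up: "?c (m n) - ?c (k n) \<le> ?s n * d" by (simp add: sum_distrib_right)
    have "(\<Sum>j=k n..<m n. clock_tick \<alpha> \<beta> j * (d - \<alpha>\<^sup>2 / real (k n))) \<le> ?c (m n) - ?c (k n)"
      unfolding tele[symmetric] using tick elim
      by (intro sum_mono mult_left_mono diff_left_mono divide_left_mono) auto
    then have lo: "?s n * (d - \<alpha>\<^sup>2 / real (k n)) \<le> ?c (m n) - ?c (k n)" by (simp add: sum_distrib_right)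
    have e: "1 - ?c (k n) / ?c (m n) = (?c (m n) - ?c (k n)) / ?c (m n)" using c by (simp add: diff_divide_distrib)
    have "(?c (m n) - ?c (k n)) / d \<le> ?s n" using up d by (simp add: divide_le_eq)
    moreover have "?s n \<le> (?c (m n) - ?c (k n)) / (d - \<alpha>\<^sup>2 / real (k n))" using lo elim(1) by (simp add: le_divide_eq)
    ultimately have "(?c (m n) - ?c (k n)) / d / ?c (m n) \<le> ?s n / ?c (m n)"
      "?s n / ?c (m n) \<le> (?c (m n) - ?c (k n)) / (d - \<alpha>\<^sup>2 / real (k n)) / ?c (m n)"
      using less_imp_le[OF c(1)] by (blast intro: divide_right_mono)+
    then show ?case unfolding e divide_divide_eq_left by (simp only: mult.commute)
  qed
  have "(\<lambda>n. ?s n / ?c (m n)) \<longlonglongrightarrow> 1 / d"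
  proof (rule tendsto_sandwich)
    show "\<forall>\<^sub>F n in sequentially. (1 - ?c (k n) / ?c (m n)) / d \<le> ?s n / ?c (m n)"
      using ev by eventually_elim simp
    show "\<forall>\<^sub>F n in sequentially. ?s n / ?c (m n) \<le> (1 - ?c (k n) / ?c (m n)) / (d - \<alpha>\<^sup>2 / real (k n))"
      using ev by eventually_elim simp
    have "(\<lambda>n. (1 - ?c (k n) / ?c (m n)) / d) \<longlonglongrightarrow> (1 - 0) / d"
      using d by (intro tendsto_intros start) auto
    then show "(\<lambda>n. (1 - ?c (k n) / ?c (m n)) / d) \<longlonglongrightarrow> 1 / d" by simp
    have "(\<lambda>n. (1 - ?c (k n) / ?c (m n)) / (d - \<alpha>\<^sup>2 / real (k n))) \<longlonglongrightarrow> (1 - 0) / (d - 0)"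
      using d by (intro tendsto_divide tendsto_diff tendsto_const start small[unfolded diff_0_right] small) auto
    then show "(\<lambda>n. (1 - ?c (k n) / ?c (m n)) / (d - \<alpha>\<^sup>2 / real (k n))) \<longlonglongrightarrow> 1 / d" by simp
  qed
  from tendsto_mult[OF tendsto_const[of \<beta>] this] show ?thesis by (simp add: d_def)
qed

text \<open>
  The clock diverges, so that a start that tends to infinity slowly enough is negligible.
\<close>

theorem subcritical_clt:
  assumes sub: "\<alpha> < \<beta> / 2"
  shows "converges_in_distribution P (\<lambda>n \<omega>. ratio n * array_walk m X V \<eta> n \<omega> / sqrt (num_moves X (m n) \<omega>))
     (centered_normal (\<beta> * (mix \<gamma>)\<^sup>2 / (\<beta> - 2 * \<alpha>) + \<beta> * \<gamma> * (1 - \<gamma>)))"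
proof -
  let ?c = "clock \<alpha> \<beta>"
  have c_top: "filterlim ?c at_top sequentially" using clock_at_top[OF \<alpha>_bounds(2,4) sub] .
  have "(\<lambda>i. (real k)\<^sup>2 * ?c k / ?c i) \<longlonglongrightarrow> 0" for k
    by (rule real_tendsto_divide_at_top[OF tendsto_const c_top])
  then obtain g where g: "filterlim g at_top sequentially" "\<And>i. g i \<le> i"
    "(\<lambda>i. (real (g i))\<^sup>2 * ?c (g i) / ?c i) \<longlonglongrightarrow> 0"
    using diagonal_sequence[of "\<lambda>k i. (real k)\<^sup>2 * ?c k / ?c i"] by blast
  define k where "k n = g (m n)" for n
  have k: "filterlim k at_top sequentially" "\<And>n. k n \<le> m n"
    using filterlim_compose[OF g(1) m_at_top] g(2) by (auto simp: k_def[abs_def])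
  have k1: "\<forall>\<^sub>F n in sequentially. 1 \<le> k n" using k(1) by (simp add: filterlim_at_top)
  have start: "(\<lambda>n. (real (k n))\<^sup>2 * ?c (k n) / ?c (m n)) \<longlonglongrightarrow> 0"
    using filterlim_compose[OF g(3) m_at_top] by (simp add: k_def)
  have start': "(\<lambda>n. ?c (k n) / ?c (m n)) \<longlonglongrightarrow> 0"
  proof (rule Lim_null_comparison[OF _ start])
    show "\<forall>\<^sub>F n in sequentially. norm (?c (k n) / ?c (m n)) \<le> (real (k n))\<^sup>2 * ?c (k n) / ?c (m n)"
      using k1
    proof eventually_elim
      case (elim n)
      have p: "0 < ?c (k n) / ?c (m n)"
        using clock_pos[of \<alpha> \<beta> "k n"] clock_pos[of \<alpha> \<beta> "m n"] k(2)[of n] elim \<alpha>_bounds by auto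
      have "1 * (?c (k n) / ?c (m n)) \<le> (real (k n))\<^sup>2 * (?c (k n) / ?c (m n))"
        using elim p by (intro mult_right_mono) auto
      then show ?case using p by simp
    qed
  qed
  \<comment> \<open>from \<open>k0\<close> on the clock increases\<close>
  obtain k0 :: nat where k0: "real k0 > \<alpha>\<^sup>2 / (\<beta> - 2 * \<alpha>)" using reals_Archimedean2 by blast
  have mono: "?c i \<le> ?c j" if "1 \<le> i" "k0 \<le> i" "i \<le> j" for i j
    using that(3)
  proof (induction rule: dec_induct)
    case (step j)
    have j: "1 \<le> j" "k0 \<le> j" using step that by auto
    have "\<alpha>\<^sup>2 / (\<beta> - 2 * \<alpha>) \<le> real j" using k0 j by simp
    then have "2 * \<alpha> - \<beta> + \<alpha>\<^sup>2 / real j \<le> 0" using sub j by (simp add: field_simps)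
    then have "?c j - ?c (Suc j) \<le> 0"
      unfolding clock_diff[OF \<alpha>_bounds(2,4) j(1)] using clock_tick_pos[OF \<alpha>_bounds(2,4) j(1)]
      by (intro mult_nonneg_nonpos) auto
    then show ?case using step by simp
  qed simp
  have "converges_in_distribution P (\<lambda>n \<omega>. ratio n * array_walk m X V \<eta> n \<omega> / sqrt (num_moves X (m n) \<omega> * 1))
     (centered_normal ((mix \<gamma>)\<^sup>2 * (\<beta> / (\<beta> - 2 * \<alpha>)) + \<beta> * \<gamma> * (1 - \<gamma>) * 1))"
  proof (rule clt_up_to_critical[where K=1 and h="\<lambda>_. 1" and k=k])
    show "\<forall>\<^sub>F n in sequentially. k n \<le> m n" using k(2) by simp
    have "\<forall>\<^sub>F n in sequentially. k0 \<le> k n" using k(1) by (simp add: filterlim_at_top)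
    then show "\<forall>\<^sub>F n in sequentially. 1 \<le> 1\<^sup>2 * (1::real) \<and> (\<forall>j. k n \<le> j \<longrightarrow> j < m n \<longrightarrow> ?c (Suc j) \<le> 1\<^sup>2 * (?c (m n) * 1))"
      by eventually_elim (auto intro!: mono)
    show "(\<lambda>n. \<beta> * (\<Sum>j=k n..<m n. clock_tick \<alpha> \<beta> j) / (?c (m n) * 1)) \<longlonglongrightarrow> \<beta> / (\<beta> - 2 * \<alpha>)"
      using subcritical_variance[OF sub k(1) _ start'] k(2) by simp
    show "(\<lambda>n. (real (k n))\<^sup>2 * ?c (k n) / (?c (m n) * 1)) \<longlonglongrightarrow> 0" using start by simp
    show "vanishes_in_prob (\<lambda>n \<omega>. (1 + deviation (k n) (m n) \<omega>) * (1 / 1) - 1)"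
      using vanishes_deviation[OF k(1)] k(2) by simp
  qed (use k(1) in auto)
  then show ?thesis by (simp add: mult.commute)
qed

text \<open>
  At the critical parameter the clock decreases to 1, which makes \<open>clock_tick \<alpha> \<beta> j\<close> asymptotic to
  \<open>1 / j\<close>.
\<close>

lemma critical_variance:
  assumes crit: "\<alpha> = \<beta> / 2" and k: "filterlim k at_top sequentially" "\<forall>\<^sub>F n in sequentially. k n \<le> m n"
    and start: "(\<lambda>n. ln (real (k n)) / ln (real (m n))) \<longlonglongrightarrow> 0"
  shows "(\<lambda>n. (\<Sum>j=k n..<m n. clock_tick \<alpha> \<beta> j) / (clock \<alpha> \<beta> (m n) * ln (real (m n)))) \<longlonglongrightarrow> 1"
proof -
  let ?s = "\<lambda>n. (\<Sum>j=k n..<m n. clock_tick \<alpha> \<beta> j)" and ?c = "clock \<alpha> \<beta>" and ?l = "\<lambda>n. ln (real (m n))"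
  have c1: "?c \<longlonglongrightarrow> 1" by (rule clock_tendsto_1[OF \<alpha>_bounds(2,4) crit])
  have ck: "(\<lambda>n. ?c (k n)) \<longlonglongrightarrow> 1" "(\<lambda>n. ?c (m n)) \<longlonglongrightarrow> 1"
    using filterlim_compose[OF c1 k(1)] filterlim_compose[OF c1 m_at_top] .
  have mono: "?c j \<le> ?c i" if "1 \<le> i" "i \<le> j" for i j
    using that(2)
  proof (induction rule: dec_induct)
    case (step j)
    have "0 \<le> ?c j - ?c (Suc j)"
    proof -
      have j: "1 \<le> j" using step that by simp
      have "0 \<le> 2 * \<alpha> - \<beta> + \<alpha>\<^sup>2 / real j" using crit by simp
      then show ?thesis
        unfolding clock_diff[OF \<alpha>_bounds(2,4) j]
        using clock_tick_pos[OF \<alpha>_bounds(2,4) j] by (intro mult_nonneg_nonneg) auto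
    qed
    then show ?case using step by simp
  qed simp
  have a0: "0 \<le> \<alpha>" using crit \<beta>_bounds by simp
  have tick: "clock_tick \<alpha> \<beta> j = ?c j / (1 + \<alpha> / real j)\<^sup>2 * (1 / real j)" if "1 \<le> j" for j
    using growth_Suc[of \<alpha> j] that \<alpha>_bounds by (simp add: clock_tick_def clock_def power_mult_distrib)
  have kreal: "filterlim (\<lambda>n. real (k n)) at_top sequentially"
    using filterlim_compose[OF filterlim_real_sequentially k(1)] .
  have l_top: "filterlim ?l at_top sequentially"
    using filterlim_compose[OF ln_at_top filterlim_compose[OF filterlim_real_sequentially m_at_top]] .
  have l0: "\<forall>\<^sub>F n in sequentially. 0 < ?l n" using l_top by (simp add: filterlim_at_top_dense)
  have k1: "\<forall>\<^sub>F n in sequentially. 1 \<le> k n" using k(1) by (simp add: filterlim_at_top)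
  have ev: "\<forall>\<^sub>F n in sequentially.
      1 / (1 + \<alpha> / real (k n))\<^sup>2 * (1 - ln (real (k n)) / ?l n) \<le> ?s n / (?c (m n) * ?l n)
    \<and> ?s n / (?c (m n) * ?l n) \<le> ?c (k n) / ?c (m n) * (1 / ?l n + 1)"
    using k1 k(2) l0
  proof eventually_elim
    case (elim n)
    have c: "0 < ?c i" if "1 \<le> i" for i using clock_pos[OF \<alpha>_bounds(2,4) that] .
    have lk: "0 \<le> ln (real (k n))" using elim by simp
    have one: "1 \<le> (1 + \<alpha> / real j)\<^sup>2" for j using a0 by (intro one_le_power) auto
    have "?s n \<le> (\<Sum>j=k n..<m n. ?c (k n) * (1 / real j))"
    proof (rule sum_mono)
      fix j assume j: "j \<in> {k n..<m n}"
      have j1: "1 \<le> j" using j elim by simp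
      have *: "?c j / (1 + \<alpha> / real j)\<^sup>2 \<le> ?c (k n) / 1"
        using mono[of "k n" j] j elim one c[of j] by (intro frac_le) auto
      show "clock_tick \<alpha> \<beta> j \<le> ?c (k n) * (1 / real j)"
        unfolding tick[OF j1] using * by (intro mult_right_mono) auto
    qed
    also have "\<dots> = ?c (k n) * (\<Sum>j=k n..<m n. 1 / real j)" by (simp add: sum_distrib_left)
    also have "\<dots> \<le> ?c (k n) * (1 + ?l n)"
    proof (rule mult_left_mono)
      show "(\<Sum>j=k n..<m n. 1 / real j) \<le> 1 + ?l n" using sum_inverse_bounds(2)[OF elim(1,2)] lk by linarith
    qed (use c[of "k n"] elim in simp)
    finally have up: "?s n \<le> ?c (k n) * (1 + ?l n)" .
    have "?c (m n) / (1 + \<alpha> / real (k n))\<^sup>2 * (?l n - ln (real (k n)))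
       \<le> ?c (m n) / (1 + \<alpha> / real (k n))\<^sup>2 * (\<Sum>j=k n..<m n. 1 / real j)"
      using sum_inverse_bounds(1)[OF elim(1,2)] c[of "m n"] elim by (intro mult_left_mono) auto
    also have "\<dots> = (\<Sum>j=k n..<m n. ?c (m n) / (1 + \<alpha> / real (k n))\<^sup>2 * (1 / real j))"
      by (rule sum_distrib_left)
    also have "\<dots> \<le> ?s n"
    proof (rule sum_mono)
      fix j assume j: "j \<in> {k n..<m n}"
      have j1: "1 \<le> j" using j elim by simp
      have "(1 + \<alpha> / real j)\<^sup>2 \<le> (1 + \<alpha> / real (k n))\<^sup>2"
        using j elim a0 by (intro power_mono add_left_mono divide_left_mono) auto
      then have *: "?c (m n) / (1 + \<alpha> / real (k n))\<^sup>2 \<le> ?c j / (1 + \<alpha> / real j)\<^sup>2"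
        using mono[of j "m n"] j elim c[of j] one[of j] by (intro frac_le) (auto intro: less_le_trans[OF zero_less_one])
      show "?c (m n) / (1 + \<alpha> / real (k n))\<^sup>2 * (1 / real j) \<le> clock_tick \<alpha> \<beta> j"
        unfolding tick[OF j1] by (rule mult_right_mono[OF *]) simp
    qed
    finally have lo: "?c (m n) / (1 + \<alpha> / real (k n))\<^sup>2 * (?l n - ln (real (k n))) \<le> ?s n" .
    have cm: "0 < ?c (m n)" using c elim by simp
    then have cl: "0 \<le> ?c (m n) * ?l n" using elim(3) by simp
    have "?c (m n) / (1 + \<alpha> / real (k n))\<^sup>2 * (?l n - ln (real (k n))) / (?c (m n) * ?l n)
       = 1 / (1 + \<alpha> / real (k n))\<^sup>2 * (1 - ln (real (k n)) / ?l n)"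
    proof -
      have "C / A * (l - x) / (C * l) = 1 / A * (1 - x / l)" if "0 < C" "0 < l" for A C l x :: real
        using that by (simp add: diff_divide_distrib right_diff_distrib)
      then show ?thesis using cm elim(3) .
    qed
    moreover have "?c (k n) * (1 + ?l n) / (?c (m n) * ?l n) = ?c (k n) / ?c (m n) * (1 / ?l n + 1)"
    proof -
      have "D * (1 + l) / (C * l) = D / C * (1 / l + 1)" if "0 < C" "0 < l" for C D l :: real
        using that by (simp add: add_divide_distrib distrib_left)
      then show ?thesis using cm elim(3) .
    qed
    moreover have "?c (m n) / (1 + \<alpha> / real (k n))\<^sup>2 * (?l n - ln (real (k n))) / (?c (m n) * ?l n) \<le> ?s n / (?c (m n) * ?l n)"
      "?s n / (?c (m n) * ?l n) \<le> ?c (k n) * (1 + ?l n) / (?c (m n) * ?l n)"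
      by (rule divide_right_mono[OF lo cl], rule divide_right_mono[OF up cl])
    ultimately show ?case by (simp only:)
  qed
  show ?thesis
  proof (rule tendsto_sandwich)
    show "\<forall>\<^sub>F n in sequentially. 1 / (1 + \<alpha> / real (k n))\<^sup>2 * (1 - ln (real (k n)) / ?l n) \<le> ?s n / (?c (m n) * ?l n)"
      using ev by eventually_elim simp
    show "\<forall>\<^sub>F n in sequentially. ?s n / (?c (m n) * ?l n) \<le> ?c (k n) / ?c (m n) * (1 / ?l n + 1)"
      using ev by eventually_elim simp
    have "(\<lambda>n. 1 / (1 + \<alpha> / real (k n))\<^sup>2 * (1 - ln (real (k n)) / ?l n)) \<longlonglongrightarrow> 1 / (1 + 0)\<^sup>2 * (1 - 0)"
      by (intro tendsto_mult tendsto_divide tendsto_power tendsto_add tendsto_diff tendsto_const start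
          real_tendsto_divide_at_top[OF tendsto_const kreal]) simp
    then show "(\<lambda>n. 1 / (1 + \<alpha> / real (k n))\<^sup>2 * (1 - ln (real (k n)) / ?l n)) \<longlonglongrightarrow> 1" by simp
    have "(\<lambda>n. ?c (k n) / ?c (m n) * (1 / ?l n + 1)) \<longlonglongrightarrow> 1 / 1 * (0 + 1)"
      by (intro tendsto_mult tendsto_divide tendsto_add tendsto_const ck real_tendsto_divide_at_top[OF tendsto_const l_top]) simp
    then show "(\<lambda>n. ?c (k n) / ?c (m n) * (1 / ?l n + 1)) \<longlonglongrightarrow> 1" by simp
  qed
qed

lemma num_moves_of_nat: "num_moves X n \<omega> = real (\<Sum>k=1..n. of_bool (X k \<omega> \<noteq> 0))"
  by (simp add: num_moves_def)

lemma ln_num_moves_nonneg: "0 \<le> ln (num_moves X n \<omega>)"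
proof -
  have "0 \<le> ln (real i)" for i :: nat by (cases i) auto
  then show ?thesis unfolding num_moves_of_nat .
qed

text \<open>
  The logarithm of \<open>\<Sigma>\<^sub>j\<close> is the sum of \<open>ln \<Sigma>\<^sub>k\<close>, which lies between 0 and \<open>ln k\<close>, of
  \<open>ln (growth \<beta> j) - ln (growth \<beta> k)\<close>, and of \<open>ln (1 + deviation k j)\<close>.
\<close>

lemma ln_num_moves_ratio_bound:
  assumes reg: "regular \<omega>" and n: "1 \<le> k" "k \<le> j" and l: "1 \<le> \<beta> * ln (real j)"
  defines "e \<equiv> ((ln (real k) + \<bar>ln (growth \<beta> k)\<bar>) / ln (real j) + \<bar>ln (growth \<beta> j) - \<beta> * ln (real j)\<bar> / ln (real j)) / \<beta>"
  shows "min 1 \<bar>ln (num_moves X j \<omega>) / (\<beta> * ln (real j)) - 1\<bar> \<le> e + 2 * min 1 \<bar>deviation k j \<omega>\<bar>"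
proof -
  let ?S = "num_moves X j \<omega>" and ?t = "num_moves X k \<omega>" and ?d = "deviation k j \<omega>" and ?l = "ln (real j)"
  have t: "1 \<le> ?t" "?t \<le> real k" "1 \<le> ?S" using num_moves_ge_1[OF reg] num_moves_le n by auto
  have b: "0 < growth \<beta> k" "0 < growth \<beta> j" using growth_pos n \<alpha>_bounds by auto
  have d: "0 < 1 + ?d" using t b by (simp add: deviation_def)
  have "?S = ?t * (growth \<beta> j / growth \<beta> k) * (1 + ?d)"
    using t b by (simp add: deviation_def)
  then have "ln ?S = ln (?t * (growth \<beta> j / growth \<beta> k) * (1 + ?d))" by simp
  also have "\<dots> = ln ?t + (ln (growth \<beta> j) - ln (growth \<beta> k)) + ln (1 + ?d)"
    using t b d by (simp add: ln_mult ln_div)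
  finally have ln_S: "ln ?S - \<beta> * ?l = ln ?t - ln (growth \<beta> k) + (ln (growth \<beta> j) - \<beta> * ?l) + ln (1 + ?d)" by simp
  have "0 \<le> ln ?t" "ln ?t \<le> ln (real k)" using t n by auto
  then have "\<bar>ln ?S - \<beta> * ?l\<bar> \<le> (ln (real k) + \<bar>ln (growth \<beta> k)\<bar> + \<bar>ln (growth \<beta> j) - \<beta> * ?l\<bar>) + \<bar>ln (1 + ?d)\<bar>"
    unfolding ln_S by linarith
  then have "\<bar>ln ?S - \<beta> * ?l\<bar> / (\<beta> * ?l) \<le> ((ln (real k) + \<bar>ln (growth \<beta> k)\<bar> + \<bar>ln (growth \<beta> j) - \<beta> * ?l\<bar>) + \<bar>ln (1 + ?d)\<bar>) / (\<beta> * ?l)"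
    using l by (intro divide_right_mono) auto
  also have "\<dots> = e + \<bar>ln (1 + ?d)\<bar> / (\<beta> * ?l)"
    by (simp add: e_def add_divide_distrib mult.commute)
  also have "\<bar>ln (1 + ?d)\<bar> / (\<beta> * ?l) \<le> \<bar>ln (1 + ?d)\<bar> / 1" using l by (intro divide_left_mono) auto
  finally have "\<bar>ln ?S - \<beta> * ?l\<bar> / (\<beta> * ?l) \<le> e + \<bar>ln (1 + ?d)\<bar>" by simp
  moreover have "ln ?S / (\<beta> * ?l) - 1 = (ln ?S - \<beta> * ?l) / (\<beta> * ?l)" using l by (auto simp: diff_divide_distrib)
  then have "\<bar>ln ?S / (\<beta> * ?l) - 1\<bar> = \<bar>ln ?S - \<beta> * ?l\<bar> / (\<beta> * ?l)" using l by (simp only: abs_divide)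
  moreover have "0 \<le> e"
  proof -
    have "0 < ?l" using l \<beta>_bounds by (smt (verit) mult_nonneg_nonpos)
    then show ?thesis using n \<beta>_bounds unfolding e_def by (intro divide_nonneg_nonneg add_nonneg_nonneg) auto
  qed
  ultimately have "min 1 \<bar>ln ?S / (\<beta> * ?l) - 1\<bar> \<le> e + min 1 \<bar>ln (1 + ?d)\<bar>" by (auto simp: min_def)
  then show ?thesis using min_1_abs_ln_le[OF d] by linarith
qed

text \<open>
  The start is chosen so slowly growing that, in addition, \<open>ln \<Sigma>\<^sub>m\<close> is asymptotic to \<open>\<beta> ln m\<close> in
  probability.
\<close>

theorem critical_clt:
  assumes crit: "\<alpha> = \<beta> / 2"
  shows "converges_in_distribution P (\<lambda>n \<omega>. ratio n * array_walk m X V \<eta> n \<omega> / sqrt (num_moves X (m n) \<omega> * ln (num_moves X (m n) \<omega>)))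
     (centered_normal ((mix \<gamma>)\<^sup>2))"
proof -
  let ?c = "clock \<alpha> \<beta>" and ?l = "\<lambda>i. ln (real i)"
  have c1: "?c \<longlonglongrightarrow> 1" by (rule clock_tendsto_1[OF \<alpha>_bounds(2,4) crit])
  have l_top: "filterlim ?l at_top sequentially"
    by (rule filterlim_compose[OF ln_at_top filterlim_real_sequentially])
  \<comment> \<open>\<open>F1\<close> controls the start and \<open>F2\<close> the logarithm of the number of moves\<close>
  define F1 where "F1 k i = (real k)\<^sup>2 * ?c k / ?c i / ?l i" for k i
  define F2 where "F2 k i = (?l k + \<bar>ln (growth \<beta> k)\<bar>) / ?l i" for k i
  have F: "(\<lambda>i. F1 k i + F2 k i) \<longlonglongrightarrow> 0" for k
  proof -
    have "(\<lambda>i. F1 k i + F2 k i) \<longlonglongrightarrow> 0 + 0"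
      unfolding F1_def F2_def
    proof (intro tendsto_add)
      show "(\<lambda>i. (real k)\<^sup>2 * ?c k / ?c i / ?l i) \<longlonglongrightarrow> 0"
        by (rule real_tendsto_divide_at_top[OF tendsto_divide[OF tendsto_const c1] l_top]) simp
      show "(\<lambda>i. (?l k + \<bar>ln (growth \<beta> k)\<bar>) / ?l i) \<longlonglongrightarrow> 0"
        by (rule real_tendsto_divide_at_top[OF tendsto_const l_top])
    qed
    then show ?thesis by simp
  qed
  then obtain g where g: "filterlim g at_top sequentially" "\<And>i. g i \<le> i"
    "(\<lambda>i. F1 (g i) i + F2 (g i) i) \<longlonglongrightarrow> 0"
    using diagonal_sequence[of "\<lambda>k i. F1 k i + F2 k i"] by blast
  define k where "k n = g (m n)" for n
  have k: "filterlim k at_top sequentially" "\<And>n. k n \<le> m n"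
    using filterlim_compose[OF g(1) m_at_top] g(2) by (auto simp: k_def[abs_def])
  have lm_top: "filterlim (\<lambda>n. ?l (m n)) at_top sequentially"
    by (rule filterlim_compose[OF l_top m_at_top])
  have k1: "\<forall>\<^sub>F n in sequentially. 1 \<le> k n" using k(1) by (simp add: filterlim_at_top)
  have l1: "\<forall>\<^sub>F n in sequentially. 1 / \<beta> \<le> ?l (m n)" using lm_top by (simp add: filterlim_at_top)
  have F_nonneg: "\<forall>\<^sub>F n in sequentially. 0 \<le> F1 (k n) (m n) \<and> 0 \<le> F2 (k n) (m n)
      \<and> ?l (k n) / ?l (m n) \<le> F2 (k n) (m n) \<and> 0 \<le> ?l (k n) / ?l (m n)"
    using k1 l1
  proof eventually_elim
    case (elim n)
    have l: "0 < ?l (m n)" using elim(2) \<beta>_bounds by (smt (verit) divide_pos_pos)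
    have "0 < ?c (k n)" "0 < ?c (m n)"
      using clock_pos[OF \<alpha>_bounds(2,4), of "k n"] clock_pos[OF \<alpha>_bounds(2,4), of "m n"] k(2)[of n] elim by auto
    then show ?case using l elim(1) by (auto simp: F1_def F2_def divide_right_mono)
  qed
  have F_lim: "(\<lambda>n. F1 (k n) (m n) + F2 (k n) (m n)) \<longlonglongrightarrow> 0"
    using filterlim_compose[OF g(3) m_at_top] by (simp add: k_def)
  have F1_lim: "(\<lambda>n. F1 (k n) (m n)) \<longlonglongrightarrow> 0"
    by (rule tendsto_sandwich[OF _ _ tendsto_const F_lim]) (use F_nonneg in \<open>auto elim!: eventually_mono\<close>)
  have F2_lim: "(\<lambda>n. F2 (k n) (m n)) \<longlonglongrightarrow> 0"
    by (rule tendsto_sandwich[OF _ _ tendsto_const F_lim]) (use F_nonneg in \<open>auto elim!: eventually_mono\<close>)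
  have ln_lim: "(\<lambda>n. ?l (k n) / ?l (m n)) \<longlonglongrightarrow> 0"
    by (rule tendsto_sandwich[OF _ _ tendsto_const F2_lim]) (use F_nonneg in \<open>auto elim!: eventually_mono\<close>)
  define e where "e n = (F2 (k n) (m n) + \<bar>ln (growth \<beta> (m n)) - \<beta> * ?l (m n)\<bar> / ?l (m n)) / \<beta>" for n
  have e_lim: "e \<longlonglongrightarrow> 0"
  proof -
    have "(\<lambda>i. ln (growth \<beta> i / real i powr \<beta>)) \<longlonglongrightarrow> ln 1"
      by (intro tendsto_ln growth_asymptotics \<alpha>_bounds) simp
    then have "(\<lambda>i. ln (growth \<beta> i) - \<beta> * ?l i) \<longlonglongrightarrow> ln 1"
    proof (rule Lim_transform_eventually)
      show "\<forall>\<^sub>F i in sequentially. ln (growth \<beta> i / real i powr \<beta>) = ln (growth \<beta> i) - \<beta> * ?l i"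
        using eventually_ge_at_top[of 1]
      proof eventually_elim
        case (elim i)
        then show ?case using growth_pos[OF \<alpha>_bounds(4) elim] by (simp add: ln_div ln_powr)
      qed
    qed
    then have "(\<lambda>n. \<bar>ln (growth \<beta> (m n)) - \<beta> * ?l (m n)\<bar>) \<longlonglongrightarrow> \<bar>ln 1\<bar>"
      by (intro tendsto_rabs) (rule filterlim_compose[OF _ m_at_top])
    then have "(\<lambda>n. \<bar>ln (growth \<beta> (m n)) - \<beta> * ?l (m n)\<bar> / ?l (m n)) \<longlonglongrightarrow> 0"
      by (rule real_tendsto_divide_at_top[OF _ lm_top])
    then have "e \<longlonglongrightarrow> (0 + 0) / \<beta>"
      unfolding e_def by (intro tendsto_divide tendsto_add F2_lim tendsto_const) (use \<beta>_bounds in auto)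
    then show ?thesis by simp
  qed
  have "converges_in_distribution P (\<lambda>n \<omega>. ratio n * array_walk m X V \<eta> n \<omega> / sqrt (num_moves X (m n) \<omega> * ln (num_moves X (m n) \<omega>)))
     (centered_normal ((mix \<gamma>)\<^sup>2 * 1 + \<beta> * \<gamma> * (1 - \<gamma>) * 0))"
  \<comment> \<open>eventually the clock lies between 1/2 and 2 and \<open>h\<close> is at least 1, so that \<open>K\<^sup>2 = 4\<close> suffices\<close>
  proof (rule clt_up_to_critical[where K=2 and h="\<lambda>n. \<beta> * ?l (m n)" and k=k])
    show "\<forall>\<^sub>F n in sequentially. k n \<le> m n" using k(2) by simp
    show "\<forall>\<^sub>F n in sequentially. 0 < \<beta> * ?l (m n)"
      using l1
    proof eventually_elim
      case (elim n)
      then have "0 < ?l (m n)" using \<beta>_bounds by (smt (verit) divide_pos_pos)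
      then show ?case using \<beta>_bounds by simp
    qed
    have "\<forall>\<^sub>F i in sequentially. 1 / 2 < ?c i \<and> ?c i < 2"
      by (intro eventually_conj order_tendstoD[OF c1]) auto
    then obtain i0 where i0: "\<And>i. i0 \<le> i \<Longrightarrow> 1 / 2 < ?c i \<and> ?c i < 2"
      by (auto simp: eventually_sequentially)
    have "\<forall>\<^sub>F n in sequentially. i0 \<le> k n" using k(1) by (simp add: filterlim_at_top)
    then show "\<forall>\<^sub>F n in sequentially. 1 \<le> 2\<^sup>2 * (\<beta> * ?l (m n)) \<and> (\<forall>j. k n \<le> j \<longrightarrow> j < m n \<longrightarrow> ?c (Suc j) \<le> 2\<^sup>2 * (?c (m n) * (\<beta> * ?l (m n))))"
      using l1
    proof eventually_elim
      case (elim n)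
      have l: "1 \<le> \<beta> * ?l (m n)" using elim(2) \<beta>_bounds by (simp add: divide_le_eq mult.commute)
      have "1 / 2 * 1 \<le> ?c (m n) * (\<beta> * ?l (m n))"
        using i0[of "m n"] elim(1) k(2)[of n] l by (intro mult_mono) auto
      moreover have "?c (Suc j) \<le> 2" if "k n \<le> j" for j using i0[of "Suc j"] elim(1) that by simp
      ultimately show ?case using l by force
    qed
    show "(\<lambda>n. \<beta> * (\<Sum>j=k n..<m n. clock_tick \<alpha> \<beta> j) / (?c (m n) * (\<beta> * ?l (m n)))) \<longlonglongrightarrow> 1"
      using critical_variance[OF crit k(1) _ ln_lim] k(2) \<beta>_bounds by (simp add: mult.left_commute)
    have "(\<lambda>n. 1 / ?l (m n)) \<longlonglongrightarrow> 0" by (rule real_tendsto_divide_at_top[OF tendsto_const lm_top])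
    from tendsto_mult[OF tendsto_const[of "1 / \<beta>"] this] show "(\<lambda>n. 1 / (\<beta> * ?l (m n))) \<longlonglongrightarrow> 0" by simp
    from tendsto_mult[OF tendsto_const[of "1 / \<beta>"] F1_lim]
    show "(\<lambda>n. (real (k n))\<^sup>2 * ?c (k n) / (?c (m n) * (\<beta> * ?l (m n)))) \<longlonglongrightarrow> 0"
      by (simp add: F1_def mult_ac)
    show "vanishes_in_prob (\<lambda>n \<omega>. (1 + deviation (k n) (m n) \<omega>) * (ln (num_moves X (m n) \<omega>) / (\<beta> * ?l (m n))) - 1)"
    proof (rule vanishes_in_probI)
      let ?d = "\<lambda>n \<omega>. min 1 \<bar>deviation (k n) (m n) \<omega>\<bar>"
      show "\<forall>\<^sub>F n in sequentially. integrable P (\<lambda>\<omega>. 6 * ?d n \<omega> + 2 * e n)"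
        by (intro always_eventually allI Bochner_Integration.integrable_add integrable_mult_right integrable_min_1_abs integrable_const) measurable
      show "\<forall>\<^sub>F n in sequentially. AE \<omega> in P. min 1 \<bar>(1 + deviation (k n) (m n) \<omega>) * (ln (num_moves X (m n) \<omega>) / (\<beta> * ?l (m n))) - 1\<bar> \<le> 6 * ?d n \<omega> + 2 * e n"
        using k1 l1
      proof eventually_elim
        case (elim n)
        have l: "1 \<le> \<beta> * ?l (m n)" using elim(2) \<beta>_bounds by (simp add: divide_le_eq mult.commute)
        show ?case using AE_regular
        proof eventually_elim
          case (elim \<omega>)
          have "min 1 \<bar>ln (num_moves X (m n) \<omega>) / (\<beta> * ?l (m n)) - 1\<bar> \<le> e n + 2 * ?d n \<omega>"
            using ln_num_moves_ratio_bound[OF elim \<open>1 \<le> k n\<close> k(2) l] by (simp add: e_def F2_def)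
          then show ?case
            using min_1_abs_mult_le[of "deviation (k n) (m n) \<omega>" "ln (num_moves X (m n) \<omega>) / (\<beta> * ?l (m n))"] by linarith
        qed
      qed
      have "expectation (\<lambda>\<omega>. 6 * ?d n \<omega> + 2 * e n) = 6 * expectation (?d n) + 2 * e n" for n
        by (subst Bochner_Integration.integral_add) (auto simp: prob_space intro!: integrable_mult_right integrable_min_1_abs)
      moreover have "(\<lambda>n. 6 * expectation (?d n) + 2 * e n) \<longlonglongrightarrow> 6 * 0 + 2 * 0"
        using vanishes_deviation[OF k(1)] k(2) unfolding vanishes_in_prob_def
        by (intro tendsto_add tendsto_mult tendsto_const e_lim) auto
      ultimately show "(\<lambda>n. expectation (\<lambda>\<omega>. 6 * ?d n \<omega> + 2 * e n)) \<longlonglongrightarrow> 0" by simp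
    qed measurable
  qed (use k(1) ln_num_moves_nonneg in auto)
  then show ?thesis by simp
qed

section \<open>Above the critical parameter\<close>

text \<open>
  Above the critical parameter the clock decreases to 0, and telescoping bounds all partial sums of ticks.
\<close>

lemma clock_tail:
  assumes super: "\<alpha> > \<beta> / 2" and k: "1 \<le> k"
  obtains l where "(\<lambda>N. \<Sum>j=k..<N. clock_tick \<alpha> \<beta> j) \<longlonglongrightarrow> l"
    "clock \<alpha> \<beta> k / (2 * \<alpha> - \<beta> + \<alpha>\<^sup>2 / real k) \<le> l" "l \<le> clock \<alpha> \<beta> k / (2 * \<alpha> - \<beta>)"
proof -
  define d where "d = 2 * \<alpha> - \<beta>"
  have d: "0 < d" using super by (simp add: d_def)
  let ?s = "\<lambda>N. \<Sum>j=k..<N. clock_tick \<alpha> \<beta> j" and ?c = "clock \<alpha> \<beta>"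
  have tick: "0 \<le> clock_tick \<alpha> \<beta> j" if "k \<le> j" for j
    using clock_tick_pos[OF \<alpha>_bounds(2,4), of j] that k by auto
  have d': "0 < d + \<alpha>\<^sup>2 / real k" using d by (simp add: add_pos_nonneg)
  have bounds: "(?c k - ?c N) / (d + \<alpha>\<^sup>2 / real k) \<le> ?s N" "?s N \<le> (?c k - ?c N) / d" if "k \<le> N" for N
  proof -
    have tele: "(\<Sum>j=k..<N. clock_tick \<alpha> \<beta> j * (d + \<alpha>\<^sup>2 / real j)) = ?c k - ?c N"
      using clock_telescope[OF \<alpha>_bounds(2,4) k that] by (simp add: d_def)
    have "(\<Sum>j=k..<N. clock_tick \<alpha> \<beta> j * d) \<le> ?c k - ?c N"
      unfolding tele[symmetric] using tick by (intro sum_mono mult_left_mono) auto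
    then have "?s N * d \<le> ?c k - ?c N" by (simp add: sum_distrib_right)
    then show "?s N \<le> (?c k - ?c N) / d" using d by (simp add: le_divide_eq)
    have "?c k - ?c N \<le> (\<Sum>j=k..<N. clock_tick \<alpha> \<beta> j * (d + \<alpha>\<^sup>2 / real k))"
      unfolding tele[symmetric] using tick k by (intro sum_mono mult_left_mono add_left_mono divide_left_mono) auto
    then have "?c k - ?c N \<le> ?s N * (d + \<alpha>\<^sup>2 / real k)" by (simp add: sum_distrib_right)
    then show "(?c k - ?c N) / (d + \<alpha>\<^sup>2 / real k) \<le> ?s N" using d' by (simp add: divide_le_eq)
  qed
  have inc: "incseq ?s"
  proof (rule incseq_SucI)
    fix N
    show "?s N \<le> ?s (Suc N)" using tick[of N] by (cases "k \<le> N") auto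
  qed
  have up: "?s N \<le> ?c k / d" for N
  proof (cases "k \<le> N")
    case True
    have "0 < ?c N" using clock_pos[OF \<alpha>_bounds(2,4), of N] True k by simp
    then have "(?c k - ?c N) / d \<le> ?c k / d" using d by (intro divide_right_mono) auto
    then show ?thesis using bounds(2)[OF True] by simp
  next
    case False
    then show ?thesis using clock_pos[OF \<alpha>_bounds(2,4) k] d by simp
  qed
  obtain s where s: "?s \<longlonglongrightarrow> s" using incseq_convergent[OF inc] up by blast
  have "(\<lambda>N. (?c k - ?c N) / (d + \<alpha>\<^sup>2 / real k)) \<longlonglongrightarrow> (?c k - 0) / (d + \<alpha>\<^sup>2 / real k)"
    using clock_tendsto_0[OF \<alpha>_bounds(2,4) super] d' by (intro tendsto_intros) auto
  then have "(?c k - 0) / (d + \<alpha>\<^sup>2 / real k) \<le> s"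
    using s by (rule LIMSEQ_le) (use bounds(1) in blast)
  moreover have "s \<le> ?c k / d" using s by (rule LIMSEQ_le_const2) (use up in blast)
  ultimately show ?thesis using that[OF s] by (simp add: d_def)
qed

text \<open>
  With \<open>a = growth \<alpha>\<close> and \<open>m = m n\<close>, \<open>W\<^sub>m - a\<^sub>m M\<close> is the limit, as \<open>N\<close> tends to infinity, of \<open>- a\<^sub>m\<close> times the
  sum of the martingale increments from \<open>m\<close> to \<open>N\<close>. The estimate \<open>char_bound_scaled\<close>, started at \<open>k = m\<close>,
  has an error that does not depend on \<open>N\<close>, so it passes to the limit and covers the joint fluctuations of
  \<open>M\<close> and of the row.
\<close>

theorem supercritical_clt:
  assumes super: "\<alpha> > \<beta> / 2" and M [measurable]: "M \<in> borel_measurable P"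
    and conv: "AE \<omega> in P. (\<lambda>n. walk X n \<omega> / real n powr \<alpha>) \<longlonglongrightarrow> M \<omega>"
  shows "converges_in_distribution P
     (\<lambda>n \<omega>. (ratio n * array_walk m X V \<eta> n \<omega> - M \<omega> * mix (ratio n) * real (m n) powr \<alpha>) / sqrt (num_moves X (m n) \<omega>))
     (centered_normal (\<beta> * (mix \<gamma>)\<^sup>2 / (2 * \<alpha> - \<beta>) + \<beta> * \<gamma> * (1 - \<gamma>)))"
proof -
  define \<sigma> where "\<sigma> = (mix \<gamma>)\<^sup>2 * (\<beta> / (2 * \<alpha> - \<beta>)) + \<beta> * \<gamma> * (1 - \<gamma>)"
  have \<alpha>0: "0 < \<alpha>" "\<alpha> < 1" using super \<beta>_bounds \<alpha>_bounds by auto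
  let ?a = "growth \<alpha>" and ?c = "clock \<alpha> \<beta>"
  define A where "A n \<omega> = (mix (ratio n) * (walk X (m n) \<omega> - M \<omega> * ?a (m n)) + ratio n * (\<Sum>i=m n..<n. row_noise n (Suc i) \<omega>)) / sqrt (num_moves X (m n) \<omega>)" for n \<omega>
  define B where "B n \<omega> = mix (ratio n) * (M \<omega> * (?a (m n) - real (m n) powr \<alpha>)) / sqrt (num_moves X (m n) \<omega>)" for n \<omega>
  define C where "C n \<omega> = (ratio n * array_walk m X V \<eta> n \<omega> - M \<omega> * mix (ratio n) * real (m n) powr \<alpha>) / sqrt (num_moves X (m n) \<omega>)" for n \<omega>
  have \<sigma>0: "0 \<le> \<sigma>"
    using super \<beta>_bounds \<gamma>_bounds unfolding \<sigma>_def by (intro add_nonneg_nonneg mult_nonneg_nonneg divide_nonneg_nonneg) auto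
  have [measurable]: "random_variable borel (A n)" "random_variable borel (B n)" "random_variable borel (C n)" for n
    unfolding A_def[abs_def] B_def[abs_def] C_def[abs_def] by measurable
  have conv': "AE \<omega> in P. (\<lambda>N. walk X N \<omega> / ?a N) \<longlonglongrightarrow> M \<omega>"
    using conv
  proof eventually_elim
    case (elim \<omega>)
    have "(\<lambda>N. (walk X N \<omega> / real N powr \<alpha>) / (?a N / real N powr \<alpha>)) \<longlonglongrightarrow> M \<omega> / 1"
      by (intro tendsto_divide elim growth_asymptotics \<alpha>_bounds) simp
    then have "(\<lambda>N. walk X N \<omega> / ?a N) \<longlonglongrightarrow> M \<omega> / 1"
      by (rule Lim_transform_eventually) (rule eventually_mono[OF eventually_gt_at_top[of 0]], simp)
    then show ?case by simp
  qed
  have "\<forall>k. \<exists>s. 1 \<le> k \<longrightarrow> (\<lambda>N. \<Sum>j=k..<N. clock_tick \<alpha> \<beta> j) \<longlonglongrightarrow> s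
    \<and> ?c k / (2 * \<alpha> - \<beta> + \<alpha>\<^sup>2 / real k) \<le> s \<and> s \<le> ?c k / (2 * \<alpha> - \<beta>)"
    using clock_tail[OF super] by metis
  then obtain tail where tail: "\<And>k. 1 \<le> k \<Longrightarrow> (\<lambda>N. \<Sum>j=k..<N. clock_tick \<alpha> \<beta> j) \<longlonglongrightarrow> tail k"
    "\<And>k. 1 \<le> k \<Longrightarrow> ?c k / (2 * \<alpha> - \<beta> + \<alpha>\<^sup>2 / real k) \<le> tail k"
    "\<And>k. 1 \<le> k \<Longrightarrow> tail k \<le> ?c k / (2 * \<alpha> - \<beta>)"
    by metis
  have c_pos: "0 < ?c k" if "1 \<le> k" for k using clock_pos[OF \<alpha>_bounds(2,4) that] .
  have tail_lim: "(\<lambda>k. tail k / ?c k) \<longlonglongrightarrow> 1 / (2 * \<alpha> - \<beta>)"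
  proof (rule tendsto_sandwich)
    show "\<forall>\<^sub>F k in sequentially. 1 / (2 * \<alpha> - \<beta> + \<alpha>\<^sup>2 / real k) \<le> tail k / ?c k"
      using eventually_ge_at_top[of 1]
    proof eventually_elim
      case (elim k)
      from divide_right_mono[OF tail(2)[OF elim], of "?c k"] show ?case using c_pos[OF elim] by simp
    qed
    show "\<forall>\<^sub>F k in sequentially. tail k / ?c k \<le> 1 / (2 * \<alpha> - \<beta>)"
      using eventually_ge_at_top[of 1]
    proof eventually_elim
      case (elim k)
      from divide_right_mono[OF tail(3)[OF elim], of "?c k"] show ?case using c_pos[OF elim] by simp
    qed
    have "(\<lambda>k. 1 / (2 * \<alpha> - \<beta> + \<alpha>\<^sup>2 / real k)) \<longlonglongrightarrow> 1 / (2 * \<alpha> - \<beta> + 0)"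
      using super by (intro tendsto_intros real_tendsto_divide_at_top[OF tendsto_const filterlim_real_sequentially]) auto
    then show "(\<lambda>k. 1 / (2 * \<alpha> - \<beta> + \<alpha>\<^sup>2 / real k)) \<longlonglongrightarrow> 1 / (2 * \<alpha> - \<beta>)" by simp
  qed simp
  define \<tau> where "\<tau> n = (mix (ratio n))\<^sup>2 * (\<beta> * (tail (m n) / ?c (m n))) + real (n - m n) * (\<beta> * (ratio n)\<^sup>2 / real (m n))" for n
  have tau_lim: "\<tau> \<longlonglongrightarrow> \<sigma>"
  proof -
    have "\<tau> \<longlonglongrightarrow> (mix \<gamma>)\<^sup>2 * (\<beta> * (1 / (2 * \<alpha> - \<beta>))) + \<beta> * \<gamma> * (1 - \<gamma>)"
      unfolding \<tau>_def
      by (intro tendsto_add tendsto_mult tendsto_power mix_lim tendsto_const row_variance_limit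
          filterlim_compose[OF tail_lim m_at_top])
    then show ?thesis by (simp add: \<sigma>_def)
  qed
  have bound: "cmod (expectation (\<lambda>\<omega>. iexp (t * A n \<omega>)) - of_real (exp (- (t\<^sup>2 * \<tau> n) / 2)))
      \<le> t\<^sup>2 * \<tau> n * char_error (m n) (\<bar>t\<bar> * 1)" if n: "1 \<le> n" for n t
  proof -
    have mn: "1 \<le> m n" using m[OF n] by simp
    have a: "0 < ?a i" if "1 \<le> i" for i using growth_pos[OF \<alpha>_bounds(2) that] .
    have b: "0 < growth \<beta> (m n)" using growth_pos[OF \<alpha>_bounds(4) mn] .
    define w where "w j = - mix (ratio n) * ?a (m n) / ?a (Suc j)" for j
    \<comment> \<open>\<open>D N\<close> tends to \<open>A n\<close> almost surely as \<open>N\<close> tends to infinity\<close>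
    define D where "D N \<omega> = walk_part (m n) w N \<omega> + ratio n * row_part (m n) n n \<omega>" for N \<omega>
    define u where "u N = (\<Sum>j=m n..<N. step_variance (m n) j (w j)) + real (n - m n) * step_variance (m n) (m n) (ratio n)" for N
    have mix1: "\<bar>mix (ratio n)\<bar> \<le> 1" using ratio_bounds[of n] n by (intro abs_mix_le_1) auto
    have w1: "\<bar>w j\<bar> \<le> 1" if "m n \<le> j" for j
    proof -
      have "\<bar>w j\<bar> = \<bar>mix (ratio n)\<bar> * (?a (m n) / ?a (Suc j))"
        using a[OF mn] a[of "Suc j"] by (simp add: w_def abs_mult abs_divide)
      also have "\<dots> \<le> 1 * 1"
        using mix1 a[OF mn] a[of "Suc j"] growth_mono[of \<alpha> "m n" "Suc j"] \<alpha>0 that mn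
        by (intro mult_mono) (auto simp: divide_le_eq)
      finally show ?thesis by simp
    qed
    have step: "step_variance (m n) j (w j) = (mix (ratio n))\<^sup>2 * \<beta> / ?c (m n) * clock_tick \<alpha> \<beta> j" for j
      using b by (simp add: step_variance_def w_def clock_def clock_tick_def power_mult_distrib power_divide mult_ac)
    have row: "step_variance (m n) (m n) (ratio n) = \<beta> * (ratio n)\<^sup>2 / real (m n)"
      using b by (simp add: step_variance_def mult_ac)
    have u_lim: "u \<longlonglongrightarrow> \<tau> n"
    proof -
      have "u \<longlonglongrightarrow> (mix (ratio n))\<^sup>2 * \<beta> / ?c (m n) * tail (m n) + real (n - m n) * (\<beta> * (ratio n)\<^sup>2 / real (m n))"
        unfolding u_def step row sum_distrib_left[symmetric]
        by (intro tendsto_add tendsto_mult tendsto_const tail(1)[OF mn])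
      then show ?thesis by (simp add: \<tau>_def mult_ac)
    qed
    have D_lim: "AE \<omega> in P. (\<lambda>N. D N \<omega>) \<longlonglongrightarrow> A n \<omega>"
      using conv'
    proof eventually_elim
      case (elim \<omega>)
      define r where "r = sqrt (num_moves X (m n) \<omega>)"
      have D_eq: "D N \<omega> = (mix (ratio n) * (walk X (m n) \<omega> - (walk X N \<omega> / ?a N) * ?a (m n)) + ratio n * (\<Sum>i=m n..<n. row_noise n (Suc i) \<omega>)) / r"
        if N: "m n \<le> N" for N
      proof -
        have "(\<Sum>j=m n..<N. w j * increment j \<omega>) = - mix (ratio n) * ?a (m n) * (\<Sum>j=m n..<N. increment j \<omega> / ?a (Suc j))"
          by (simp add: w_def sum_distrib_left mult_ac)
        also have "\<dots> = - mix (ratio n) * ?a (m n) * (walk X N \<omega> / ?a N - walk X (m n) \<omega> / ?a (m n))"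
          by (simp only: walk_telescope[OF mn N])
        also have "\<dots> = mix (ratio n) * (walk X (m n) \<omega> - (walk X N \<omega> / ?a N) * ?a (m n))"
          using a[OF mn] by (simp add: right_diff_distrib)
        finally show ?thesis by (simp add: D_def walk_part_def row_part_def r_def add_divide_distrib)
      qed
      have "(\<lambda>N. (mix (ratio n) * (walk X (m n) \<omega> - (walk X N \<omega> / ?a N) * ?a (m n)) + ratio n * (\<Sum>i=m n..<n. row_noise n (Suc i) \<omega>)) * (1 / r))
        \<longlonglongrightarrow> (mix (ratio n) * (walk X (m n) \<omega> - M \<omega> * ?a (m n)) + ratio n * (\<Sum>i=m n..<n. row_noise n (Suc i) \<omega>)) * (1 / r)"
        by (intro tendsto_intros elim)
      then have "(\<lambda>N. (mix (ratio n) * (walk X (m n) \<omega> - (walk X N \<omega> / ?a N) * ?a (m n)) + ratio n * (\<Sum>i=m n..<n. row_noise n (Suc i) \<omega>)) / r) \<longlonglongrightarrow> A n \<omega>"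
        by (simp add: A_def r_def)
      then show ?case
        by (rule Lim_transform_eventually) (use D_eq in \<open>auto intro!: eventually_mono[OF eventually_ge_at_top[of "m n"]]\<close>)
    qed
    have [measurable]: "random_variable borel (D N)" for N
      unfolding D_def[abs_def] using walk_part_measurable[OF mn] by measurable
    have "(\<lambda>N. expectation (\<lambda>\<omega>. iexp (t * D N \<omega>))) \<longlonglongrightarrow> expectation (\<lambda>\<omega>. iexp (t * A n \<omega>))"
    proof (rule integral_dominated_convergence[where w="\<lambda>_. 1"])
      show "AE \<omega> in P. (\<lambda>N. iexp (t * D N \<omega>)) \<longlonglongrightarrow> iexp (t * A n \<omega>)"
        using D_lim by eventually_elim (intro tendsto_intros)
    qed auto
    then have lhs: "(\<lambda>N. cmod (expectation (\<lambda>\<omega>. iexp (t * D N \<omega>)) - of_real (exp (- (t\<^sup>2 * u N) / 2))))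
      \<longlonglongrightarrow> cmod (expectation (\<lambda>\<omega>. iexp (t * A n \<omega>)) - of_real (exp (- (t\<^sup>2 * \<tau> n) / 2)))"
      by (intro tendsto_intros u_lim) auto
    have rhs: "(\<lambda>N. t\<^sup>2 * u N * char_error (m n) (\<bar>t\<bar> * 1)) \<longlonglongrightarrow> t\<^sup>2 * \<tau> n * char_error (m n) (\<bar>t\<bar> * 1)"
      by (intro tendsto_intros u_lim)
    show ?thesis
    proof (rule LIMSEQ_le[OF lhs rhs], intro exI[of _ "m n"] allI impI)
      fix N assume N: "m n \<le> N"
      show "cmod (expectation (\<lambda>\<omega>. iexp (t * D N \<omega>)) - of_real (exp (- (t\<^sup>2 * u N) / 2))) \<le> t\<^sup>2 * u N * char_error (m n) (\<bar>t\<bar> * 1)"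
        unfolding D_def u_def using ratio_bounds[of n] n
        by (intro char_bound_scaled mn N order_refl w1) auto
    qed
  qed
  have "converges_in_distribution P C (centered_normal \<sigma>)"
  proof (rule slutsky[where A=A and B=B and R="\<lambda>_ _. 1"])
    show "real_distribution (centered_normal \<sigma>)" by (rule real_distribution_centered_normal[OF \<sigma>0])
    show "(\<lambda>n. expectation (\<lambda>\<omega>. iexp (t * A n \<omega>))) \<longlonglongrightarrow> char (centered_normal \<sigma>) t" for t
      by (rule char_limit[OF m_at_top tau_lim _ \<sigma>0]) (rule eventually_mono[OF eventually_ge_at_top[of 1]], rule bound)
    show "vanishes_in_prob (\<lambda>n \<omega>. 1 - 1)" by (simp add: vanishes_in_prob_def)
    show "vanishes_in_prob B"
    proof (rule vanishes_in_prob_AE)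
      show "AE \<omega> in P. (\<lambda>n. B n \<omega>) \<longlonglongrightarrow> 0"
        using AE_regular
      proof eventually_elim
        case (elim \<omega>)
        have lim: "(\<lambda>n. \<bar>M \<omega>\<bar> * \<bar>?a (m n) - real (m n) powr \<alpha>\<bar>) \<longlonglongrightarrow> \<bar>M \<omega>\<bar> * \<bar>0\<bar>"
          by (intro tendsto_mult tendsto_rabs tendsto_const filterlim_compose[OF growth_minus_powr[OF \<alpha>0] m_at_top])
        show ?case
        proof (rule Lim_null_comparison)
          show "(\<lambda>n. \<bar>M \<omega>\<bar> * \<bar>?a (m n) - real (m n) powr \<alpha>\<bar>) \<longlonglongrightarrow> 0" using lim by simp
          show "\<forall>\<^sub>F n in sequentially. norm (B n \<omega>) \<le> \<bar>M \<omega>\<bar> * \<bar>?a (m n) - real (m n) powr \<alpha>\<bar>"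
            using eventually_ge_at_top[of 1]
          proof eventually_elim
            case (elim n)
            have "norm (B n \<omega>) = \<bar>mix (ratio n)\<bar> * (\<bar>M \<omega>\<bar> * \<bar>?a (m n) - real (m n) powr \<alpha>\<bar>) * (1 / sqrt (num_moves X (m n) \<omega>))"
              by (simp add: B_def abs_mult abs_divide num_moves_nonneg)
            also have "\<dots> \<le> 1 * (\<bar>M \<omega>\<bar> * \<bar>?a (m n) - real (m n) powr \<alpha>\<bar>) * 1"
              using inverse_moves_bounds(4)[OF \<open>regular \<omega>\<close>, of "m n"] m[OF elim] ratio_bounds[of n] elim
              by (intro mult_mono abs_mix_le_1) (auto simp: num_moves_nonneg)
            finally show ?case by simp
          qed
        qed
      qed
    qed measurable
    show "\<forall>\<^sub>F n in sequentially. AE \<omega> in P. C n \<omega> = (A n \<omega> + B n \<omega>) * 1"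
      using eventually_ge_at_top[of 1]
    proof eventually_elim
      case (elim n)
      have "C n \<omega> = (A n \<omega> + B n \<omega>) * 1" for \<omega>
      proof -
        have "ratio n * array_walk m X V \<eta> n \<omega> = mix (ratio n) * walk X (m n) \<omega> + ratio n * (\<Sum>i=m n..<n. row_noise n (Suc i) \<omega>)"
          using array_walk_decomposition[OF elim, of \<omega>] by (simp add: ratio_def mix_def)
        then show ?thesis by (simp add: A_def B_def C_def algebra_simps flip: add_divide_distrib)
      qed
      then show ?case by simp
    qed
  qed measurable
  then show ?thesis unfolding C_def[abs_def] \<sigma>_def by (simp add: mult.commute)
qed

lemma square_integrable_array_walk:
  "square_integrable P (\<lambda>\<omega>. c * array_walk m X V \<eta> n \<omega>)"
  unfolding square_integrable_def
proof
  have step: "AE \<omega> in P. \<bar>array_step m X V \<eta> n k \<omega>\<bar> \<le> 1" if k: "k \<in> {1..n}" for k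
  proof (cases "k \<le> m n")
    case True
    show ?thesis using AE_regular
    proof eventually_elim
      case (elim \<omega>)
      have "X k \<omega> \<in> {-1, 0, 1}" using elim k by (simp add: regular_def)
      then show ?case using True by (auto simp: array_step_def)
    qed
  next
    case False
    then have "AE \<omega> in P. \<eta> n k \<omega> * X (V n k \<omega>) \<omega> \<in> {-1, 0, 1}"
      using k by (intro fresh_step_measurable(2)[OF fresh_step_array]) auto
    then show ?thesis by eventually_elim (use False in \<open>auto simp: array_step_def\<close>)
  qed
  have "AE \<omega> in P. \<forall>k\<in>{1..n}. \<bar>array_step m X V \<eta> n k \<omega>\<bar> \<le> 1"
    using step by (intro AE_finite_allI) auto
  then have "AE \<omega> in P. norm ((c * array_walk m X V \<eta> n \<omega>)\<^sup>2) \<le> (\<bar>c\<bar> * real n)\<^sup>2"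
  proof eventually_elim
    case (elim \<omega>)
    have "\<bar>array_walk m X V \<eta> n \<omega>\<bar> \<le> (\<Sum>k=1..n. \<bar>array_step m X V \<eta> n k \<omega>\<bar>)"
      unfolding array_walk_def by (rule sum_abs)
    also have "\<dots> \<le> (\<Sum>k=1..n. 1)" using elim by (intro sum_mono) auto
    finally have "\<bar>c * array_walk m X V \<eta> n \<omega>\<bar> \<le> \<bar>c\<bar> * real n" by (simp add: abs_mult mult_left_mono)
    then have "\<bar>c * array_walk m X V \<eta> n \<omega>\<bar>\<^sup>2 \<le> (\<bar>c\<bar> * real n)\<^sup>2" by (intro power_mono) auto
    then show ?case by simp
  qed
  then show "integrable P (\<lambda>\<omega>. (c * array_walk m X V \<eta> n \<omega>)\<^sup>2)"
    by (rule integrable_const_bound) measurable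
qed measurable

text \<open>
  The difference is split into the error of \<open>W\<^sub>m / m powr \<alpha>\<close>, the error of the ratio, and the row, whose second
  moment is of smaller order because \<open>\<beta> < 2 * \<alpha>\<close>.
\<close>

theorem supercritical_L2:
  assumes super: "\<alpha> > \<beta> / 2" and conv: "converges_in_L2 P (\<lambda>n \<omega>. walk X n \<omega> / real n powr \<alpha>) M"
  shows "converges_in_L2 P (\<lambda>n \<omega>. ratio n * array_walk m X V \<eta> n \<omega> / real (m n) powr \<alpha>) (\<lambda>\<omega>. mix \<gamma> * M \<omega>)"
proof -
  have M [measurable]: "random_variable borel M" and M2: "integrable P (\<lambda>\<omega>. (M \<omega>)\<^sup>2)"
    and W_lim: "(\<lambda>n. expectation (\<lambda>\<omega>. (walk X n \<omega> / real n powr \<alpha> - M \<omega>)\<^sup>2)) \<longlonglongrightarrow> 0"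
    using conv by (auto simp: converges_in_L2_def square_integrable_def)
  define Q where "Q n \<omega> = (\<Sum>i=m n..<n. row_noise n (Suc i) \<omega>)" for n \<omega>
  define E where "E n \<omega> = walk X (m n) \<omega> / real (m n) powr \<alpha> - M \<omega>" for n \<omega>
  have [measurable]: "random_variable borel (Q n)" "random_variable borel (E n)" for n
    unfolding Q_def[abs_def] E_def[abs_def] by measurable
  have Q2: "integrable P (\<lambda>\<omega>. (Q n \<omega>)\<^sup>2)" if n: "1 \<le> n" for n
  proof (rule integrable_const_bound[where B="(2 * real n)\<^sup>2"])
    show "AE \<omega> in P. norm ((Q n \<omega>)\<^sup>2) \<le> (2 * real n)\<^sup>2"
      using AE_row_noise_bound[OF n]
    proof eventually_elim
      case (elim \<omega>)
      have "\<bar>Q n \<omega>\<bar> \<le> (\<Sum>i=m n..<n. \<bar>row_noise n (Suc i) \<omega>\<bar>)" unfolding Q_def by (rule sum_abs)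
      also have "\<dots> \<le> (\<Sum>i=m n..<n. 2)" using elim by (intro sum_mono) auto
      also have "\<dots> \<le> 2 * real n" by simp
      finally have "\<bar>Q n \<omega>\<bar>\<^sup>2 \<le> (2 * real n)\<^sup>2" by (intro power_mono) auto
      then show ?case by simp
    qed
  qed measurable
  have W2: "integrable P (\<lambda>\<omega>. (walk X k \<omega> / real k powr \<alpha>)\<^sup>2)" for k
    using conv by (simp add: converges_in_L2_def square_integrable_def)
  have sq_diff: "(x - y)\<^sup>2 \<le> 2 * x\<^sup>2 + 2 * y\<^sup>2" for x y :: real
    using zero_le_power2[of "x + y"] by (simp add: power2_eq_square algebra_simps)
  have E2: "integrable P (\<lambda>\<omega>. (E n \<omega>)\<^sup>2)" for n
    by (rule Bochner_Integration.integrable_bound[OF Bochner_Integration.integrable_add[OF integrable_mult_right[OF W2, of 2] integrable_mult_right[OF M2, of 2]]])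
       (use sq_diff in \<open>auto simp: E_def\<close>)
  have sq3: "(x + y + z)\<^sup>2 \<le> 3 * (x\<^sup>2 + y\<^sup>2 + z\<^sup>2)" for x y z :: real
    using zero_le_power2[of "x - y"] zero_le_power2[of "y - z"] zero_le_power2[of "x - z"]
    by (simp add: power2_eq_square algebra_simps)
  let ?Z = "\<lambda>n \<omega>. ratio n * array_walk m X V \<eta> n \<omega> / real (m n) powr \<alpha>"
  let ?q = "\<lambda>n. real (n - m n) * (\<beta> * (ratio n)\<^sup>2 / real (m n)) * (growth \<beta> (m n) / (real (m n) powr (2 * \<alpha>)) / growth \<beta> 1)"
  have bound: "expectation (\<lambda>\<omega>. (?Z n \<omega> - mix \<gamma> * M \<omega>)\<^sup>2)
    \<le> 3 * (expectation (\<lambda>\<omega>. (E n \<omega>)\<^sup>2) + (mix (ratio n) - mix \<gamma>)\<^sup>2 * expectation (\<lambda>\<omega>. (M \<omega>)\<^sup>2) + ?q n)" if n: "1 \<le> n" for n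
  proof -
    have mn: "1 \<le> m n" "m n \<le> n" using m[OF n] by auto
    let ?p = "real (m n) powr \<alpha>"
    have p: "0 < ?p" using mn by simp
    have p2: "?p\<^sup>2 = real (m n) powr (2 * \<alpha>)" by (simp add: power2_eq_square flip: powr_add)
    have eq: "?Z n \<omega> - mix \<gamma> * M \<omega> = mix (ratio n) * E n \<omega> + (mix (ratio n) - mix \<gamma>) * M \<omega> + ratio n / ?p * Q n \<omega>" for \<omega>
    proof -
      have "ratio n * array_walk m X V \<eta> n \<omega> = mix (ratio n) * walk X (m n) \<omega> + ratio n * Q n \<omega>"
        using array_walk_decomposition[OF n, of \<omega>] by (simp add: ratio_def mix_def Q_def)
      then show ?thesis using p by (simp add: E_def add_divide_distrib algebra_simps)
    qed
    have mix2: "(mix (ratio n))\<^sup>2 \<le> 1"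
      using abs_mix_le_1[of "ratio n"] ratio_bounds[of n] n by (simp add: abs_square_le_1)
    have "expectation (\<lambda>\<omega>. (?Z n \<omega> - mix \<gamma> * M \<omega>)\<^sup>2)
      \<le> expectation (\<lambda>\<omega>. 3 * ((E n \<omega>)\<^sup>2 + (mix (ratio n) - mix \<gamma>)\<^sup>2 * (M \<omega>)\<^sup>2 + (ratio n / ?p)\<^sup>2 * (Q n \<omega>)\<^sup>2))"
    proof (rule integral_mono_AE')
      show "integrable P (\<lambda>\<omega>. 3 * ((E n \<omega>)\<^sup>2 + (mix (ratio n) - mix \<gamma>)\<^sup>2 * (M \<omega>)\<^sup>2 + (ratio n / ?p)\<^sup>2 * (Q n \<omega>)\<^sup>2))"
        by (intro integrable_mult_right Bochner_Integration.integrable_add E2 M2 Q2[OF n])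
      show "AE \<omega> in P. (?Z n \<omega> - mix \<gamma> * M \<omega>)\<^sup>2 \<le> 3 * ((E n \<omega>)\<^sup>2 + (mix (ratio n) - mix \<gamma>)\<^sup>2 * (M \<omega>)\<^sup>2 + (ratio n / ?p)\<^sup>2 * (Q n \<omega>)\<^sup>2)"
      proof (rule AE_I2)
        fix \<omega>
        have "(mix (ratio n))\<^sup>2 * (E n \<omega>)\<^sup>2 \<le> 1 * (E n \<omega>)\<^sup>2" using mix2 by (intro mult_right_mono) auto
        then show "(?Z n \<omega> - mix \<gamma> * M \<omega>)\<^sup>2 \<le> 3 * ((E n \<omega>)\<^sup>2 + (mix (ratio n) - mix \<gamma>)\<^sup>2 * (M \<omega>)\<^sup>2 + (ratio n / ?p)\<^sup>2 * (Q n \<omega>)\<^sup>2)"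
          unfolding eq by (intro order_trans[OF sq3] mult_left_mono add_mono) (simp_all add: power_mult_distrib power_divide)
      qed
    qed (auto intro!: AE_I2 add_nonneg_nonneg)
    also have "\<dots> = 3 * (expectation (\<lambda>\<omega>. (E n \<omega>)\<^sup>2) + (mix (ratio n) - mix \<gamma>)\<^sup>2 * expectation (\<lambda>\<omega>. (M \<omega>)\<^sup>2)
        + (ratio n / ?p)\<^sup>2 * expectation (\<lambda>\<omega>. (Q n \<omega>)\<^sup>2))"
      using E2[of n] M2 Q2[OF n] by (simp add: Bochner_Integration.integral_add)
    also have "(ratio n / ?p)\<^sup>2 * expectation (\<lambda>\<omega>. (Q n \<omega>)\<^sup>2)
       \<le> (ratio n / ?p)\<^sup>2 * (real (n - m n) * (\<beta> * growth \<beta> (m n) / (growth \<beta> 1 * real (m n))))"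
      unfolding Q_def by (intro mult_left_mono row_noise_second_moment n mn) auto
    also have "\<dots> = ?q n" unfolding power_divide p2 by (simp add: mult_ac)
    finally show ?thesis by simp
  qed
  have q_lim: "?q \<longlonglongrightarrow> 0"
  proof -
    have "(\<lambda>i. real i powr (\<beta> - 2 * \<alpha>) * (growth \<beta> i / real i powr \<beta>)) \<longlonglongrightarrow> 0 * 1"
      using super by (intro tendsto_mult growth_asymptotics \<alpha>_bounds) real_asymp
    then have "(\<lambda>i. growth \<beta> i / real i powr (2 * \<alpha>)) \<longlonglongrightarrow> 0 * 1"
      by (rule Lim_transform_eventually) (rule eventually_mono[OF eventually_gt_at_top[of 0]], simp add: powr_diff)
    then have lim: "(\<lambda>i. growth \<beta> i / real i powr (2 * \<alpha>)) \<longlonglongrightarrow> 0" by simp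
    then have "?q \<longlonglongrightarrow> \<beta> * \<gamma> * (1 - \<gamma>) * (0 / growth \<beta> 1)"
      using growth_pos[OF \<alpha>_bounds(4), of 1]
      by (intro tendsto_mult tendsto_divide row_variance_limit tendsto_const filterlim_compose[OF lim m_at_top]) auto
    then show ?thesis by simp
  qed
  have "(\<lambda>n. expectation (\<lambda>\<omega>. (?Z n \<omega> - mix \<gamma> * M \<omega>)\<^sup>2)) \<longlonglongrightarrow> 0"
  proof (rule tendsto_sandwich[OF _ _ tendsto_const])
    show "\<forall>\<^sub>F n in sequentially. 0 \<le> expectation (\<lambda>\<omega>. (?Z n \<omega> - mix \<gamma> * M \<omega>)\<^sup>2)"
      by (simp add: integral_nonneg)
    show "\<forall>\<^sub>F n in sequentially. expectation (\<lambda>\<omega>. (?Z n \<omega> - mix \<gamma> * M \<omega>)\<^sup>2)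
      \<le> 3 * (expectation (\<lambda>\<omega>. (E n \<omega>)\<^sup>2) + (mix (ratio n) - mix \<gamma>)\<^sup>2 * expectation (\<lambda>\<omega>. (M \<omega>)\<^sup>2) + ?q n)"
      using eventually_ge_at_top[of 1] by eventually_elim (rule bound)
    have "(\<lambda>n. 3 * (expectation (\<lambda>\<omega>. (E n \<omega>)\<^sup>2) + (mix (ratio n) - mix \<gamma>)\<^sup>2 * expectation (\<lambda>\<omega>. (M \<omega>)\<^sup>2) + ?q n))
       \<longlonglongrightarrow> 3 * (0 + (mix \<gamma> - mix \<gamma>)\<^sup>2 * expectation (\<lambda>\<omega>. (M \<omega>)\<^sup>2) + 0)"
      unfolding E_def
      by (intro tendsto_mult tendsto_add tendsto_const tendsto_power tendsto_diff mix_lim q_lim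
          filterlim_compose[OF W_lim m_at_top])
    then show "(\<lambda>n. 3 * (expectation (\<lambda>\<omega>. (E n \<omega>)\<^sup>2) + (mix (ratio n) - mix \<gamma>)\<^sup>2 * expectation (\<lambda>\<omega>. (M \<omega>)\<^sup>2) + ?q n)) \<longlonglongrightarrow> 0"
      by simp
  qed
  moreover have "square_integrable P (\<lambda>\<omega>. ?Z n \<omega>)" for n
    using square_integrable_array_walk[of "ratio n / real (m n) powr \<alpha>" n] by simp
  moreover have "square_integrable P (\<lambda>\<omega>. mix \<gamma> * M \<omega>)"
    using M2 by (simp add: square_integrable_def power_mult_distrib)
  ultimately show ?thesis unfolding converges_in_L2_def by blast
qed

end

section \<open>The limit theorem\<close>

theorem theorem5p1:
  fixes P :: "'a measure"
    and s p q r \<alpha> \<beta> \<gamma> :: real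
    and m :: "nat \<Rightarrow> nat"
    and \<gamma>s :: "nat \<Rightarrow> real"
    and X \<xi> :: "nat \<Rightarrow> 'a \<Rightarrow> real"
    and U :: "nat \<Rightarrow> 'a \<Rightarrow> nat"
    and V :: "nat \<Rightarrow> nat \<Rightarrow> 'a \<Rightarrow> nat"
    and \<eta> :: "nat \<Rightarrow> nat \<Rightarrow> 'a \<Rightarrow> real"
    and T \<Sigma> W :: "nat \<Rightarrow> 'a \<Rightarrow> real"
  assumes "erw_stops_array P s p q r m X U \<xi> V \<eta>"
    and "\<alpha> = p - q"
    and "\<beta> = 1 - r"
    and "\<And>n. \<gamma>s n = real (m n) / real n"
    and "filterlim m at_top sequentially"
    and "\<gamma>s \<longlonglongrightarrow> \<gamma>"
    and "T = array_walk m X V \<eta>"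
    and "\<Sigma> = num_moves X"
    and "W = walk X"
  shows
    "(\<alpha> < \<beta> / 2 \<longrightarrow>
        converges_in_distribution P (\<lambda>n \<omega>. \<gamma>s n * T n \<omega> / sqrt (\<Sigma> (m n) \<omega>))
          (centered_normal
            (\<beta> * (\<gamma> + \<alpha> * (1 - \<gamma>))\<^sup>2 / (\<beta> - 2 * \<alpha>) + \<beta> * \<gamma> * (1 - \<gamma>)))) \<and>
     (\<alpha> = \<beta> / 2 \<longrightarrow>
        converges_in_distribution P
          (\<lambda>n \<omega>. \<gamma>s n * T n \<omega> / sqrt (\<Sigma> (m n) \<omega> * ln (\<Sigma> (m n) \<omega>)))
          (centered_normal ((\<gamma> + \<beta> * (1 - \<gamma>) / 2)\<^sup>2))) \<and>
     (\<alpha> > \<beta> / 2 \<longrightarrow>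
        (\<forall>M. M \<in> borel_measurable P \<longrightarrow>
             (AE \<omega> in P. (\<lambda>n. W n \<omega> / real n powr \<alpha>) \<longlonglongrightarrow> M \<omega>) \<longrightarrow>
             converges_in_L2 P (\<lambda>n \<omega>. W n \<omega> / real n powr \<alpha>) M \<longrightarrow>
          converges_in_L2 P (\<lambda>n \<omega>. \<gamma>s n * T n \<omega> / real (m n) powr \<alpha>)
            (\<lambda>\<omega>. (\<gamma> + \<alpha> * (1 - \<gamma>)) * M \<omega>) \<and>
          converges_in_distribution P
            (\<lambda>n \<omega>. (\<gamma>s n * T n \<omega> - M \<omega> * (\<gamma>s n + \<alpha> * (1 - \<gamma>s n)) * real (m n) powr \<alpha>)
                     / sqrt (\<Sigma> (m n) \<omega>))
            (centered_normal
              (\<beta> * (\<gamma> + \<alpha> * (1 - \<gamma>))\<^sup>2 / (2 * \<alpha> - \<beta>) + \<beta> * \<gamma> * (1 - \<gamma>)))))"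
proof -
  interpret E: erw_stops_array P s p q r m X U \<xi> V \<eta> by fact
  interpret E: erw_stops_limit P s p q r m X U \<xi> V \<eta> \<gamma>
    by unfold_locales (use assms(4-6) in \<open>simp_all flip: assms(4)\<close>)
  have \<alpha>: "E.\<alpha> = \<alpha>" and \<beta>: "E.\<beta> = \<beta>"
    using assms(2,3) by (simp_all add: E.\<alpha>_def E.\<beta>_def)
  have ratio: "E.ratio = \<gamma>s" using assms(4) by (simp add: E.ratio_def fun_eq_iff)
  have mix: "E.mix g = g + \<alpha> * (1 - g)" for g by (simp add: E.mix_def \<alpha>)
  have T: "T = array_walk m X V \<eta>" and \<Sigma>: "\<Sigma> = num_moves X" and W: "W = walk X" by fact+
  note eqs = \<alpha> \<beta> ratio mix
  show ?thesis
    unfolding T \<Sigma> W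
  proof (intro conjI impI allI)
    assume "\<alpha> < \<beta> / 2"
    then show "converges_in_distribution P (\<lambda>n \<omega>. \<gamma>s n * array_walk m X V \<eta> n \<omega> / sqrt (num_moves X (m n) \<omega>))
        (centered_normal (\<beta> * (\<gamma> + \<alpha> * (1 - \<gamma>))\<^sup>2 / (\<beta> - 2 * \<alpha>) + \<beta> * \<gamma> * (1 - \<gamma>)))"
      using E.subcritical_clt unfolding eqs by blast
  next
    assume crit: "\<alpha> = \<beta> / 2"
    then have "converges_in_distribution P
        (\<lambda>n \<omega>. \<gamma>s n * array_walk m X V \<eta> n \<omega> / sqrt (num_moves X (m n) \<omega> * ln (num_moves X (m n) \<omega>)))
        (centered_normal ((\<gamma> + \<alpha> * (1 - \<gamma>))\<^sup>2))"
      using E.critical_clt unfolding eqs by blast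
    then show "converges_in_distribution P
        (\<lambda>n \<omega>. \<gamma>s n * array_walk m X V \<eta> n \<omega> / sqrt (num_moves X (m n) \<omega> * ln (num_moves X (m n) \<omega>)))
        (centered_normal ((\<gamma> + \<beta> * (1 - \<gamma>) / 2)\<^sup>2))"
      by (simp add: crit)
  next
    fix M assume super: "\<alpha> > \<beta> / 2" and "M \<in> borel_measurable P"
      and "AE \<omega> in P. (\<lambda>n. walk X n \<omega> / real n powr \<alpha>) \<longlonglongrightarrow> M \<omega>"
    then show "converges_in_distribution P
        (\<lambda>n \<omega>. (\<gamma>s n * array_walk m X V \<eta> n \<omega> - M \<omega> * (\<gamma>s n + \<alpha> * (1 - \<gamma>s n)) * real (m n) powr \<alpha>)
           / sqrt (num_moves X (m n) \<omega>))
        (centered_normal (\<beta> * (\<gamma> + \<alpha> * (1 - \<gamma>))\<^sup>2 / (2 * \<alpha> - \<beta>) + \<beta> * \<gamma> * (1 - \<gamma>)))"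
      using E.supercritical_clt unfolding eqs by blast
  next
    fix M assume "\<alpha> > \<beta> / 2" and "converges_in_L2 P (\<lambda>n \<omega>. walk X n \<omega> / real n powr \<alpha>) M"
    then show "converges_in_L2 P (\<lambda>n \<omega>. \<gamma>s n * array_walk m X V \<eta> n \<omega> / real (m n) powr \<alpha>)
        (\<lambda>\<omega>. (\<gamma> + \<alpha> * (1 - \<gamma>)) * M \<omega>)"
      using E.supercritical_L2 unfolding eqs by blast
  qed
qed

end
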